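(* Let $A$ be the set consisting of all integer compositions with more than one part together with the unique composition $(1)$ of $1$. Let $\mathcal{H}$ be the commutative $\Bbbk$-algebra generated freely by $A$, where for every $n\ge 1$ the composition $(n)$ is defined to be the product $(1)^n\in\mathcal{H}$, and the empty composition $\varnothing$ is the unit $1\in\mathcal{H}$. For $\alpha\in A$ define $$\Delta(\alpha) := \sum_{\substack{\beta\cdot\gamma=\alpha\\ \text{or}\\ \beta\odot\gamma=\alpha}}\binom{|\alpha|}{|\beta|}\,\beta\otimes\gamma ,$$ where the sum is over pairs of compositions $(\beta,\gamma)$ whose concatenation $\beta\cdot\gamma$ or near-concatenation $\beta\odot\gamma$ equals $\alpha$, and extend $\Delta$ to an algebra homomorphism $\mathcal{H}\to\mathcal{H}\otimes\mathcal{H}$. Then $\Delta$ makes $\mathcal{H}$ (graded by $\deg\alpha=|\alpha|$) into a graded Hopf algebra which is isomorphic, as a graded Hopf algebra, to the Hopf algebra of normal equivalence classes of orbit polytopes.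
   Context: $\Bbbk$ is a field. Compositions. A composition of an integer $n\ge 0$ is a finite sequence of positive integers (its parts) with sum $n$; $\varnothing$ is the unique composition of $0$; $|\alpha|$ is the sum of the parts of $\alpha$. The concatenation of $\beta=(\beta_1,\dots,\beta_k)$ and $\gamma=(\gamma_1,\dots,\gamma_\ell)$ is $\beta\cdot\gamma=(\beta_1,\dots,\beta_k,\gamma_1,\dots,\gamma_\ell)$; for nonempty $\beta,\gamma$ the near-concatenation is $\beta\odot\gamma=(\beta_1,\dots,\beta_{k-1},\beta_k+\gamma_1,\gamma_2,\dots,\gamma_\ell)$. Orbit polytopes. For a finite set $I$, $\mathbb{R}I$ is the real vector space with basis $\{e_i:i\in I\}$ and $\mathbb{R}^I$ its dual space. The group $\mathfrak{S}_I$ of permutations of $I$ acts on $\mathbb{R}I$ by $\sigma(p)_i=p_{\sigma^{-1}(i)}$. The orbit polytope of $p\in\mathbb{R}I$ is $\mathcal{O}(p)=\operatorname{conv}\{\sigma(p):\sigma\in\mathfrak{S}_I\}$. For polytopes $P\subset\mathbb{R}S$, $Q\subset\mathbb{R}T$ with $S\cap T=\varnothing$, the product is $P\cdot Q=\{(p,q):p\in P,q\in Q\}\subset\mathbb{R}(S\sqcup T)$; its identity is the unique orbit polytope (a point) in $\mathbb{R}\varnothing$. Normal equivalence. For a face $F$ of a polytope $P\subset\mathbb{R}I$, $\mathcal{N}_P(F)$ is the cone of all $y\in\mathbb{R}^I$ attaining their maximum over $P$ at every point of $F$; the normal fan is $\mathcal{N}_P=\{\mathcal{N}_P(F):F\le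 P\}$; $P,Q$ are normally equivalent if $\mathcal{N}_P=\mathcal{N}_Q$. Hopf structure. $\overline{\mathrm{OP}}[I]$ is the set of normal equivalence classes of finite products of orbit polytopes lying in $\mathbb{R}I$ (products taken along partitions of $I$); a bijection $\sigma:I\to J$ induces a relabeling map $\overline{\mathrm{OP}}[\sigma]:\overline{\mathrm{OP}}[I]\to\overline{\mathrm{OP}}[J]$ by relabeling basis vectors. For $I=S\sqcup T$ and $P$ a finite product of orbit polytopes in $\mathbb{R}I$, the face of $P$ maximizing $\mathbf{1}_S(x)=\sum_{s\in S}x_s$ is uniquely of the form $P|_S\cdot P/_S$ with $P|_S\subset\mathbb{R}S$, $P/_S\subset\mathbb{R}T$ finite products of orbit polytopes. Both $\cdot$ and $P\mapsto(P|_S,P/_S)$ are well defined on normal equivalence classes. The Hopf algebra of normal equivalence classes of orbit polytopes (the image of $\overline{\mathrm{OP}}$ under linearization followed by the first Fock functor) is the graded vector space $\bigoplus_{n\ge 0}\operatorname{Span}_{\Bbbk}\{\text{isomorphism classes } [x] \text{ of elements } x\in\overline{\mathrm{OP}}[I],\ |I|=n\}$, where $x\in\overline{\mathrm{OP}}[I]$ and $y\in\overline{\mathrm{OP}}[J]$ are isomorphic if $\overline{\mathrm{OP}}[\sigma](x)=y$ for some bijection $\sigma:I\to J$. Its product is $[x][y]=[x\cdot y]$ (with $x,y$ represented on disjoint label sets) and its coproduct is $\Delta([x])=\sum_{I=S\sqcup T}[x|_S]\otimes[x/_S]$ for $x\in\overline{\mathrm{OP}}[I]$, the sum being over all ordered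 pairs $(S,T)$ of disjoint, possibly empty, sets with union $I$. *)

theory Defs
  imports "HOL-Analysis.Analysis" "HOL-Analysis.Finite_Function_Topology"
begin

section \<open>Graded Hopf algebras\<close>

text \<open>
  A \<open>'k\<close>-vector space with basis indexed by the type \<open>'b\<close> is represented as
  \<open>'b \<Rightarrow>\<^sub>0 'k\<close>, and the tensor product of the spaces with bases \<open>'b\<close> and \<open>'c\<close>
  as \<open>'b \<times> 'c \<Rightarrow>\<^sub>0 'k\<close>; its universal property is \<open>tensor_universal\<close> below.
\<close>

definition pscale :: "'k::field \<Rightarrow> ('b \<Rightarrow>\<^sub>0 'k) \<Rightarrow> ('b \<Rightarrow>\<^sub>0 'k)" where
  "pscale c f = Poly_Mapping.map ((*) c) f"

definition basis_vec :: "'b \<Rightarrow> ('b \<Rightarrow>\<^sub>0 'k::field)" where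
  "basis_vec b = Poly_Mapping.single b 1"

abbreviation linear_map :: "(('b \<Rightarrow>\<^sub>0 'k::field) \<Rightarrow> ('c \<Rightarrow>\<^sub>0 'k)) \<Rightarrow> bool" where
  "linear_map \<equiv> Vector_Spaces.linear pscale pscale"

abbreviation linear_form :: "(('b \<Rightarrow>\<^sub>0 'k::field) \<Rightarrow> 'k) \<Rightarrow> bool" where
  "linear_form \<equiv> Vector_Spaces.linear pscale (*)"

definition bilinear_map ::
  "(('a \<Rightarrow>\<^sub>0 'k::field) \<Rightarrow> ('b \<Rightarrow>\<^sub>0 'k) \<Rightarrow> ('c \<Rightarrow>\<^sub>0 'k)) \<Rightarrow> bool" where
  "bilinear_map B \<longleftrightarrow> (\<forall>f. linear_map (B f)) \<and> (\<forall>g. linear_map (\<lambda>f. B f g))"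

text \<open>The linear map with prescribed values on the basis.\<close>

definition lin_ext :: "('b \<Rightarrow> ('c \<Rightarrow>\<^sub>0 'k::field)) \<Rightarrow> ('b \<Rightarrow>\<^sub>0 'k) \<Rightarrow> ('c \<Rightarrow>\<^sub>0 'k)" where
  "lin_ext h f = (\<Sum>b\<in>Poly_Mapping.keys f. pscale (Poly_Mapping.lookup f b) (h b))"

definition tensor :: "('b \<Rightarrow>\<^sub>0 'k::field) \<Rightarrow> ('c \<Rightarrow>\<^sub>0 'k) \<Rightarrow> ('b \<times> 'c \<Rightarrow>\<^sub>0 'k)" where
  "tensor f g = lin_ext (\<lambda>b. lin_ext (\<lambda>c. basis_vec (b, c)) g) f"

definition tensor_map ::
  "(('a \<Rightarrow>\<^sub>0 'k::field) \<Rightarrow> ('c \<Rightarrow>\<^sub>0 'k)) \<Rightarrow> (('b \<Rightarrow>\<^sub>0 'k) \<Rightarrow> ('d \<Rightarrow>\<^sub>0 'k))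
    \<Rightarrow> ('a \<times> 'b \<Rightarrow>\<^sub>0 'k) \<Rightarrow> ('c \<times> 'd \<Rightarrow>\<^sub>0 'k)" where
  "tensor_map \<phi> \<psi> = lin_ext (\<lambda>(a, b). tensor (\<phi> (basis_vec a)) (\<psi> (basis_vec b)))"

definition tensor_assoc :: "(('a \<times> 'b) \<times> 'c \<Rightarrow>\<^sub>0 'k::field) \<Rightarrow> ('a \<times> 'b \<times> 'c \<Rightarrow>\<^sub>0 'k)" where
  "tensor_assoc = lin_ext (\<lambda>((a, b), c). basis_vec (a, b, c))"

text \<open>\<open>\<epsilon> \<otimes> id\<close> and \<open>id \<otimes> \<epsilon>\<close> for a linear form \<open>\<epsilon>\<close>, with \<open>\<bbbk> \<otimes> V\<close> and \<open>V \<otimes> \<bbbk>\<close> identified with \<open>V\<close>.\<close>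

definition form_left :: "(('a \<Rightarrow>\<^sub>0 'k::field) \<Rightarrow> 'k) \<Rightarrow> ('a \<times> 'b \<Rightarrow>\<^sub>0 'k) \<Rightarrow> ('b \<Rightarrow>\<^sub>0 'k)" where
  "form_left \<epsilon> = lin_ext (\<lambda>(a, b). pscale (\<epsilon> (basis_vec a)) (basis_vec b))"

definition form_right :: "(('b \<Rightarrow>\<^sub>0 'k::field) \<Rightarrow> 'k) \<Rightarrow> ('a \<times> 'b \<Rightarrow>\<^sub>0 'k) \<Rightarrow> ('a \<Rightarrow>\<^sub>0 'k)" where
  "form_right \<epsilon> = lin_ext (\<lambda>(a, b). pscale (\<epsilon> (basis_vec b)) (basis_vec a))"

record (overloaded) ('b, 'k::field) hopf =
  degree :: "'b \<Rightarrow> nat"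
  mult :: "('b \<Rightarrow>\<^sub>0 'k) \<Rightarrow> ('b \<Rightarrow>\<^sub>0 'k) \<Rightarrow> ('b \<Rightarrow>\<^sub>0 'k)"
  unit :: "'b \<Rightarrow>\<^sub>0 'k"
  comult :: "('b \<Rightarrow>\<^sub>0 'k) \<Rightarrow> ('b \<times> 'b \<Rightarrow>\<^sub>0 'k)"
  counit :: "('b \<Rightarrow>\<^sub>0 'k) \<Rightarrow> 'k"
  antipode :: "('b \<Rightarrow>\<^sub>0 'k) \<Rightarrow> ('b \<Rightarrow>\<^sub>0 'k)"

text \<open>The multiplication as a linear map on the tensor square, and the product of the tensor square.\<close>

definition mult_tensor :: "('b, 'k::field) hopf \<Rightarrow> ('b \<times> 'b \<Rightarrow>\<^sub>0 'k) \<Rightarrow> ('b \<Rightarrow>\<^sub>0 'k)" where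
  "mult_tensor A = lin_ext (\<lambda>(a, b). mult A (basis_vec a) (basis_vec b))"

definition tensor_mult ::
  "('b, 'k::field) hopf \<Rightarrow> ('b \<times> 'b \<Rightarrow>\<^sub>0 'k) \<Rightarrow> ('b \<times> 'b \<Rightarrow>\<^sub>0 'k) \<Rightarrow> ('b \<times> 'b \<Rightarrow>\<^sub>0 'k)" where
  "tensor_mult A s t =
     lin_ext (\<lambda>(a, b). lin_ext (\<lambda>(c, d).
       tensor (mult A (basis_vec a) (basis_vec c)) (mult A (basis_vec b) (basis_vec d))) t) s"

text \<open>
  The degree \<open>n\<close> component is the span of the basis elements of degree \<open>n\<close>, so the space is
  the direct sum of these components. For the tensor square the degree of \<open>(a, b)\<close> is the sum of
  the degrees, which yields \<open>\<Oplus>\<^bsub>i+j=n\<^esub> V\<^sub>i \<otimes> V\<^sub>j\<close>.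
\<close>

definition homogeneous :: "('b \<Rightarrow> nat) \<Rightarrow> nat \<Rightarrow> ('b \<Rightarrow>\<^sub>0 'k::field) set" where
  "homogeneous d n = {f. \<forall>b\<in>Poly_Mapping.keys f. d b = n}"

definition graded_algebra :: "('b, 'k::field) hopf \<Rightarrow> bool" where
  "graded_algebra A \<longleftrightarrow>
     bilinear_map (mult A) \<and>
     (\<forall>f g h. mult A (mult A f g) h = mult A f (mult A g h)) \<and>
     (\<forall>f. mult A (unit A) f = f \<and> mult A f (unit A) = f) \<and>
     unit A \<in> homogeneous (degree A) 0 \<and>
     (\<forall>m n. \<forall>f\<in>homogeneous (degree A) m. \<forall>g\<in>homogeneous (degree A) n.
        mult A f g \<in> homogeneous (degree A) (m + n))"

definition graded_coalgebra :: "('b, 'k::field) hopf \<Rightarrow> bool" where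
  "graded_coalgebra A \<longleftrightarrow>
     linear_map (comult A) \<and> linear_form (counit A) \<and>
     (\<forall>f. tensor_assoc (tensor_map (comult A) id (comult A f)) =
          tensor_map id (comult A) (comult A f)) \<and>
     (\<forall>f. form_left (counit A) (comult A f) = f \<and> form_right (counit A) (comult A f) = f) \<and>
     (\<forall>n. \<forall>f\<in>homogeneous (degree A) n.
        comult A f \<in> homogeneous (\<lambda>(a, b). degree A a + degree A b) n) \<and>
     (\<forall>n>0. \<forall>f\<in>homogeneous (degree A) n. counit A f = 0)"

definition graded_bialgebra :: "('b, 'k::field) hopf \<Rightarrow> bool" where
  "graded_bialgebra A \<longleftrightarrow>
     graded_algebra A \<and> graded_coalgebra A \<and>
     (\<forall>f g. comult A (mult A f g) = tensor_mult A (comult A f) (comult A g)) \<and>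
     comult A (unit A) = tensor (unit A) (unit A) \<and>
     (\<forall>f g. counit A (mult A f g) = counit A f * counit A g) \<and>
     counit A (unit A) = 1"

definition graded_hopf_algebra :: "('b, 'k::field) hopf \<Rightarrow> bool" where
  "graded_hopf_algebra A \<longleftrightarrow>
     graded_bialgebra A \<and>
     linear_map (antipode A) \<and>
     (\<forall>f. mult_tensor A (tensor_map (antipode A) id (comult A f)) = pscale (counit A f) (unit A)) \<and>
     (\<forall>f. mult_tensor A (tensor_map id (antipode A) (comult A f)) = pscale (counit A f) (unit A)) \<and>
     (\<forall>n. \<forall>f\<in>homogeneous (degree A) n. antipode A f \<in> homogeneous (degree A) n)"

definition graded_hopf_iso ::
  "('b, 'k::field) hopf \<Rightarrow> ('c, 'k) hopf \<Rightarrow> (('b \<Rightarrow>\<^sub>0 'k) \<Rightarrow> ('c \<Rightarrow>\<^sub>0 'k)) \<Rightarrow> bool" where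
  "graded_hopf_iso A B \<phi> \<longleftrightarrow>
     linear_map \<phi> \<and> bij \<phi> \<and>
     (\<forall>n. \<phi> ` homogeneous (degree A) n = homogeneous (degree B) n) \<and>
     (\<forall>f g. \<phi> (mult A f g) = mult B (\<phi> f) (\<phi> g)) \<and>
     \<phi> (unit A) = unit B \<and>
     (\<forall>f. comult B (\<phi> f) = tensor_map \<phi> \<phi> (comult A f)) \<and>
     (\<forall>f. counit B (\<phi> f) = counit A f) \<and>
     (\<forall>f. antipode B (\<phi> f) = \<phi> (antipode A f))"

definition graded_hopf_isomorphic :: "('b, 'k::field) hopf \<Rightarrow> ('c, 'k) hopf \<Rightarrow> bool" where
  "graded_hopf_isomorphic A B \<longleftrightarrow> (\<exists>\<phi>. graded_hopf_iso A B \<phi>)"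

lemma lookup_pscale [simp]: "Poly_Mapping.lookup (pscale c f) b = c * Poly_Mapping.lookup f b"
  by (simp add: pscale_def Poly_Mapping.map.rep_eq when_def)

lemma vector_space_pscale: "vector_space pscale"
  by unfold_locales (auto intro!: poly_mapping_eqI simp: lookup_add algebra_simps)

interpretation pscale: vector_space "pscale :: 'k::field \<Rightarrow> ('b \<Rightarrow>\<^sub>0 'k) \<Rightarrow> _"
  by (rule vector_space_pscale)

lemma lin_ext_superset:
  assumes "finite X" "Poly_Mapping.keys f \<subseteq> X"
  shows "lin_ext h f = (\<Sum>b\<in>X. pscale (Poly_Mapping.lookup f b) (h b))"
  unfolding lin_ext_def using assms
  by (intro sum.mono_neutral_left) (auto simp: in_keys_iff)

lemma linear_lin_ext:
  fixes h :: "'b \<Rightarrow> ('c \<Rightarrow>\<^sub>0 'k::field)"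
  shows "linear_map (lin_ext h)"
proof (unfold linear_iff_module_hom, unfold_locales)
  fix f g :: "'b \<Rightarrow>\<^sub>0 'k"
  let ?X = "Poly_Mapping.keys f \<union> Poly_Mapping.keys g"
  have "lin_ext h (f + g) = (\<Sum>b\<in>?X. pscale (Poly_Mapping.lookup (f + g) b) (h b))"
    by (rule lin_ext_superset) (auto dest: subsetD[OF Poly_Mapping.keys_add])
  also have "\<dots> = lin_ext h f + lin_ext h g"
    by (simp add: lookup_add pscale.scale_left_distrib sum.distrib
        lin_ext_superset[of ?X f] lin_ext_superset[of ?X g])
  finally show "lin_ext h (f + g) = lin_ext h f + lin_ext h g" .
next
  fix c and f :: "'b \<Rightarrow>\<^sub>0 'k"
  have "lin_ext h (pscale c f) =
      (\<Sum>b\<in>Poly_Mapping.keys f. pscale (Poly_Mapping.lookup (pscale c f) b) (h b))"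
    by (rule lin_ext_superset) (auto simp: in_keys_iff)
  then show "lin_ext h (pscale c f) = pscale c (lin_ext h f)"
    by (simp add: lin_ext_def pscale.scale_sum_right)
qed

lemma lin_ext_basis_vec [simp]: "lin_ext h (basis_vec b) = h b"
  by (simp add: lin_ext_def basis_vec_def)

lemma lin_ext_basis_id: "lin_ext basis_vec f = f"
  by (rule poly_mapping_eqI)
     (simp add: lin_ext_def lookup_sum basis_vec_def lookup_single when_def in_keys_iff
        if_distrib[of "(*) _"] cong: if_cong)

lemma linear_eq_lin_ext:
  assumes "linear_map L"
  shows "L f = lin_ext (\<lambda>b. L (basis_vec b)) f"
proof -
  interpret L: Vector_Spaces.linear pscale pscale L by fact
  have "L f = L (lin_ext basis_vec f)"
    by (simp add: lin_ext_basis_id)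
  then show ?thesis
    by (simp only: lin_ext_def L.sum L.scale)
qed

theorem tensor_universal:
  fixes B :: "('a \<Rightarrow>\<^sub>0 'k::field) \<Rightarrow> ('b \<Rightarrow>\<^sub>0 'k) \<Rightarrow> ('c \<Rightarrow>\<^sub>0 'k)"
  assumes "bilinear_map B"
  shows "\<exists>!L. linear_map L \<and> (\<forall>f g. L (tensor f g) = B f g)"
proof -
  define L where "L = lin_ext (\<lambda>(a, b). B (basis_vec a) (basis_vec b))"
  interpret L: Vector_Spaces.linear pscale pscale L
    unfolding L_def by (rule linear_lin_ext)
  have B: "B f g = lin_ext (\<lambda>a. lin_ext (\<lambda>b. B (basis_vec a) (basis_vec b)) g) f" for f g
  proof -
    have "B f g = lin_ext (\<lambda>a. B (basis_vec a) g) f"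
      using assms linear_eq_lin_ext[of "\<lambda>f. B f g" f] by (simp add: bilinear_map_def)
    moreover have "B (basis_vec a) g = lin_ext (\<lambda>b. B (basis_vec a) (basis_vec b)) g" for a
      using assms linear_eq_lin_ext[of "B (basis_vec a)" g] by (simp add: bilinear_map_def)
    ultimately show ?thesis
      by simp
  qed
  have L_basis: "L (basis_vec (a, b)) = B (basis_vec a) (basis_vec b)" for a b
    by (simp add: L_def)
  have "L (tensor f g) = B f g" for f g
    by (rule trans[OF _ B[symmetric]]) (simp add: tensor_def lin_ext_def L.sum L.scale L_basis)
  then have L: "linear_map L \<and> (\<forall>f g. L (tensor f g) = B f g)"
    unfolding L_def using linear_lin_ext by blast
  moreover have "L' = L" if "linear_map L' \<and> (\<forall>f g. L' (tensor f g) = B f g)" for L'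
  proof
    fix t
    have t: "L' (basis_vec p) = L (basis_vec p)" for p
    proof (cases p)
      case (Pair a b)
      have "tensor (basis_vec a) (basis_vec b) = (basis_vec p :: _ \<Rightarrow>\<^sub>0 'k)"
        by (simp add: tensor_def Pair)
      then show ?thesis
        using L that by metis
    qed
    have "L' t = lin_ext (\<lambda>p. L' (basis_vec p)) t" "L t = lin_ext (\<lambda>p. L (basis_vec p)) t"
      using L that linear_eq_lin_ext by blast+
    with t show "L' t = L t"
      by simp
  qed
  ultimately show ?thesis
    by blast
qed


section \<open>The algebra on compositions\<close>

definition composition :: "nat list \<Rightarrow> bool" where
  "composition \<alpha> \<longleftrightarrow> (\<forall>a\<in>set \<alpha>. 0 < a)"

definition near_concat :: "nat list \<Rightarrow> nat list \<Rightarrow> nat list" where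
  "near_concat \<beta> \<gamma> = butlast \<beta> @ [last \<beta> + hd \<gamma>] @ tl \<gamma>"

definition decompositions :: "nat list \<Rightarrow> (nat list \<times> nat list) set" where
  "decompositions \<alpha> = {(\<beta>, \<gamma>). composition \<beta> \<and> composition \<gamma> \<and>
     (\<beta> @ \<gamma> = \<alpha> \<or> \<beta> \<noteq> [] \<and> \<gamma> \<noteq> [] \<and> near_concat \<beta> \<gamma> = \<alpha>)}"

typedef generator = "{\<alpha>. composition \<alpha> \<and> (1 < length \<alpha> \<or> \<alpha> = [1])}"
  morphisms gen_composition Gen
  by (rule exI[of _ "[1]"]) (simp add: composition_def)

text \<open>
  The free commutative algebra on \<open>generator\<close> is the monoid algebra of the free commutative
  monoid \<open>generator multiset\<close>, i.e. the polynomial algebra in the generators.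
  Similarly, multiplication in \<open>monomial \<times> monomial \<Rightarrow>\<^sub>0 'k\<close> is that of
  the tensor product algebra \<open>\<H> \<otimes> \<H>\<close>.
\<close>

type_synonym monomial = "generator multiset"

definition comp_elem :: "nat list \<Rightarrow> (monomial \<Rightarrow>\<^sub>0 'k::field)" where
  "comp_elem \<alpha> =
     (if \<alpha> = [] then 1
      else if length \<alpha> = 1 then Poly_Mapping.single {#Gen [1]#} 1 ^ hd \<alpha>
      else Poly_Mapping.single {#Gen \<alpha>#} 1)"

definition comp_comult_gen :: "generator \<Rightarrow> (monomial \<times> monomial \<Rightarrow>\<^sub>0 'k::field)" where
  "comp_comult_gen a =
     (\<Sum>(\<beta>, \<gamma>)\<in>decompositions (gen_composition a).
        pscale (of_nat (sum_list (gen_composition a) choose sum_list \<beta>))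
          (tensor (comp_elem \<beta>) (comp_elem \<gamma>)))"

text \<open>The extension of the above to an algebra homomorphism.\<close>

definition comp_comult :: "(monomial \<Rightarrow>\<^sub>0 'k::field) \<Rightarrow> (monomial \<times> monomial \<Rightarrow>\<^sub>0 'k)" where
  "comp_comult = lin_ext (\<lambda>M. \<Prod>a\<in>#M. comp_comult_gen a)"

definition comp_degree :: "monomial \<Rightarrow> nat" where
  "comp_degree M = (\<Sum>a\<in>#M. sum_list (gen_composition a))"

definition comp_hopf ::
  "((monomial \<Rightarrow>\<^sub>0 'k::field) \<Rightarrow> 'k) \<Rightarrow> ((monomial \<Rightarrow>\<^sub>0 'k) \<Rightarrow> (monomial \<Rightarrow>\<^sub>0 'k)) \<Rightarrow> (monomial, 'k) hopf" where
  "comp_hopf \<epsilon> S = \<lparr>degree = comp_degree, mult = (*), unit = 1, comult = comp_comult,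
     counit = \<epsilon>, antipode = S\<rparr>"


section \<open>Orbit polytopes\<close>

text \<open>
  Finite label sets are finite sets of natural numbers; every isomorphism class over an arbitrary
  finite label set has a representative of this form. The space \<open>\<real>I\<close> consists
  of those \<open>p :: nat \<Rightarrow>\<^sub>0 real\<close> with \<open>keys p \<subseteq> I\<close>, and its dual \<open>\<real>\<^sup>I\<close> of the
  functions in \<open>I \<rightarrow>\<^sub>E UNIV\<close>.
\<close>

type_synonym polytope = "(nat \<Rightarrow>\<^sub>0 real) set"

definition orbit_polytope :: "nat set \<Rightarrow> (nat \<Rightarrow>\<^sub>0 real) \<Rightarrow> polytope" where
  "orbit_polytope I p = convex hull {Poly_Mapping.map_key (inv \<sigma>) p | \<sigma>. \<sigma> permutes I}"

definition poly_prod :: "polytope \<Rightarrow> polytope \<Rightarrow> polytope" where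
  "poly_prod P Q = {p + q | p q. p \<in> P \<and> q \<in> Q}"

text \<open>
  The empty product, the point in \<open>\<real>\<emptyset>\<close>, is the orbit polytope of \<open>0\<close> for \<open>I = {}\<close>.
\<close>

inductive orbit_product :: "nat set \<Rightarrow> polytope \<Rightarrow> bool" where
  orbit: "finite I \<Longrightarrow> Poly_Mapping.keys p \<subseteq> I \<Longrightarrow> orbit_product I (orbit_polytope I p)"
| product: "orbit_product S P \<Longrightarrow> orbit_product T Q \<Longrightarrow> S \<inter> T = {} \<Longrightarrow>
    orbit_product (S \<union> T) (poly_prod P Q)"

definition pairing :: "nat set \<Rightarrow> (nat \<Rightarrow> real) \<Rightarrow> (nat \<Rightarrow>\<^sub>0 real) \<Rightarrow> real" where
  "pairing I y p = (\<Sum>i\<in>I. y i * Poly_Mapping.lookup p i)"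

definition normal_cone :: "nat set \<Rightarrow> polytope \<Rightarrow> polytope \<Rightarrow> (nat \<Rightarrow> real) set" where
  "normal_cone I P F = {y \<in> I \<rightarrow>\<^sub>E UNIV. \<forall>p\<in>F. \<forall>q\<in>P. pairing I y q \<le> pairing I y p}"

definition normal_fan :: "nat set \<Rightarrow> polytope \<Rightarrow> (nat \<Rightarrow> real) set set" where
  "normal_fan I P = {normal_cone I P F | F. F face_of P \<and> F \<noteq> {}}"

definition normal_class :: "nat set \<Rightarrow> polytope \<Rightarrow> polytope set" where
  "normal_class I P = {Q. orbit_product I Q \<and> normal_fan I Q = normal_fan I P}"

definition OP_bar :: "nat set \<Rightarrow> polytope set set" where
  "OP_bar I = {normal_class I P | P. orbit_product I P}"

definition relabel :: "(nat \<Rightarrow> nat) \<Rightarrow> (nat \<Rightarrow>\<^sub>0 real) \<Rightarrow> (nat \<Rightarrow>\<^sub>0 real)" where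
  "relabel \<sigma> p = (\<Sum>i\<in>Poly_Mapping.keys p. Poly_Mapping.single (\<sigma> i) (Poly_Mapping.lookup p i))"

definition max_face :: "nat set \<Rightarrow> polytope \<Rightarrow> polytope" where
  "max_face S P = {p \<in> P. \<forall>q\<in>P.
     (\<Sum>s\<in>S. Poly_Mapping.lookup q s) \<le> (\<Sum>s\<in>S. Poly_Mapping.lookup p s)}"

definition face_factors :: "nat set \<Rightarrow> nat set \<Rightarrow> polytope \<Rightarrow> polytope \<times> polytope" where
  "face_factors S T P =
     (THE (A, B). orbit_product S A \<and> orbit_product T B \<and> max_face S P = poly_prod A B)"

text \<open>
  Operations on normal equivalence classes: a union over all representatives of a family of
  classes that does not depend on the representative, as in \<open>HOL.Equiv_Relations\<close>. In the
  restriction and contraction, \<open>S\<close> and \<open>T\<close> are the two blocks of \<open>I = S \<squnion> T\<close>.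
\<close>

definition class_relabel :: "nat set \<Rightarrow> (nat \<Rightarrow> nat) \<Rightarrow> polytope set \<Rightarrow> polytope set" where
  "class_relabel J \<sigma> x = (\<Union>P\<in>x. normal_class J (relabel \<sigma> ` P))"

definition class_prod :: "nat set \<Rightarrow> polytope set \<Rightarrow> polytope set \<Rightarrow> polytope set" where
  "class_prod I x y = (\<Union>P\<in>x. \<Union>Q\<in>y. normal_class I (poly_prod P Q))"

definition class_restrict :: "nat set \<Rightarrow> nat set \<Rightarrow> polytope set \<Rightarrow> polytope set" where
  "class_restrict S T x = (\<Union>P\<in>x. normal_class S (fst (face_factors S T P)))"

definition class_contract :: "nat set \<Rightarrow> nat set \<Rightarrow> polytope set \<Rightarrow> polytope set" where
  "class_contract S T x = (\<Union>P\<in>x. normal_class T (snd (face_factors S T P)))"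

text \<open>
  An isomorphism class is the set of all \<open>(J, y)\<close> with \<open>y \<in> OP_bar J\<close> isomorphic to a given
  \<open>x \<in> OP_bar I\<close>. The label set is recorded since \<open>x\<close> does not determine it.
\<close>

definition iso_class :: "nat set \<Rightarrow> polytope set \<Rightarrow> (nat set \<times> polytope set) set" where
  "iso_class I x =
     {(J, y). finite J \<and> y \<in> OP_bar J \<and> (\<exists>\<sigma>. bij_betw \<sigma> I J \<and> class_relabel J \<sigma> x = y)}"

typedef op_class = "{iso_class I x | I x. finite I \<and> x \<in> OP_bar I}"
  morphisms representatives Abs_op_class
proof -
  have "orbit_product {} (orbit_polytope {} 0)"
    by (rule orbit) auto
  then show ?thesis
    unfolding OP_bar_def by blast
qed

abbreviation op_cls :: "nat set \<Rightarrow> polytope set \<Rightarrow> op_class" where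
  "op_cls I x \<equiv> Abs_op_class (iso_class I x)"

definition op_degree :: "op_class \<Rightarrow> nat" where
  "op_degree c = (THE n. \<exists>I x. (I, x) \<in> representatives c \<and> n = card I)"

definition op_basis_mult :: "op_class \<Rightarrow> op_class \<Rightarrow> op_class" where
  "op_basis_mult c d = (THE e. \<exists>I x J y. (I, x) \<in> representatives c \<and> (J, y) \<in> representatives d \<and>
     I \<inter> J = {} \<and> e = op_cls (I \<union> J) (class_prod (I \<union> J) x y))"

definition op_mult ::
  "(op_class \<Rightarrow>\<^sub>0 'k::field) \<Rightarrow> (op_class \<Rightarrow>\<^sub>0 'k) \<Rightarrow> (op_class \<Rightarrow>\<^sub>0 'k)" where
  "op_mult f g = lin_ext (\<lambda>c. lin_ext (\<lambda>d. basis_vec (op_basis_mult c d)) g) f"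

definition op_unit :: "op_class \<Rightarrow>\<^sub>0 'k::field" where
  "op_unit = basis_vec (op_cls {} (normal_class {} (orbit_polytope {} 0)))"

definition op_basis_comult :: "op_class \<Rightarrow> (op_class \<times> op_class \<Rightarrow>\<^sub>0 'k::field)" where
  "op_basis_comult c = (THE t. \<exists>I x. (I, x) \<in> representatives c \<and>
     t = (\<Sum>(S, T) \<in> {(S, T). S \<union> T = I \<and> S \<inter> T = {}}.
            tensor (basis_vec (op_cls S (class_restrict S T x)))
                   (basis_vec (op_cls T (class_contract S T x)))))"

definition op_comult :: "(op_class \<Rightarrow>\<^sub>0 'k::field) \<Rightarrow> (op_class \<times> op_class \<Rightarrow>\<^sub>0 'k)" where
  "op_comult = lin_ext op_basis_comult"

definition op_hopf ::
  "((op_class \<Rightarrow>\<^sub>0 'k::field) \<Rightarrow> 'k) \<Rightarrow> ((op_class \<Rightarrow>\<^sub>0 'k) \<Rightarrow> (op_class \<Rightarrow>\<^sub>0 'k)) \<Rightarrow> (op_class, 'k) hopf" where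
  "op_hopf \<epsilon> S = \<lparr>degree = op_degree, mult = op_mult, unit = op_unit, comult = op_comult,
     counit = \<epsilon>, antipode = S\<rparr>"

end

theory Submission
  imports Defs
begin

text \<open>
  An orbit polytope with coordinates \<open>p\<close> is determined up to normal equivalence by the run lengths of
  its weakly decreasing list of coordinates, a composition. Two products of orbit polytopes are
  normally equivalent iff every linear functional \<open>y\<close> whose maximal face is contained in that of \<open>y'\<close>
  for one of them has this property for the other. Functionals constant on blocks recover the
  partition into blocks from this preorder, and generic functionals with two adjacent coordinates
  exchanged recover the compositions. Hence, once points are split into points on single labels,
  isomorphism classes correspond to multisets of generators. The face of an orbit polytope
  maximizing \<open>1\<^sub>S\<close> cuts the decreasing list of coordinates after \<open>card S\<close> entries, so counting subsets
  by cardinality turns the geometric coproduct into the binomial coproduct on compositions. The latter is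
  coassociative because iterated cuts are counted by multinomial coefficients, and its antipode is
  an inverse in the convolution algebra of functions on compositions.
\<close>

text \<open>The Hopf axioms are verified for compositions only. The map \<open>op_of\<close> is a
  bijection between the two bases, and it suffices that it respects degree, product, unit and
  coproduct: counit and antipode of polytopes are then transported, and the axioms follow by
  conjugation. The first obstacle is that \<open>normal_fan\<close> is indexed by all nonempty
  faces, whereas functionals only see exposed ones. Farkas' lemma shows that every nonempty face is
  exposed; only then are the fan and the preorder \<open>amax_le\<close> interchangeable. The second
  obstacle is that a product of orbit polytopes is a bare set, which does not remember its factors
  and may be written as a product in several ways, since points split. So the monomial enters as a
  relation \<open>orbit_monomial\<close>, not as a function, and
  \<open>orbit_monomial_unique\<close> shows that the preorder determines it. Normal equivalence
  thereby becomes the inductive relation \<open>orbit_equiv\<close>, whose invariance under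
  relabelling and maximal faces is a rule induction. On the algebraic side, a decomposition of a
  composition is encoded by its cut position, so that sums over pairs become sums over
  \<open>k\<close>.\<close>

abbreviation "supp \<equiv> Poly_Mapping.keys"
abbreviation "coord \<equiv> Poly_Mapping.lookup"

subsection \<open>Linear maps and tensor products\<close>

lemma linear_mapI:
  assumes "\<And>f g. L (f + g) = L f + L g" "\<And>c f. L (pscale c f) = pscale c (L f)"
  shows "linear_map L"
  by (unfold linear_iff_module_hom, unfold_locales) (simp_all add: assms)

lemma linear_map_add: "linear_map L \<Longrightarrow> L (f + g) = L f + L g"
  by (simp add: linear_iff_module_hom module_hom.add)

lemma linear_map_scale: "linear_map L \<Longrightarrow> L (pscale c f) = pscale c (L f)"
  by (simp add: linear_iff_module_hom module_hom.scale)

lemma linear_map_sum: "linear_map L \<Longrightarrow> L (sum h X) = (\<Sum>x\<in>X. L (h x))"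
  by (simp add: linear_iff_module_hom module_hom.sum)

lemma linear_map_eqI:
  assumes "linear_map L" "linear_map L'" "\<And>b. L (basis_vec b) = L' (basis_vec b)"
  shows "L f = L' f"
  using linear_eq_lin_ext[OF assms(1), of f] linear_eq_lin_ext[OF assms(2), of f] assms(3) by simp

lemma linear_map_comp: "linear_map L \<Longrightarrow> linear_map L' \<Longrightarrow> linear_map (\<lambda>f. L (L' f))"
  by (rule linear_mapI) (simp_all add: linear_map_add linear_map_scale)

lemma linear_map_id: "linear_map (\<lambda>f. f)"
  by (rule linear_mapI) simp_all

lemmas linear_map_simps = linear_map_add linear_map_scale

lemmas lin_ext_add = linear_map_add[OF linear_lin_ext]
lemmas lin_ext_scale = linear_map_scale[OF linear_lin_ext]

lemma lin_ext_fun_add: "lin_ext (\<lambda>b. h b + h' b) f = lin_ext h f + lin_ext h' f"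
  by (simp add: lin_ext_def pscale.scale_right_distrib sum.distrib)

lemma lin_ext_fun_scale: "lin_ext (\<lambda>b. pscale c (h b)) f = pscale c (lin_ext h f)"
  by (simp add: lin_ext_def pscale.scale_sum_right mult.commute)

lemma tensor_add_left: "tensor (f + f') g = tensor f g + tensor f' g"
  and tensor_scale_left: "tensor (pscale c f) g = pscale c (tensor f g)"
  by (simp_all add: tensor_def lin_ext_add lin_ext_scale)

lemmas lin_ext_bilinear = lin_ext_add lin_ext_scale lin_ext_fun_add lin_ext_fun_scale

lemma tensor_add_right: "tensor f (g + g') = tensor f g + tensor f g'"
  and tensor_scale_right: "tensor f (pscale c g) = pscale c (tensor f g)"
  by (simp_all add: tensor_def lin_ext_bilinear)

lemmas tensor_bilinear = tensor_add_left tensor_add_right tensor_scale_left tensor_scale_right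

lemma linear_tensor_left: "linear_map (\<lambda>f. tensor f g)"
  and linear_tensor_right: "linear_map (tensor f)"
  by (rule linear_mapI, simp_all add: tensor_bilinear)+

lemma tensor_basis [simp]: "tensor (basis_vec a) (basis_vec b) = basis_vec (a, b)"
  by (simp add: tensor_def)

lemma bilinear_mapI:
  assumes "\<And>f g g'. B f (g + g') = B f g + B f g'" "\<And>f c g. B f (pscale c g) = pscale c (B f g)"
    and "\<And>f f' g. B (f + f') g = B f g + B f' g" "\<And>f c g. B (pscale c f) g = pscale c (B f g)"
  shows "bilinear_map B"
  unfolding bilinear_map_def by (intro conjI allI linear_mapI assms)

lemma bilinear_mapD:
  assumes "bilinear_map B"
  shows "linear_map (B f)" "linear_map (\<lambda>f. B f g)"
  using assms unfolding bilinear_map_def by iprover+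

lemma bilinear_map_tensor_comp: "linear_map L \<Longrightarrow> bilinear_map (\<lambda>f g. L (tensor f g))"
  by (rule bilinear_mapI)
    (simp_all add: tensor_bilinear
      linear_map_add linear_map_scale)

lemma bilinear_map_eqI:
  assumes "bilinear_map B" "bilinear_map B'"
    and "\<And>a b. B (basis_vec a) (basis_vec b) = B' (basis_vec a) (basis_vec b)"
  shows "B f g = B' f g"
proof -
  have "B (basis_vec a) g = B' (basis_vec a) g" for a
    by (rule linear_map_eqI[OF bilinear_mapD(1)[OF assms(1)] bilinear_mapD(1)[OF assms(2)]])
      (rule assms(3))
  then show ?thesis
    by (rule linear_map_eqI[OF bilinear_mapD(2)[OF assms(1)] bilinear_mapD(2)[OF assms(2)]])
qed

lemma linear_tensor_map: "linear_map (tensor_map \<phi> \<psi>)"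
  unfolding tensor_map_def by (rule linear_lin_ext)

lemma tensor_map_basis: "tensor_map \<phi> \<psi> (basis_vec (a, b)) = tensor (\<phi> (basis_vec a)) (\<psi> (basis_vec b))"
  by (simp add: tensor_map_def)

lemma tensor_map_tensor:
  assumes "linear_map \<phi>" "linear_map \<psi>"
  shows "tensor_map \<phi> \<psi> (tensor f g) = tensor (\<phi> f) (\<psi> g)"
proof (rule bilinear_map_eqI[where B = "\<lambda>f g. tensor_map \<phi> \<psi> (tensor f g)"
      and B' = "\<lambda>f g. tensor (\<phi> f) (\<psi> g)"])
  show "bilinear_map (\<lambda>f g. tensor_map \<phi> \<psi> (tensor f g))"
    by (rule bilinear_map_tensor_comp[OF linear_tensor_map])
  show "bilinear_map (\<lambda>f g. tensor (\<phi> f) (\<psi> g))"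
    by (rule bilinear_mapI)
      (simp_all add: tensor_bilinear
        linear_map_simps[OF assms(1)]
        linear_map_simps[OF assms(2)])
qed (simp add: tensor_map_basis)

lemma linear_tensor_assoc: "linear_map tensor_assoc"
  unfolding tensor_assoc_def by (rule linear_lin_ext)

lemma tensor_assoc_tensor:
  fixes f :: "'a \<Rightarrow>\<^sub>0 'k::field" and g :: "'b \<Rightarrow>\<^sub>0 'k" and h :: "'c \<Rightarrow>\<^sub>0 'k"
  shows "tensor_assoc (tensor (tensor f g) h) = tensor f (tensor g h)"
proof -
  have 1: "tensor_assoc (tensor (basis_vec (a, b)) h) = tensor (basis_vec a) (tensor (basis_vec b) h)"
    for a :: 'a and b :: 'b
    by (rule linear_map_eqI[where L = "\<lambda>h. tensor_assoc (tensor (basis_vec (a, b)) h)"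
          and L' = "\<lambda>h. tensor (basis_vec a) (tensor (basis_vec b) h)"])
      (rule linear_mapI; simp add: tensor_add_right tensor_scale_right
        linear_map_simps[OF linear_tensor_assoc]
       | simp add: tensor_assoc_def)+
  show ?thesis
  proof (rule bilinear_map_eqI[where B = "\<lambda>f g. tensor_assoc (tensor (tensor f g) h)"
        and B' = "\<lambda>f g. tensor f (tensor g h)"])
    show "bilinear_map (\<lambda>f g. tensor_assoc (tensor (tensor f g) h))"
      by (rule bilinear_mapI)
        (simp_all add: tensor_bilinear
          linear_map_simps[OF linear_tensor_assoc])
    show "bilinear_map (\<lambda>f g. tensor f (tensor g h))"
      by (rule bilinear_mapI)
        (simp_all add: tensor_bilinear)
  qed (simp add: 1)
qed

section \<open>Monoid algebras and their homomorphisms\<close>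

lemma pscale_conv_mult: "pscale c (f :: 'b::monoid_add \<Rightarrow>\<^sub>0 'k::field) = Poly_Mapping.single 0 c * f"
  unfolding pscale_def by (rule mult_map_scale_conv_mult)

text \<open>Turns the binomial coefficients of the coproduct, given as scalars, into ring elements,
  so that \<open>binomial_ring\<close> and the distributive laws apply to them.\<close>

lemma pscale_of_nat: "pscale (of_nat n) (f :: 'b::monoid_add \<Rightarrow>\<^sub>0 'k::field) = of_nat n * f"
  by (simp add: pscale_conv_mult)

lemma pscale_mult_left: "pscale c f * g = pscale c (f * (g :: 'b::monoid_add \<Rightarrow>\<^sub>0 'k::field))"
  by (simp add: pscale_conv_mult mult.assoc)

lemma pscale_mult_right: "f * pscale c g = pscale c (f * (g :: 'b::comm_monoid_add \<Rightarrow>\<^sub>0 'k::field))"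
  by (simp add: pscale_conv_mult mult.left_commute)

lemma basis_vec_mult: "basis_vec a * basis_vec b = basis_vec (a + b)"
  by (simp add: basis_vec_def mult_single)

lemma basis_vec_zero: "basis_vec 0 = 1"
  by (simp add: basis_vec_def)

lemma bilinear_times: "bilinear_map ((*) :: ('b::comm_monoid_add \<Rightarrow>\<^sub>0 'k::field) \<Rightarrow> _)"
  by (rule bilinear_mapI) (simp_all add: algebra_simps pscale_mult_left pscale_mult_right)

text \<open>Domain and codomain are algebras of arbitrary commutative monoids. Products of monoids
  are monoids, so this one notion covers \<H>, its tensor square and its tensor cube.\<close>

definition alg_hom :: "(('b::comm_monoid_add \<Rightarrow>\<^sub>0 'k::field) \<Rightarrow> ('c::comm_monoid_add \<Rightarrow>\<^sub>0 'k)) \<Rightarrow> bool" where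
  "alg_hom \<phi> \<longleftrightarrow> linear_map \<phi> \<and> \<phi> 1 = 1 \<and> (\<forall>f g. \<phi> (f * g) = \<phi> f * \<phi> g)"

text \<open>Multiplicativity is an identity of bilinear maps, hence enough on basis vectors, whose
  product is addition in the monoid.\<close>

lemma alg_homI:
  assumes "linear_map \<phi>" "\<phi> 1 = 1" "\<And>a b. \<phi> (basis_vec (a + b)) = \<phi> (basis_vec a) * \<phi> (basis_vec b)"
  shows "alg_hom \<phi>"
proof -
  have "\<phi> (f * g) = \<phi> f * \<phi> g" for f g
  proof (rule bilinear_map_eqI[where B = "\<lambda>f g. \<phi> (f * g)" and B' = "\<lambda>f g. \<phi> f * \<phi> g"])
    show "bilinear_map (\<lambda>f g. \<phi> (f * g))"
      by (rule bilinear_mapI)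
        (simp_all add: algebra_simps pscale_mult_left pscale_mult_right
          linear_map_simps[OF assms(1)])
    show "bilinear_map (\<lambda>f g. \<phi> f * \<phi> g)"
      by (rule bilinear_mapI)
        (simp_all add: algebra_simps pscale_mult_left pscale_mult_right
          linear_map_simps[OF assms(1)])
  qed (simp add: basis_vec_mult assms(3))
  with assms show ?thesis
    by (simp add: alg_hom_def)
qed

lemma alg_homD:
  assumes "alg_hom \<phi>"
  shows "linear_map \<phi>" "\<phi> 1 = 1" "\<phi> (f * g) = \<phi> f * \<phi> g" 
  using assms by (auto simp: alg_hom_def)

lemma alg_hom_power: "alg_hom \<phi> \<Longrightarrow> \<phi> (f ^ n) = \<phi> f ^ n"
  by (induction n) (simp_all add: alg_homD)

lemma alg_hom_lin_ext:
  assumes "h 0 = 1" "\<And>a b. h (a + b) = h a * h b"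
  shows "alg_hom (lin_ext h)"
  by (rule alg_homI) (simp_all add: linear_lin_ext assms flip: basis_vec_zero)

lemma alg_hom_comp: "alg_hom \<phi> \<Longrightarrow> alg_hom \<psi> \<Longrightarrow> alg_hom (\<lambda>f. \<phi> (\<psi> f))"
  by (simp add: alg_hom_def linear_map_comp)

lemma alg_hom_id: "alg_hom (\<lambda>f. f)"
  by (simp add: alg_hom_def linear_map_id)

text \<open>Convolution over the product monoid is the product of the tensor product algebra: on
  basis vectors both add componentwise.\<close>

lemma tensor_mult_tensor:
  fixes f f' :: "'b::comm_monoid_add \<Rightarrow>\<^sub>0 'k::field" and g g' :: "'c::comm_monoid_add \<Rightarrow>\<^sub>0 'k"
  shows "tensor f g * tensor f' g' = tensor (f * f') (g * g')"
proof -
  note lin = tensor_bilinear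
    pscale_mult_left pscale_mult_right distrib_left distrib_right
  have 1: "tensor (basis_vec a) (basis_vec b) * tensor f' g' =
      tensor (basis_vec a * f') (basis_vec b * g')" for a :: 'b and b :: 'c
    by (rule bilinear_map_eqI[where B = "\<lambda>f' g'. tensor (basis_vec a) (basis_vec b) * tensor f' g'"
          and B' = "\<lambda>f' g'. tensor (basis_vec a * f') (basis_vec b * g')"])
      (rule bilinear_mapI; simp add: lin basis_vec_mult | simp add: basis_vec_mult)+
  show ?thesis
    by (rule bilinear_map_eqI[where B = "\<lambda>f g. tensor f g * tensor f' g'"
          and B' = "\<lambda>f g. tensor (f * f') (g * g')"])
      (rule bilinear_mapI; simp add: lin | rule 1)+
qed

lemma tensor_one [simp]: "tensor 1 1 = 1"
  by (simp add: zero_prod_def flip: basis_vec_zero)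

lemma alg_hom_tensor_map:
  fixes \<phi> :: "('a::comm_monoid_add \<Rightarrow>\<^sub>0 'k::field) \<Rightarrow> ('c::comm_monoid_add \<Rightarrow>\<^sub>0 'k)"
    and \<psi> :: "('b::comm_monoid_add \<Rightarrow>\<^sub>0 'k) \<Rightarrow> ('d::comm_monoid_add \<Rightarrow>\<^sub>0 'k)"
  assumes "alg_hom \<phi>" "alg_hom \<psi>"
  shows "alg_hom (tensor_map \<phi> \<psi>)"
proof (rule alg_homI[OF linear_tensor_map])
  show "tensor_map \<phi> \<psi> 1 = 1"
    using tensor_map_tensor[OF alg_homD(1)[OF assms(1)] alg_homD(1)[OF assms(2)], of 1 1]
    by (simp add: alg_homD assms)
next
  fix x y :: "'a \<times> 'b"
  show "tensor_map \<phi> \<psi> (basis_vec (x + y)) = tensor_map \<phi> \<psi> (basis_vec x) * tensor_map \<phi> \<psi> (basis_vec y)"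
    by (cases x; cases y)
      (simp add: tensor_map_basis tensor_mult_tensor flip: basis_vec_mult alg_homD(3)[OF assms(1)] alg_homD(3)[OF assms(2)])
qed

lemma alg_hom_tensor_assoc: "alg_hom tensor_assoc"
proof (rule alg_homI[OF linear_tensor_assoc])
  fix x y :: "('a \<times> 'b) \<times> 'c"
  show "tensor_assoc (basis_vec (x + y)) = tensor_assoc (basis_vec x) * tensor_assoc (basis_vec y)"
    by (cases x; cases y) (auto simp add: tensor_assoc_def basis_vec_mult)
qed (simp add: tensor_assoc_def zero_prod_def flip: basis_vec_zero)

text \<open>Singletons generate the free commutative monoid of multisets, so a homomorphism out of
  \<H> is fixed by its values on generators. Coassociativity, counit and antipode axioms are all
  reduced to one generator in this way.\<close>

lemma alg_hom_eqI:
  assumes "alg_hom \<phi>" "alg_hom \<psi>" "\<And>a. \<phi> (basis_vec {#a#}) = \<psi> (basis_vec {#a#})"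
  shows "\<phi> f = \<psi> f"
proof (rule linear_map_eqI[OF alg_homD(1)[OF assms(1)] alg_homD(1)[OF assms(2)]])
  show "\<phi> (basis_vec M) = \<psi> (basis_vec M)" for M
  proof (induction M)
    case empty
    show ?case
      using assms by (simp add: alg_hom_def basis_vec_zero)
  next
    case (add x M)
    have "basis_vec (add_mset x M) = basis_vec {#x#} * (basis_vec M :: _ \<Rightarrow>\<^sub>0 'b)"
      by (simp add: basis_vec_mult)
    with add assms show ?case
      by (simp add: alg_homD)
  qed
qed

subsection \<open>Homogeneous elements\<close>

lemma homogeneous_iff: "f \<in> homogeneous d n \<longleftrightarrow> (\<forall>b. Poly_Mapping.lookup f b \<noteq> 0 \<longrightarrow> d b = n)"
  by (auto simp: homogeneous_def in_keys_iff)

lemma homogeneous_add: "f \<in> homogeneous d n \<Longrightarrow> g \<in> homogeneous d n \<Longrightarrow> f + g \<in> homogeneous d n"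
  by (auto simp: homogeneous_iff lookup_add) (metis add.right_neutral add_0)

lemma homogeneous_scale: "f \<in> homogeneous d n \<Longrightarrow> pscale c f \<in> homogeneous d n"
  by (auto simp: homogeneous_iff)

lemma homogeneous_uminus: "f \<in> homogeneous d n \<Longrightarrow> - f \<in> homogeneous d n"
  by (auto simp: homogeneous_iff)

lemma homogeneous_zero: "0 \<in> homogeneous d n"
  by (simp add: homogeneous_iff)

lemma homogeneous_sum: "(\<And>x. x \<in> X \<Longrightarrow> h x \<in> homogeneous d n) \<Longrightarrow> sum h X \<in> homogeneous d n"
  by (induction X rule: infinite_finite_induct) (auto simp: homogeneous_zero homogeneous_add)

lemma homogeneous_basis: "basis_vec b \<in> homogeneous d (d b)"
  by (simp add: homogeneous_def basis_vec_def)

lemma homogeneous_lin_ext: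
  assumes "f \<in> homogeneous d n" "\<And>b. d b = n \<Longrightarrow> h b \<in> homogeneous d' n"
  shows "lin_ext h f \<in> homogeneous d' n"
  using assms unfolding lin_ext_def homogeneous_def[of d]
  by (auto intro!: homogeneous_sum homogeneous_scale)

lemma homogeneous_times:
  assumes "\<And>a b. d (a + b) = d a + d b" "f \<in> homogeneous d m" "g \<in> homogeneous d n"
  shows "f * g \<in> homogeneous d (m + n)"
  using assms keys_mult[of f g] unfolding homogeneous_def by fastforce

lemma homogeneous_tensor:
  assumes "f \<in> homogeneous d m" "g \<in> homogeneous d' n"
  shows "tensor f g \<in> homogeneous (\<lambda>(a, b). d a + d' b) (m + n)"
proof -
  have "basis_vec (a, b) \<in> homogeneous (\<lambda>(a, b). d a + d' b) (m + n)" if "d a = m" "d' b = n" for a b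
    using that homogeneous_basis[of "(a, b)" "\<lambda>(a, b). d a + d' b"] by simp
  with assms show ?thesis
    unfolding tensor_def lin_ext_def homogeneous_def[of d] homogeneous_def[of d']
    by (auto intro!: homogeneous_sum homogeneous_scale)
qed

lemma homogeneous_prod_mset:
  assumes "d 0 = 0" "\<And>a b. d (a + b) = d a + d b" "\<And>x. x \<in># M \<Longrightarrow> h x \<in> homogeneous d (w x)"
  shows "(\<Prod>x\<in>#M. h x) \<in> homogeneous d (\<Sum>x\<in>#M. w x)"
  using assms(3)
proof (induction M)
  case empty
  then show ?case
    by (simp add: assms(1) homogeneous_def)
next
  case (add x M)
  then show ?case
    by (auto intro!: homogeneous_times[OF assms(2)])
qed

subsection \<open>Cutting compositions\<close>

text \<open>A composition of \<open>n\<close> is a row of \<open>n\<close> cells grouped into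
  blocks, and this keeps the first \<open>k\<close> cells. A cut between blocks gives a
  concatenation, a cut inside a block a near-concatenation. The case \<open>k = 0\<close> here, and
  the strict \<open>k < a\<close> in \<open>comp_drop\<close>, prevent parts equal to zero.\<close>

fun comp_take :: "nat \<Rightarrow> nat list \<Rightarrow> nat list" where
  "comp_take k [] = []"
| "comp_take k (a # \<alpha>) = (if k = 0 then [] else if k \<le> a then [k] else a # comp_take (k - a) \<alpha>)"

fun comp_drop :: "nat \<Rightarrow> nat list \<Rightarrow> nat list" where
  "comp_drop k [] = []"
| "comp_drop k (a # \<alpha>) = (if k < a then (a - k) # \<alpha> else comp_drop (k - a) \<alpha>)"

lemma composition_simps [simp]:
  "composition []" "composition (a # \<alpha>) \<longleftrightarrow> 0 < a \<and> composition \<alpha>"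
  by (auto simp: composition_def)

lemma composition_gen [simp]: "composition (gen_composition a)"
  using gen_composition[of a] by simp

lemma comp_take_0 [simp]: "comp_take 0 \<alpha> = []"
  by (cases \<alpha>) auto

lemma comp_drop_0 [simp]: "composition \<alpha> \<Longrightarrow> comp_drop 0 \<alpha> = \<alpha>"
  by (cases \<alpha>) auto

lemma composition_comp_take: "composition \<alpha> \<Longrightarrow> composition (comp_take k \<alpha>)"
  by (induction k \<alpha> rule: comp_take.induct) auto

lemma composition_comp_drop: "composition \<alpha> \<Longrightarrow> composition (comp_drop k \<alpha>)"
  by (induction k \<alpha> rule: comp_drop.induct) auto

lemma sum_comp_take: "k \<le> sum_list \<alpha> \<Longrightarrow> sum_list (comp_take k \<alpha>) = k"
  by (induction k \<alpha> rule: comp_take.induct) auto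

lemma sum_comp_drop: "sum_list (comp_drop k \<alpha>) = sum_list \<alpha> - k"
  by (induction k \<alpha> rule: comp_drop.induct) auto

lemma composition_sum_eq_0: "composition \<alpha> \<Longrightarrow> sum_list \<alpha> = 0 \<longleftrightarrow> \<alpha> = []"
  by (cases \<alpha>) auto

lemma composition_all_zero: "composition \<alpha> \<Longrightarrow> (\<forall>n\<in>set \<alpha>. n = 0) \<longleftrightarrow> \<alpha> = []"
  by (cases \<alpha>) auto

lemma comp_take_all: "composition \<alpha> \<Longrightarrow> sum_list \<alpha> \<le> k \<Longrightarrow> comp_take k \<alpha> = \<alpha>"
proof (induction k \<alpha> rule: comp_take.induct)
  case (2 k a \<alpha>)
  then have "\<alpha> = []" if "k \<le> a"
  proof -
    from 2(2-) that have "sum_list \<alpha> = 0"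
      unfolding sum_list.Cons composition_simps by linarith
    then show ?thesis
      using 2(2) composition_sum_eq_0[of \<alpha>] by simp
  qed
  with 2 show ?case
    by auto
qed simp

lemma comp_drop_all: "sum_list \<alpha> \<le> k \<Longrightarrow> comp_drop k \<alpha> = []"
  by (induction k \<alpha> rule: comp_drop.induct) auto

lemma comp_take_take: "j \<le> k \<Longrightarrow> comp_take j (comp_take k \<alpha>) = comp_take j \<alpha>"
  by (induction k \<alpha> arbitrary: j rule: comp_take.induct) auto

text \<open>The middle piece between two cut positions does not depend on which cut is made first.
  With \<open>comp_take_take\<close> and \<open>comp_drop_drop\<close> this is coassociativity
  before the coefficients are taken into account.\<close>

lemma comp_drop_take:
  "composition \<alpha> \<Longrightarrow> j \<le> k \<Longrightarrow> k \<le> sum_list \<alpha> \<Longrightarrow> comp_drop j (comp_take k \<alpha>) = comp_take (k - j) (comp_drop j \<alpha>)"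
proof (induction k \<alpha> arbitrary: j rule: comp_take.induct)
  case (2 k a \<alpha>)
  then show ?case
    by (auto simp: not_le not_less) 
qed auto

lemma comp_drop_drop: "composition \<alpha> \<Longrightarrow> j \<le> k \<Longrightarrow> comp_drop (k - j) (comp_drop j \<alpha>) = comp_drop k \<alpha>"
proof (induction j \<alpha> arbitrary: k rule: comp_drop.induct)
  case (2 j a \<alpha>)
  from 2(1)[of "k - a"] 2(2-) show ?case
    by auto
qed auto

lemma near_concat_Cons:
  "near_concat (b # \<beta>) \<gamma> = (if \<beta> = [] then (b + hd \<gamma>) # tl \<gamma> else b # near_concat \<beta> \<gamma>)"
  by (simp add: near_concat_def)

lemma comp_take_drop_append:
  "composition \<beta> \<Longrightarrow> composition \<gamma> \<Longrightarrow>
    comp_take (sum_list \<beta>) (\<beta> @ \<gamma>) = \<beta> \<and> comp_drop (sum_list \<beta>) (\<beta> @ \<gamma>) = \<gamma>"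
  by (induction \<beta>) (auto simp: composition_all_zero)

lemma comp_take_drop_near_concat:
  "composition \<beta> \<Longrightarrow> composition \<gamma> \<Longrightarrow> \<beta> \<noteq> [] \<Longrightarrow> \<gamma> \<noteq> [] \<Longrightarrow>
    comp_take (sum_list \<beta>) (near_concat \<beta> \<gamma>) = \<beta> \<and> comp_drop (sum_list \<beta>) (near_concat \<beta> \<gamma>) = \<gamma> \<and>
    sum_list (near_concat \<beta> \<gamma>) = sum_list \<beta> + sum_list \<gamma>"
proof (induction \<beta>)
  case (Cons b \<beta>)
  then show ?case
    by (cases \<gamma>) (auto simp: near_concat_Cons composition_all_zero)
qed simp

lemma decomposition_take_drop:
  assumes "composition \<alpha>" "k \<le> sum_list \<alpha>"
  shows "comp_take k \<alpha> @ comp_drop k \<alpha> = \<alpha> \<or> comp_take k \<alpha> \<noteq> [] \<and> comp_drop k \<alpha> \<noteq> [] \<and>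
    near_concat (comp_take k \<alpha>) (comp_drop k \<alpha>) = \<alpha>"
  using assms
proof (induction k \<alpha> rule: comp_take.induct)
  case (2 k a \<alpha>)
  show ?case
  proof (cases "k = 0 \<or> k \<le> a")
    case True
    with 2 show ?thesis
      by (auto simp: near_concat_def)
  next
    case False
    with 2 show ?thesis
      by (fastforce simp: near_concat_Cons not_le)
  qed
qed auto

text \<open>The size of the left part determines the pair: each cut position arises exactly once, as
  a concatenation if it separates two blocks and as a near-concatenation otherwise.\<close>

lemma decompositions_eq:
  assumes "composition \<alpha>"
  shows "decompositions \<alpha> = (\<lambda>k. (comp_take k \<alpha>, comp_drop k \<alpha>)) ` {..sum_list \<alpha>}"
proof (intro equalityI subsetI)
  fix x
  assume "x \<in> decompositions \<alpha>"
  then obtain \<beta> \<gamma> where x: "x = (\<beta>, \<gamma>)" "composition \<beta>" "composition \<gamma>"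
    "\<beta> @ \<gamma> = \<alpha> \<or> \<beta> \<noteq> [] \<and> \<gamma> \<noteq> [] \<and> near_concat \<beta> \<gamma> = \<alpha>"
    by (auto simp: decompositions_def)
  then have "comp_take (sum_list \<beta>) \<alpha> = \<beta>" "comp_drop (sum_list \<beta>) \<alpha> = \<gamma>" "sum_list \<beta> \<le> sum_list \<alpha>"
    using comp_take_drop_append comp_take_drop_near_concat by auto
  with x show "x \<in> (\<lambda>k. (comp_take k \<alpha>, comp_drop k \<alpha>)) ` {..sum_list \<alpha>}"
    by (intro image_eqI[of _ _ "sum_list \<beta>"]) auto
qed (use assms in \<open>auto simp: decompositions_def composition_comp_take composition_comp_drop
    dest: decomposition_take_drop\<close>)

lemma sum_decompositions:
  assumes "composition \<alpha>"
  shows "(\<Sum>(\<beta>, \<gamma>)\<in>decompositions \<alpha>. h \<beta> \<gamma>) = (\<Sum>k\<le>sum_list \<alpha>. h (comp_take k \<alpha>) (comp_drop k \<alpha>))"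
proof -
  have "inj_on (\<lambda>k. (comp_take k \<alpha>, comp_drop k \<alpha>)) {..sum_list \<alpha>}"
    by (rule inj_on_inverseI[of _ "\<lambda>(\<beta>, \<gamma>). sum_list \<beta>"]) (simp add: sum_comp_take)
  then show ?thesis
    by (simp add: decompositions_eq[OF assms] sum.reindex)
qed

text \<open>The function \<open>T\<close> is left arbitrary because the identity is needed twice:
  for coassociativity of \<open>comp_comult\<close>, where \<open>T\<close> is a triple tensor, and
  for associativity of \<open>comp_conv\<close>, where it is a product of three values.\<close>

lemma sum_comp_split_assoc:
  fixes T :: "nat list \<Rightarrow> nat list \<Rightarrow> nat list \<Rightarrow> 'r::comm_ring_1"
  assumes "composition \<alpha>" and n: "n = sum_list \<alpha>"
  shows "(\<Sum>k\<le>n. \<Sum>j\<le>k. of_nat (n choose k) * (of_nat (k choose j) *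
        T (comp_take j (comp_take k \<alpha>)) (comp_drop j (comp_take k \<alpha>)) (comp_drop k \<alpha>)))
    = (\<Sum>j\<le>n. \<Sum>i\<le>n - j. of_nat (n choose j) * (of_nat ((n - j) choose i) *
        T (comp_take j \<alpha>) (comp_take i (comp_drop j \<alpha>)) (comp_drop i (comp_drop j \<alpha>))))"
proof -
  let ?X = "\<lambda>j i. of_nat (n choose j) * (of_nat ((n - j) choose i) *
        T (comp_take j \<alpha>) (comp_take i (comp_drop j \<alpha>)) (comp_drop i (comp_drop j \<alpha>)))"
  have "(\<Sum>k\<le>n. \<Sum>j\<le>k. of_nat (n choose k) * (of_nat (k choose j) *
        T (comp_take j (comp_take k \<alpha>)) (comp_drop j (comp_take k \<alpha>)) (comp_drop k \<alpha>)))
      = (\<Sum>k\<le>n. \<Sum>j\<le>k. ?X j (k - j))"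
  proof (intro sum.cong refl)
    fix k j
    assume kj: "k \<in> {..n}" "j \<in> {..k}"
    then have "(n choose k) * (k choose j) = (n choose j) * ((n - j) choose (k - j))"
      by (simp add: choose_mult)
    then have "of_nat (n choose k) * of_nat (k choose j) =
        of_nat (n choose j) * (of_nat ((n - j) choose (k - j)) :: 'r)"
      by (metis of_nat_mult)
    with kj assms show "of_nat (n choose k) * (of_nat (k choose j) *
        T (comp_take j (comp_take k \<alpha>)) (comp_drop j (comp_take k \<alpha>)) (comp_drop k \<alpha>)) = ?X j (k - j)"
      by (simp add: comp_take_take comp_drop_take comp_drop_drop flip: mult.assoc)
  qed
  \<comment> \<open>The pairs \<open>j \<le> k \<le> n\<close> are parametrized by \<open>j\<close>
    and the length \<open>i = k - j\<close> of the middle piece.\<close>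
  also have "\<dots> = (\<Sum>(j, i)\<in>{(j, i). j + i \<le> n}. ?X j i)"
    by (rule sum.triangle_reindex_eq[symmetric])
  also have "{(j, i). j + i \<le> n} = (SIGMA j:{..n}. {..n - j})"
    by auto
  also have "(\<Sum>(j, i)\<in>(SIGMA j:{..n}. {..n - j}). ?X j i) = (\<Sum>j\<le>n. \<Sum>i\<le>n - j. ?X j i)"
    by (simp add: sum.Sigma)
  finally show ?thesis .
qed

subsection \<open>The bialgebra of compositions\<close>

text \<open>Every composition, generator or not, is a single basis element of \<H>; this is its
  index. Length one covers both the generator \<open>[1]\<close> and the powers denoted by
  \<open>[n]\<close>.\<close>

definition comp_mon :: "nat list \<Rightarrow> monomial" where
  "comp_mon \<alpha> = (if \<alpha> = [] then {#} else if length \<alpha> = 1 then replicate_mset (hd \<alpha>) (Gen [1])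
     else {#Gen \<alpha>#})"

lemma Gen_inverse_composition:
  "composition \<alpha> \<Longrightarrow> 1 < length \<alpha> \<or> \<alpha> = [1] \<Longrightarrow> gen_composition (Gen \<alpha>) = \<alpha>"
  by (simp add: Gen_inverse)

lemma basis_vec_power: "basis_vec {#a#} ^ n = basis_vec (replicate_mset n a)"
  by (induction n) (simp_all add: basis_vec_zero basis_vec_mult)

lemma comp_elem_eq: "comp_elem \<alpha> = basis_vec (comp_mon \<alpha>)"
proof -
  have "Poly_Mapping.single {#Gen [1]#} 1 ^ n = (basis_vec (replicate_mset n (Gen [1])) :: monomial \<Rightarrow>\<^sub>0 'a)" for n
    by (simp add: basis_vec_power flip: basis_vec_def)
  then show ?thesis
    by (auto simp: comp_elem_def comp_mon_def basis_vec_zero basis_vec_def)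
qed

lemma comp_mon_gen: "comp_mon (gen_composition a) = {#a#}"
proof -
  have "composition (gen_composition a)" "1 < length (gen_composition a) \<or> gen_composition a = [1]"
    using gen_composition[of a] by auto
  then show ?thesis
    by (auto simp: comp_mon_def gen_composition_inverse)
      (metis One_nat_def gen_composition_inverse)+
qed

lemma comp_degree_zero: "comp_degree 0 = 0"
  and comp_degree_add: "comp_degree (M + N) = comp_degree M + comp_degree N"
  by (simp_all add: comp_degree_def)

lemma gen_composition_one: "gen_composition (Gen [Suc 0]) = [Suc 0]"
  by (simp add: Gen_inverse_composition)

lemma comp_degree_comp_mon:
  assumes "composition \<alpha>"
  shows "comp_degree (comp_mon \<alpha>) = sum_list \<alpha>"
proof (cases \<alpha>)
  case (Cons a \<beta>)
  with assms show ?thesis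
    by (cases \<beta>) (auto simp: comp_mon_def comp_degree_def Gen_inverse_composition gen_composition_one)
qed (simp add: comp_mon_def comp_degree_def)

abbreviation X1 :: "monomial \<Rightarrow>\<^sub>0 'k::field" where
  "X1 \<equiv> basis_vec {#Gen [1]#}"

lemma comp_elem_Nil [simp]: "comp_elem [] = 1"
  by (simp add: comp_elem_def)

lemma comp_elem_single: "comp_elem [n] = X1 ^ n"
  by (simp add: comp_elem_def basis_vec_def)

lemma comp_elem_take_single: "k \<le> n \<Longrightarrow> comp_elem (comp_take k [n]) = X1 ^ k"
  and comp_elem_drop_single: "k \<le> n \<Longrightarrow> comp_elem (comp_drop k [n]) = X1 ^ (n - k)"
  by (auto simp: comp_elem_single)

lemma alg_hom_comp_comult: "alg_hom comp_comult"
  unfolding comp_comult_def by (rule alg_hom_lin_ext) simp_all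

lemma comp_comult_gen_eq:
  "comp_comult_gen a = (\<Sum>k\<le>sum_list (gen_composition a).
     of_nat (sum_list (gen_composition a) choose k) *
       tensor (comp_elem (comp_take k (gen_composition a))) (comp_elem (comp_drop k (gen_composition a))))"
  unfolding comp_comult_gen_def
  by (subst sum_decompositions) (auto simp: pscale_of_nat sum_comp_take intro!: sum.cong)

lemma comp_comult_basis: "comp_comult (basis_vec {#a#}) = comp_comult_gen a"
  by (simp add: comp_comult_def)

lemma tensor_power:
  fixes f :: "'b::comm_monoid_add \<Rightarrow>\<^sub>0 'k::field" and g :: "'c::comm_monoid_add \<Rightarrow>\<^sub>0 'k"
  shows "tensor f g ^ n = tensor (f ^ n) (g ^ n)"
  by (induction n) (simp_all add: tensor_mult_tensor)

text \<open>The formula that defines the coproduct on generators persists for \<open>[n]\<close>,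
  although its coproduct is computed as that of a power. This is indispensable for iterating: pieces
  of a generator need not be generators.\<close>

lemma comp_comult_comp_elem:
  assumes "composition \<alpha>"
  shows "comp_comult (comp_elem \<alpha> :: _ \<Rightarrow>\<^sub>0 'k::field) = (\<Sum>k\<le>sum_list \<alpha>. of_nat (sum_list \<alpha> choose k) *
    tensor (comp_elem (comp_take k \<alpha>)) (comp_elem (comp_drop k \<alpha>)))"
proof -
  consider "\<alpha> = []" | n where "\<alpha> = [n]" "0 < n" | "1 < length \<alpha>"
    using assms by (cases \<alpha>; cases "tl \<alpha>") auto
  then show ?thesis
  proof cases
    case 1
    then show ?thesis
      by (simp add: alg_homD[OF alg_hom_comp_comult])
  next
    case 2
    \<comment> \<open>The two cuts of \<open>[1]\<close> make \<open>X1\<close> primitive. The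
      binomial theorem for the power of this sum then yields exactly the coefficients of the cuts of
      \<open>[n]\<close>.\<close>
    have "comp_comult X1 = tensor X1 1 + (tensor 1 X1 :: _ \<Rightarrow>\<^sub>0 'k)"
      by (simp add: comp_comult_basis comp_comult_gen_eq gen_composition_one comp_elem_single)
    then have "comp_comult (comp_elem \<alpha> :: _ \<Rightarrow>\<^sub>0 'k) = (tensor X1 1 + tensor 1 X1) ^ n"
      by (simp add: 2 comp_elem_single alg_hom_power[OF alg_hom_comp_comult])
    then show ?thesis
      by (simp add: 2 binomial_ring tensor_power tensor_mult_tensor mult.assoc
          comp_elem_take_single comp_elem_drop_single del: comp_take.simps comp_drop.simps)
  next
    case 3
    with assms have "comp_elem \<alpha> = (basis_vec {#Gen \<alpha>#} :: _ \<Rightarrow>\<^sub>0 'k)" "gen_composition (Gen \<alpha>) = \<alpha>"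
      by (auto simp: comp_elem_def basis_vec_def Gen_inverse_composition)
    then show ?thesis
      by (simp add: comp_comult_basis comp_comult_gen_eq)
  qed
qed

subsection \<open>Convolution and the antipode\<close>

text \<open>The convolution product dual to the coproduct: for linear maps on \<H> with values in a
  commutative algebra it computes their convolution on \<open>comp_elem \<alpha>\<close> from their
  values on the elements of the pieces.\<close>

definition comp_conv :: "(nat list \<Rightarrow> 'r::comm_ring_1) \<Rightarrow> (nat list \<Rightarrow> 'r) \<Rightarrow> nat list \<Rightarrow> 'r" where
  "comp_conv F G \<alpha> = (\<Sum>k\<le>sum_list \<alpha>. of_nat (sum_list \<alpha> choose k) *
     (F (comp_take k \<alpha>) * G (comp_drop k \<alpha>)))"

definition comp_unit :: "nat list \<Rightarrow> 'r::comm_ring_1" where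
  "comp_unit \<alpha> = (if \<alpha> = [] then 1 else 0)"

lemma comp_conv_cong:
  assumes "composition \<alpha>" "\<And>\<beta>. composition \<beta> \<Longrightarrow> F \<beta> = F' \<beta>" "\<And>\<beta>. composition \<beta> \<Longrightarrow> G \<beta> = G' \<beta>"
  shows "comp_conv F G \<alpha> = comp_conv F' G' \<alpha>"
  using assms by (simp add: comp_conv_def composition_comp_take composition_comp_drop)

lemma comp_conv_assoc:
  assumes "composition \<alpha>"
  shows "comp_conv (comp_conv F G) H \<alpha> = comp_conv F (comp_conv G H) \<alpha>"
  using sum_comp_split_assoc[OF assms refl, of "\<lambda>\<beta> \<gamma> \<delta>. F \<beta> * G \<gamma> * H \<delta>"]
  by (simp add: comp_conv_def sum_comp_take sum_comp_drop sum_distrib_left sum_distrib_right ac_simps)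

lemma comp_take_eq_Nil: "composition \<alpha> \<Longrightarrow> k \<le> sum_list \<alpha> \<Longrightarrow> comp_take k \<alpha> = [] \<longleftrightarrow> k = 0"
  using sum_comp_take by fastforce

lemma comp_drop_eq_Nil:
  "composition \<alpha> \<Longrightarrow> k \<le> sum_list \<alpha> \<Longrightarrow> comp_drop k \<alpha> = [] \<longleftrightarrow> k = sum_list \<alpha>"
  using sum_comp_drop[of k \<alpha>] comp_drop_all[of \<alpha> k] by (metis diff_is_0_eq le_antisym order_refl sum_list.Nil)

lemma comp_conv_unit_left: "composition \<alpha> \<Longrightarrow> comp_conv comp_unit F \<alpha> = F \<alpha>"
proof -
  assume "composition \<alpha>"
  then have "comp_conv comp_unit F \<alpha> = (\<Sum>k\<le>sum_list \<alpha>. if k = 0 then F \<alpha> else 0)"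
    unfolding comp_conv_def by (intro sum.cong) (auto simp: comp_unit_def comp_take_eq_Nil)
  then show ?thesis
    by simp
qed

lemma comp_conv_unit_right: "composition \<alpha> \<Longrightarrow> comp_conv F comp_unit \<alpha> = F \<alpha>"
proof -
  assume "composition \<alpha>"
  then have "comp_conv F comp_unit \<alpha> = (\<Sum>k\<le>sum_list \<alpha>. if k = sum_list \<alpha> then F \<alpha> else 0)"
    unfolding comp_conv_def by (intro sum.cong) (auto simp: comp_unit_def comp_drop_eq_Nil comp_take_all)
  then show ?thesis
    by simp
qed

text \<open>The left inverse equation solved for its last summand. For
  \<open>k = sum_list \<alpha>\<close> the right piece is empty and contributes \<open>F []\<close>,
  which is 1 in all uses; the other summands involve smaller compositions.\<close>

function comp_inv :: "(nat list \<Rightarrow> 'r::comm_ring_1) \<Rightarrow> nat list \<Rightarrow> 'r" where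
  "comp_inv F \<alpha> = (if sum_list \<alpha> = 0 then 1 else
     - (\<Sum>k<sum_list \<alpha>. of_nat (sum_list \<alpha> choose k) * (comp_inv F (comp_take k \<alpha>) * F (comp_drop k \<alpha>))))"
  by auto
termination
  by (relation "Wellfounded.measure (\<lambda>(F, \<alpha>). sum_list \<alpha>)") (auto simp: sum_comp_take)

declare comp_inv.simps [simp del]

lemma comp_inv_Nil [simp]: "comp_inv F [] = 1"
  by (simp add: comp_inv.simps)

lemma comp_inv_left:
  assumes "composition \<alpha>" "F [] = 1"
  shows "comp_conv (comp_inv F) F \<alpha> = comp_unit \<alpha>"
proof (cases "\<alpha> = []")
  case False
  then have "sum_list \<alpha> \<noteq> 0"
    using assms(1) composition_sum_eq_0 by blast
  have "comp_conv (comp_inv F) F \<alpha> = (\<Sum>k<sum_list \<alpha>. of_nat (sum_list \<alpha> choose k) *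
      (comp_inv F (comp_take k \<alpha>) * F (comp_drop k \<alpha>))) + comp_inv F \<alpha>"
    using assms by (simp add: comp_conv_def lessThan_Suc_atMost[symmetric] comp_take_all comp_drop_all)
  also have "comp_inv F \<alpha> = - (\<Sum>k<sum_list \<alpha>. of_nat (sum_list \<alpha> choose k) *
      (comp_inv F (comp_take k \<alpha>) * F (comp_drop k \<alpha>)))"
    using \<open>sum_list \<alpha> \<noteq> 0\<close> by (subst comp_inv.simps) auto
  finally show ?thesis
    using False by (simp add: comp_unit_def)
qed (simp add: comp_conv_def comp_unit_def assms)

text \<open>In a monoid in which every element has a left inverse, left inverses are right inverses.\<close>

lemma comp_inv_right:
  assumes "composition \<alpha>" "F [] = 1"
  shows "comp_conv F (comp_inv F) \<alpha> = comp_unit \<alpha>"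
proof -
  let ?L = "comp_inv F"
  have "F \<beta> = comp_inv ?L \<beta>" if \<beta>: "composition \<beta>" for \<beta>
  proof -
    have "F \<beta> = comp_conv comp_unit F \<beta>"
      using \<beta> by (simp add: comp_conv_unit_left)
    also have "\<dots> = comp_conv (comp_conv (comp_inv ?L) ?L) F \<beta>"
      using \<beta> by (intro comp_conv_cong) (simp_all add: comp_inv_left)
    also have "\<dots> = comp_conv (comp_inv ?L) (comp_conv ?L F) \<beta>"
      by (rule comp_conv_assoc[OF \<beta>])
    also have "\<dots> = comp_conv (comp_inv ?L) comp_unit \<beta>"
      using \<beta> assms by (intro comp_conv_cong) (simp_all add: comp_inv_left)
    finally show ?thesis
      using \<beta> by (simp add: comp_conv_unit_right)
  qed
  then have "comp_conv F ?L \<alpha> = comp_conv (comp_inv ?L) ?L \<alpha>"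
    using assms(1) by (intro comp_conv_cong) auto
  with assms(1) show ?thesis
    by (simp add: comp_inv_left)
qed

definition comp_counit :: "(monomial \<Rightarrow>\<^sub>0 'k::field) \<Rightarrow> 'k" where
  "comp_counit f = Poly_Mapping.lookup f {#}"

text \<open>As \<H> is commutative, its antipode has to be an algebra homomorphism, so the
  convolution inverse is prescribed on generators and extended multiplicatively.\<close>

definition comp_antipode :: "(monomial \<Rightarrow>\<^sub>0 'k::field) \<Rightarrow> (monomial \<Rightarrow>\<^sub>0 'k)" where
  "comp_antipode = lin_ext (\<lambda>M. \<Prod>a\<in>#M. comp_inv comp_elem (gen_composition a))"

lemma alg_hom_comp_antipode: "alg_hom comp_antipode"
  unfolding comp_antipode_def by (rule alg_hom_lin_ext) simp_all

text \<open>Since \<open>[n]\<close> is a power of \<open>X1\<close>, the recursion and the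
  multiplicative extension both assign it a value, and these must agree. The recursion is the
  expansion of \<open>(- X1 + X1) ^ n\<close>, which vanishes for positive \<open>n\<close>.\<close>

lemma comp_inv_single: "comp_inv comp_elem [n] = (- X1) ^ n"
proof (induction n rule: less_induct)
  case (less n)
  show ?case
  proof (cases "n = 0")
    case False
    let ?t = "\<lambda>k. of_nat (n choose k) * ((- X1) ^ k * X1 ^ (n - k)) :: monomial \<Rightarrow>\<^sub>0 'a"
    have "comp_inv comp_elem (comp_take k [n]) = (- X1 :: _ \<Rightarrow>\<^sub>0 'a) ^ k" if "k < n" for k
      using less[OF that] that by simp
    then have "comp_inv comp_elem [n] = - (\<Sum>k<n. ?t k)"
      using False by (subst comp_inv.simps) (simp add: comp_elem_drop_single del: comp_take.simps comp_drop.simps)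
    moreover have "(\<Sum>k\<le>n. ?t k) = (- X1 + X1) ^ n"
      unfolding binomial_ring by (simp add: mult.assoc)
    then have "(\<Sum>k<n. ?t k) + (- X1) ^ n = 0"
      using False by (simp add: zero_power flip: lessThan_Suc_atMost)
    ultimately show ?thesis
      by (simp only: add_eq_0_iff)
  qed (simp add: comp_inv.simps)
qed

lemma comp_antipode_comp_elem:
  assumes "composition \<alpha>"
  shows "comp_antipode (comp_elem \<alpha>) = (comp_inv comp_elem \<alpha> :: _ \<Rightarrow>\<^sub>0 'k::field)"
proof -
  have basis: "comp_antipode (basis_vec {#a#}) = (comp_inv comp_elem (gen_composition a) :: _ \<Rightarrow>\<^sub>0 'k)" for a
    by (simp add: comp_antipode_def)
  consider "\<alpha> = []" | n where "\<alpha> = [n]" "0 < n" | "1 < length \<alpha>"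
    using assms by (cases \<alpha>; cases "tl \<alpha>") auto
  then show ?thesis
  proof cases
    case 1
    then show ?thesis
      by (simp add: alg_homD[OF alg_hom_comp_antipode])
  next
    case 2
    then show ?thesis
      using basis[of "Gen [1]"]
      by (simp add: comp_elem_single alg_hom_power[OF alg_hom_comp_antipode] gen_composition_one comp_inv_single)
  next
    case 3
    with assms have "comp_elem \<alpha> = (basis_vec {#Gen \<alpha>#} :: _ \<Rightarrow>\<^sub>0 'k)" "gen_composition (Gen \<alpha>) = \<alpha>"
      by (auto simp: comp_elem_def basis_vec_def Gen_inverse_composition)
    then show ?thesis
      by (simp add: basis)
  qed
qed

lemma linear_map_of_nat:
  fixes L :: "('b::monoid_add \<Rightarrow>\<^sub>0 'k::field) \<Rightarrow> ('c::monoid_add \<Rightarrow>\<^sub>0 'k)"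
  shows "linear_map L \<Longrightarrow> L (of_nat c * f) = of_nat c * L f"
  by (simp add: linear_map_scale flip: pscale_of_nat)

text \<open>The common scheme of the counit and antipode axioms: both sides are homomorphisms, so
  they are compared on a generator, where the coproduct is an explicit sum over cuts and the claim
  becomes an identity of \<open>comp_conv\<close>.\<close>

lemma alg_hom_comult_eqI:
  fixes \<phi> :: "(monomial \<times> monomial \<Rightarrow>\<^sub>0 'k::field) \<Rightarrow> ('c::comm_monoid_add \<Rightarrow>\<^sub>0 'k)"
  assumes "alg_hom \<phi>" "alg_hom \<psi>"
    and "\<And>\<alpha>. composition \<alpha> \<Longrightarrow> \<alpha> \<noteq> [] \<Longrightarrow> (\<Sum>k\<le>sum_list \<alpha>. of_nat (sum_list \<alpha> choose k) *
      \<phi> (tensor (comp_elem (comp_take k \<alpha>)) (comp_elem (comp_drop k \<alpha>)))) = \<psi> (comp_elem \<alpha>)"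
  shows "\<phi> (comp_comult f) = \<psi> f"
proof (rule alg_hom_eqI[OF alg_hom_comp[OF assms(1) alg_hom_comp_comult] assms(2)])
  fix a
  have "gen_composition a \<noteq> []"
    using gen_composition[of a] by auto
  moreover have "comp_elem (gen_composition a) = (basis_vec {#a#} :: _ \<Rightarrow>\<^sub>0 'k)"
    by (simp add: comp_elem_eq comp_mon_gen)
  moreover have "\<phi> (comp_comult (basis_vec {#a#})) = (\<Sum>k\<le>sum_list (gen_composition a).
      of_nat (sum_list (gen_composition a) choose k) *
      \<phi> (tensor (comp_elem (comp_take k (gen_composition a))) (comp_elem (comp_drop k (gen_composition a)))))"
    by (simp add: comp_comult_basis comp_comult_gen_eq linear_map_sum[OF alg_homD(1)[OF assms(1)]]
        linear_map_of_nat[OF alg_homD(1)[OF assms(1)]])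
  ultimately show "\<phi> (comp_comult (basis_vec {#a#})) = \<psi> (basis_vec {#a#})"
    using assms(3)[of "gen_composition a"] by simp
qed

lemma comp_comult_coassoc:
  "tensor_assoc (tensor_map comp_comult id (comp_comult f)) = tensor_map id comp_comult (comp_comult f)"
proof (rule alg_hom_eqI[of "\<lambda>f. tensor_assoc (tensor_map comp_comult id (comp_comult f))"
      "\<lambda>f. tensor_map id comp_comult (comp_comult f)"])
  have id: "alg_hom id"
    using alg_hom_id by (simp add: id_def)
  note homs = alg_hom_tensor_map[OF alg_hom_comp_comult id] alg_hom_tensor_map[OF id alg_hom_comp_comult]
  show "alg_hom (\<lambda>f :: _ \<Rightarrow>\<^sub>0 'a. tensor_assoc (tensor_map comp_comult id (comp_comult f)))"
    by (intro alg_hom_comp[OF alg_hom_tensor_assoc] alg_hom_comp[OF homs(1)] alg_hom_comp_comult)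
  show "alg_hom (\<lambda>f :: _ \<Rightarrow>\<^sub>0 'a. tensor_map id comp_comult (comp_comult f))"
    by (intro alg_hom_comp[OF homs(2)] alg_hom_comp_comult)
  fix a
  let ?\<alpha> = "gen_composition a"
  note lin = linear_map_sum[OF linear_tensor_assoc] linear_map_of_nat[OF linear_tensor_assoc]
    linear_map_sum[OF linear_tensor_map] linear_map_of_nat[OF linear_tensor_map]
    linear_map_sum[OF linear_tensor_left] linear_map_of_nat[OF linear_tensor_left]
    linear_map_sum[OF linear_tensor_right] linear_map_of_nat[OF linear_tensor_right]
    tensor_map_tensor[OF alg_homD(1)[OF alg_hom_comp_comult] alg_homD(1)[OF id]]
    tensor_map_tensor[OF alg_homD(1)[OF id] alg_homD(1)[OF alg_hom_comp_comult]]
  show "tensor_assoc (tensor_map comp_comult id (comp_comult (basis_vec {#a#} :: _ \<Rightarrow>\<^sub>0 'a))) =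
      tensor_map id comp_comult (comp_comult (basis_vec {#a#}))"
    using sum_comp_split_assoc[of ?\<alpha> "sum_list ?\<alpha>" "\<lambda>\<beta> \<gamma> \<delta>. tensor (comp_elem \<beta>) (tensor (comp_elem \<gamma>) (comp_elem \<delta>))
      :: _ \<Rightarrow>\<^sub>0 'a"]
    by (simp add: comp_comult_basis comp_comult_gen_eq lin comp_comult_comp_elem composition_comp_take composition_comp_drop
        sum_comp_take sum_comp_drop tensor_assoc_tensor sum_distrib_left)
qed

section \<open>The counit\<close>

lemma comp_counit_linear: "linear_form comp_counit"
  by (unfold linear_iff_module_hom, unfold_locales)
    (simp_all add: comp_counit_def lookup_add algebra_simps)

lemma comp_counit_basis: "comp_counit (basis_vec M) = (if M = {#} then 1 else 0)"
  by (simp add: comp_counit_def basis_vec_def lookup_single when_def)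

lemma comp_counit_one: "comp_counit 1 = 1"
  by (simp add: comp_counit_def lookup_one)

lemma comp_mon_eq_empty: "composition \<alpha> \<Longrightarrow> comp_mon \<alpha> = {#} \<longleftrightarrow> \<alpha> = []"
  by (cases \<alpha>) (auto simp: comp_mon_def)

lemma comp_counit_comp_elem: "composition \<alpha> \<Longrightarrow> comp_counit (comp_elem \<alpha>) = comp_unit \<alpha>"
  by (simp add: comp_elem_eq comp_counit_basis comp_mon_eq_empty comp_unit_def)

text \<open>The notion \<open>alg_hom\<close> concerns maps into monoid algebras, so the counit is
  followed by the embedding of scalars into \<H>. Multiplicativity of the form itself is then read
  off at the empty monomial.\<close>

lemma alg_hom_unit_counit: "alg_hom (\<lambda>f. pscale (comp_counit f) (1 :: monomial \<Rightarrow>\<^sub>0 'a::field))"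
proof (rule alg_homI)
  show "linear_map (\<lambda>f. pscale (comp_counit f) (1 :: monomial \<Rightarrow>\<^sub>0 'a))"
    by (rule linear_mapI) (simp_all add: comp_counit_def lookup_add pscale.scale_left_distrib)
  show "pscale (comp_counit 1) (1 :: monomial \<Rightarrow>\<^sub>0 'a) = 1"
    by (simp add: comp_counit_one)
qed (simp add: comp_counit_basis)

lemma comp_counit_mult: "comp_counit (f * g) = comp_counit f * comp_counit g"
proof -
  have "pscale (comp_counit (f * g)) (1 :: monomial \<Rightarrow>\<^sub>0 'a) = pscale (comp_counit f * comp_counit g) 1"
    using alg_homD(3)[OF alg_hom_unit_counit, of f g] by (simp add: pscale_mult_left)
  then have "Poly_Mapping.lookup (pscale (comp_counit (f * g)) (1 :: monomial \<Rightarrow>\<^sub>0 'a)) 0 =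
      Poly_Mapping.lookup (pscale (comp_counit f * comp_counit g) (1 :: monomial \<Rightarrow>\<^sub>0 'a)) 0"
    by simp
  then show ?thesis
    by simp
qed

lemma alg_hom_form_left: "alg_hom (form_left comp_counit)"
  and alg_hom_form_right: "alg_hom (form_right comp_counit)"
  unfolding form_left_def form_right_def
  by (rule alg_hom_lin_ext; force simp: comp_counit_basis basis_vec_zero basis_vec_mult zero_prod_def
      split: prod.splits)+

lemma form_counit_comp_comult:
  "form_left comp_counit (comp_comult f) = f" "form_right comp_counit (comp_comult f) = f"
proof -
  have u: "comp_counit (basis_vec (comp_mon \<alpha>)) = (comp_unit \<alpha> :: 'a)" if "composition \<alpha>" for \<alpha>
    using comp_counit_comp_elem[OF that] by (simp add: comp_elem_eq)
  show "form_left comp_counit (comp_comult f) = f"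
  proof (rule alg_hom_comult_eqI[OF alg_hom_form_left alg_hom_id])
    fix \<alpha>
    assume \<alpha>: "composition \<alpha>"
    then have "form_left comp_counit (tensor (comp_elem (comp_take k \<alpha>)) (comp_elem (comp_drop k \<alpha>))) =
       comp_unit (comp_take k \<alpha>) * (comp_elem (comp_drop k \<alpha>) :: _ \<Rightarrow>\<^sub>0 'a)" for k
      by (simp add: comp_elem_eq form_left_def u composition_comp_take comp_unit_def)
    with \<alpha> show "(\<Sum>k\<le>sum_list \<alpha>. of_nat (sum_list \<alpha> choose k) * form_left comp_counit
        (tensor (comp_elem (comp_take k \<alpha>)) (comp_elem (comp_drop k \<alpha>)))) = (comp_elem \<alpha> :: _ \<Rightarrow>\<^sub>0 'a)"
      using comp_conv_unit_left[OF \<alpha>, of comp_elem] by (simp add: comp_conv_def)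
  qed
  show "form_right comp_counit (comp_comult f) = f"
  proof (rule alg_hom_comult_eqI[OF alg_hom_form_right alg_hom_id])
    fix \<alpha>
    assume \<alpha>: "composition \<alpha>"
    then have "form_right comp_counit (tensor (comp_elem (comp_take k \<alpha>)) (comp_elem (comp_drop k \<alpha>))) =
       (comp_elem (comp_take k \<alpha>) :: _ \<Rightarrow>\<^sub>0 'a) * comp_unit (comp_drop k \<alpha>)" for k
      by (simp add: comp_elem_eq form_right_def u composition_comp_drop comp_unit_def)
    with \<alpha> show "(\<Sum>k\<le>sum_list \<alpha>. of_nat (sum_list \<alpha> choose k) * form_right comp_counit
        (tensor (comp_elem (comp_take k \<alpha>)) (comp_elem (comp_drop k \<alpha>)))) = (comp_elem \<alpha> :: _ \<Rightarrow>\<^sub>0 'a)"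
      using comp_conv_unit_right[OF \<alpha>, of comp_elem] by (simp add: comp_conv_def)
  qed
qed

section \<open>The antipode axioms\<close>

abbreviation mult_lin :: "('b::comm_monoid_add \<times> 'b \<Rightarrow>\<^sub>0 'k::field) \<Rightarrow> ('b \<Rightarrow>\<^sub>0 'k)" where
  "mult_lin \<equiv> lin_ext (\<lambda>(a, b). basis_vec a * basis_vec b)"

text \<open>Commutativity is what makes the multiplication map a homomorphism, and hence what allows
  the antipode axioms to be checked on generators.\<close>

lemma alg_hom_mult_lin: "alg_hom mult_lin"
  by (rule alg_hom_lin_ext; force simp: basis_vec_zero basis_vec_mult zero_prod_def algebra_simps split: prod.splits)

lemma mult_lin_tensor: "mult_lin (tensor f g) = f * g"
proof (rule bilinear_map_eqI[where B = "\<lambda>f g. mult_lin (tensor f g)" and B' = "(*)"])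
  show "bilinear_map (\<lambda>f g. mult_lin (tensor f g))"
    by (rule bilinear_map_tensor_comp[OF linear_lin_ext])
qed (simp_all add: bilinear_times)

text \<open>On \<open>comp_elem \<alpha>\<close> the two left-hand sides are the convolutions of
  \<open>comp_elem\<close> with its inverse from either side, and the right-hand side is
  \<open>comp_unit \<alpha>\<close>.\<close>

lemma comp_antipode_left:
    "mult_lin (tensor_map comp_antipode id (comp_comult f)) = pscale (comp_counit f) 1" (is ?left)
  and comp_antipode_right:
    "mult_lin (tensor_map id comp_antipode (comp_comult f)) = pscale (comp_counit f) 1" (is ?right)
proof -
  have id: "alg_hom id"
    using alg_hom_id by (simp add: id_def)
  note lin = alg_homD(1)[OF alg_hom_comp_antipode] alg_homD(1)[OF id]
  note s = comp_antipode_comp_elem composition_comp_take composition_comp_drop comp_counit_comp_elem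
  have unit: "pscale (comp_unit \<alpha>) 1 = (comp_unit \<alpha> :: monomial \<Rightarrow>\<^sub>0 'a)" for \<alpha>
    by (simp add: comp_unit_def)
  show ?left
  proof (rule alg_hom_comult_eqI[where \<phi> = "\<lambda>t. mult_lin (tensor_map comp_antipode id t)"])
    show "alg_hom (\<lambda>t. mult_lin (tensor_map comp_antipode id t :: _ \<Rightarrow>\<^sub>0 'a))"
      by (intro alg_hom_comp[OF alg_hom_mult_lin] alg_hom_tensor_map alg_hom_comp_antipode id)
    fix \<alpha>
    assume \<alpha>: "composition \<alpha>"
    then show "(\<Sum>k\<le>sum_list \<alpha>. of_nat (sum_list \<alpha> choose k) * mult_lin (tensor_map comp_antipode id
        (tensor (comp_elem (comp_take k \<alpha>)) (comp_elem (comp_drop k \<alpha>))))) = pscale (comp_counit (comp_elem \<alpha>)) (1 :: _ \<Rightarrow>\<^sub>0 'a)"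
      using comp_inv_left[OF \<alpha>, of comp_elem]
      by (simp add: tensor_map_tensor[OF lin] mult_lin_tensor s comp_conv_def unit)
  qed (rule alg_hom_unit_counit)
  show ?right
  proof (rule alg_hom_comult_eqI[where \<phi> = "\<lambda>t. mult_lin (tensor_map id comp_antipode t)"])
    show "alg_hom (\<lambda>t. mult_lin (tensor_map id comp_antipode t :: _ \<Rightarrow>\<^sub>0 'a))"
      by (intro alg_hom_comp[OF alg_hom_mult_lin] alg_hom_tensor_map alg_hom_comp_antipode id)
    fix \<alpha>
    assume \<alpha>: "composition \<alpha>"
    then show "(\<Sum>k\<le>sum_list \<alpha>. of_nat (sum_list \<alpha> choose k) * mult_lin (tensor_map id comp_antipode
        (tensor (comp_elem (comp_take k \<alpha>)) (comp_elem (comp_drop k \<alpha>))))) = pscale (comp_counit (comp_elem \<alpha>)) (1 :: _ \<Rightarrow>\<^sub>0 'a)"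
      using comp_inv_right[OF \<alpha>, of comp_elem]
      by (simp add: tensor_map_tensor[OF lin(2,1)] mult_lin_tensor s comp_conv_def unit)
  qed (rule alg_hom_unit_counit)
qed

lemma homogeneous_comp_elem: "composition \<alpha> \<Longrightarrow> comp_elem \<alpha> \<in> homogeneous comp_degree (sum_list \<alpha>)"
  using homogeneous_basis[of "comp_mon \<alpha>" comp_degree] by (simp add: comp_elem_eq comp_degree_comp_mon)

lemma homogeneous_comp_inv: "composition \<alpha> \<Longrightarrow>
  (comp_inv comp_elem \<alpha> :: _ \<Rightarrow>\<^sub>0 'k::field) \<in> homogeneous comp_degree (sum_list \<alpha>)"
proof (induction "sum_list \<alpha>" arbitrary: \<alpha> rule: less_induct)
  case less
  show ?case
  proof (cases "sum_list \<alpha> = 0")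
    case True
    then show ?thesis
      by (simp add: comp_inv.simps homogeneous_def comp_degree_zero)
  next
    case False
    have "comp_inv comp_elem (comp_take k \<alpha>) * (comp_elem (comp_drop k \<alpha>) :: _ \<Rightarrow>\<^sub>0 'k)
        \<in> homogeneous comp_degree (sum_list \<alpha>)" if "k < sum_list \<alpha>" for k
      using homogeneous_times[OF comp_degree_add less(1)[of "comp_take k \<alpha>"]
          homogeneous_comp_elem[of "comp_drop k \<alpha>"]] that less(2)
      by (simp add: sum_comp_take sum_comp_drop composition_comp_take composition_comp_drop)
    then show ?thesis
      using False by (subst comp_inv.simps)
        (auto intro!: homogeneous_uminus homogeneous_sum homogeneous_scale simp flip: pscale_of_nat)
  qed
qed

lemma homogeneous_comp_antipode:
  "f \<in> homogeneous comp_degree n \<Longrightarrow> comp_antipode f \<in> homogeneous comp_degree n"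
  unfolding comp_antipode_def
proof (erule homogeneous_lin_ext)
  fix M
  assume "comp_degree M = n"
  moreover have "(\<Prod>a\<in>#M. comp_inv comp_elem (gen_composition a)) \<in>
      homogeneous comp_degree (\<Sum>a\<in>#M. sum_list (gen_composition a))"
    by (rule homogeneous_prod_mset) (simp_all add: comp_degree_zero comp_degree_add homogeneous_comp_inv)
  ultimately show "(\<Prod>a\<in>#M. comp_inv comp_elem (gen_composition a)) \<in> homogeneous comp_degree n"
    by (simp add: comp_degree_def)
qed

lemma homogeneous_comp_comult:
  "f \<in> homogeneous comp_degree n \<Longrightarrow>
    comp_comult f \<in> homogeneous (\<lambda>(a, b). comp_degree a + comp_degree b) n"
  unfolding comp_comult_def
proof (erule homogeneous_lin_ext)
  fix M
  assume M: "comp_degree M = n"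
  let ?d = "\<lambda>(a, b). comp_degree a + comp_degree b"
  have "(comp_comult_gen a :: _ \<Rightarrow>\<^sub>0 'a) \<in> homogeneous ?d (sum_list (gen_composition a))" for a
    unfolding comp_comult_gen_eq pscale_of_nat[symmetric]
  proof (intro homogeneous_sum homogeneous_scale)
    fix k
    assume "k \<in> {..sum_list (gen_composition a)}"
    then show "tensor (comp_elem (comp_take k (gen_composition a))) (comp_elem (comp_drop k (gen_composition a)))
        \<in> homogeneous ?d (sum_list (gen_composition a))"
      using homogeneous_tensor[OF homogeneous_comp_elem[of "comp_take k (gen_composition a)"]
          homogeneous_comp_elem[of "comp_drop k (gen_composition a)"]]
      by (simp add: composition_comp_take composition_comp_drop sum_comp_take sum_comp_drop)
  qed
  then have "(\<Prod>a\<in>#M. comp_comult_gen a :: _ \<Rightarrow>\<^sub>0 'a) \<in> homogeneous ?d (\<Sum>a\<in>#M. sum_list (gen_composition a))"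
    by (intro homogeneous_prod_mset) (auto simp add: comp_degree_zero comp_degree_add zero_prod_def)
  with M show "(\<Prod>a\<in>#M. comp_comult_gen a :: _ \<Rightarrow>\<^sub>0 'a) \<in> homogeneous ?d n"
    by (simp add: comp_degree_def)
qed

lemma bilinear_tensor_mult: "bilinear_map (tensor_mult A)"
  unfolding tensor_mult_def split_def
  by (rule bilinear_mapI) (simp_all add: lin_ext_bilinear)

text \<open>Identifies the product of the tensor square in the Hopf record with the ring product, so
  that the bialgebra axiom becomes multiplicativity of \<open>comp_comult\<close>.\<close>

lemma tensor_mult_times:
  fixes A :: "('b::comm_monoid_add, 'k::field) hopf"
  assumes "mult A = (*)"
  shows "tensor_mult A s t = s * t"
proof (rule bilinear_map_eqI[where B = "tensor_mult A" and B' = "(*)"])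
qed (auto simp: bilinear_tensor_mult bilinear_times tensor_mult_def assms basis_vec_mult)

lemma graded_hopf_algebra_comp: "graded_hopf_algebra (comp_hopf comp_counit comp_antipode)"
proof -
  have one: "1 \<in> homogeneous comp_degree 0"
    by (simp add: homogeneous_def comp_degree_zero)
  have counit_zero: "comp_counit f = 0" if "0 < n" "f \<in> homogeneous comp_degree n"
    for n and f :: "monomial \<Rightarrow>\<^sub>0 'a"
    using that comp_degree_zero unfolding homogeneous_iff comp_counit_def by (metis less_numeral_extra(3))
  have "graded_algebra (comp_hopf comp_counit (comp_antipode :: (_ \<Rightarrow>\<^sub>0 'a) \<Rightarrow> _))"
    by (simp add: graded_algebra_def comp_hopf_def bilinear_times mult.assoc one
        homogeneous_times[OF comp_degree_add])
  moreover have "graded_coalgebra (comp_hopf comp_counit (comp_antipode :: (_ \<Rightarrow>\<^sub>0 'a) \<Rightarrow> _))"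
    by (simp add: graded_coalgebra_def comp_hopf_def comp_counit_linear alg_homD(1)[OF alg_hom_comp_comult]
        comp_comult_coassoc form_counit_comp_comult homogeneous_comp_comult counit_zero)
  ultimately have "graded_bialgebra (comp_hopf comp_counit (comp_antipode :: (_ \<Rightarrow>\<^sub>0 'a) \<Rightarrow> _))"
    by (simp add: graded_bialgebra_def tensor_mult_times)
      (simp add: comp_hopf_def tensor_mult_times alg_homD[OF alg_hom_comp_comult] comp_counit_mult comp_counit_one)
  then show ?thesis
    by (simp add: graded_hopf_algebra_def)
      (simp add: comp_hopf_def mult_tensor_def alg_homD(1)[OF alg_hom_comp_antipode] comp_antipode_left comp_antipode_right
        homogeneous_comp_antipode)
qed

subsection \<open>Transport of structure\<close>

lemma tensor_map_comp:
  assumes "linear_map \<phi>" "linear_map \<psi>"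
  shows "tensor_map \<phi> \<psi> (tensor_map \<phi>' \<psi>' t) = tensor_map (\<lambda>f. \<phi> (\<phi>' f)) (\<lambda>f. \<psi> (\<psi>' f)) t"
proof (rule linear_map_eqI[OF linear_map_comp[OF linear_tensor_map linear_tensor_map] linear_tensor_map])
  show "tensor_map \<phi> \<psi> (tensor_map \<phi>' \<psi>' (basis_vec p)) =
      tensor_map (\<lambda>f. \<phi> (\<phi>' f)) (\<lambda>f. \<psi> (\<psi>' f)) (basis_vec p)" for p
    by (cases p) (simp add: tensor_map_basis tensor_map_tensor[OF assms])
qed

lemma tensor_assoc_basis: "tensor_assoc (basis_vec ((a, b), c)) = basis_vec (a, b, c)"
  by (simp add: tensor_assoc_def)

text \<open>Naturality of the associator, through which coassociativity passes to the transported
  structure.\<close>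

lemma tensor_assoc_tensor_map:
  assumes "linear_map \<phi>"
  shows "tensor_assoc (tensor_map (tensor_map \<phi> \<phi>) \<phi> t) = tensor_map \<phi> (tensor_map \<phi> \<phi>) (tensor_assoc t)"
proof (rule linear_map_eqI[OF linear_map_comp[OF linear_tensor_assoc linear_tensor_map]
      linear_map_comp[OF linear_tensor_map linear_tensor_assoc]])
  fix p
  show "tensor_assoc (tensor_map (tensor_map \<phi> \<phi>) \<phi> (basis_vec p)) =
      tensor_map \<phi> (tensor_map \<phi> \<phi>) (tensor_assoc (basis_vec p))"
    by (cases p rule: prod.exhaust[case_product prod.exhaust])
      (auto simp: tensor_map_basis tensor_assoc_tensor tensor_assoc_basis)
qed

text \<open>Conjugation by a bijection of bases carries every axiom over. The work lies in the
  derived constructions: \<open>fl\<close>, \<open>fr\<close>, \<open>tm\<close> and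
  \<open>mt\<close> record that counit contractions, the tensor square product and the
  multiplication map commute with \<phi>.\<close>

lemma graded_hopf_transport:
  fixes A :: "('b, 'k::field) hopf" and B :: "('c, 'k) hopf" and b :: "'b \<Rightarrow> 'c"
  assumes A: "graded_hopf_algebra A" and b: "bij b"
  defines "\<phi> \<equiv> lin_ext (\<lambda>x. basis_vec (b x))" and "\<phi>' \<equiv> lin_ext (\<lambda>x. basis_vec (inv b x))"
  assumes B: "\<And>x. degree B (b x) = degree A x" "\<And>f g. mult B f g = \<phi> (mult A (\<phi>' f) (\<phi>' g))"
    "unit B = \<phi> (unit A)" "\<And>f. comult B f = tensor_map \<phi> \<phi> (comult A (\<phi>' f))"
    "\<And>f. counit B f = counit A (\<phi>' f)" "\<And>f. antipode B f = \<phi> (antipode A (\<phi>' f))"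
  shows "graded_hopf_algebra B" "graded_hopf_iso A B \<phi>"
proof -
  have \<phi>: "linear_map \<phi>" and \<phi>': "linear_map \<phi>'"
    unfolding \<phi>_def \<phi>'_def by (rule linear_lin_ext)+
  have \<phi>_basis: "\<phi> (basis_vec x) = basis_vec (b x)" for x
    by (simp add: \<phi>_def)
  have \<phi>'_basis: "\<phi>' (basis_vec y) = basis_vec (inv b y)" for y
    by (simp add: \<phi>'_def)
  have inv [simp]: "inv b (b x) = x" "b (inv b y) = y" for x y
    using b by (simp_all add: bij_is_inj bij_is_surj surj_f_inv_f)
  have inv1 [simp]: "\<phi> (\<phi>' f) = f" for f
    by (rule linear_map_eqI[OF linear_map_comp[OF \<phi> \<phi>'] linear_map_id]) (simp add: \<phi>_basis \<phi>'_basis)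
  have inv2 [simp]: "\<phi>' (\<phi> f) = f" for f
    by (rule linear_map_eqI[OF linear_map_comp[OF \<phi>' \<phi>] linear_map_id]) (simp add: \<phi>_basis \<phi>'_basis)
  have id: "linear_map id"
    using linear_map_id by (simp add: id_def)
  have alg: "graded_algebra A" and coalg: "graded_coalgebra A" and bialg: "graded_bialgebra A"
    using A by (auto simp: graded_hopf_algebra_def graded_bialgebra_def)
  have \<phi>_hom: "\<phi> f \<in> homogeneous (degree B) n" if "f \<in> homogeneous (degree A) n" for f n
    unfolding \<phi>_def using that
    by (rule homogeneous_lin_ext) (metis B(1) homogeneous_basis)
  have \<phi>'_hom: "\<phi>' f \<in> homogeneous (degree A) n" if "f \<in> homogeneous (degree B) n" for f n
    unfolding \<phi>'_def using that
    by (rule homogeneous_lin_ext) (metis B(1) homogeneous_basis inv(2))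
  have \<phi>2_hom: "tensor_map \<phi> \<phi> t \<in> homogeneous (\<lambda>(x, y). degree B x + degree B y) n"
    if "t \<in> homogeneous (\<lambda>(x, y). degree A x + degree A y) n" for t n
    unfolding tensor_map_def using that
  proof (rule homogeneous_lin_ext)
    fix p :: "'b \<times> 'b"
    assume p: "(case p of (x, y) \<Rightarrow> degree A x + degree A y) = n"
    obtain x y where "p = (x, y)"
      by (cases p)
    then show "(case p of (x, y) \<Rightarrow> tensor (\<phi> (basis_vec x)) (\<phi> (basis_vec y)))
        \<in> homogeneous (\<lambda>(x, y). degree B x + degree B y) n"
      using p homogeneous_basis[of "(b x, b y)" "\<lambda>(x, y). degree B x + degree B y"]
      by (simp add: \<phi>_basis B(1))
  qed
  have bil: "bilinear_map (mult A)"
    using alg by (simp only: graded_algebra_def)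
  have bilB: "bilinear_map (mult B)"
    by (rule bilinear_mapI) (simp_all add: B linear_map_add[OF \<phi>] linear_map_add[OF \<phi>']
        linear_map_scale[OF \<phi>] linear_map_scale[OF \<phi>'] linear_map_add[OF bilinear_mapD(1)[OF bil]]
        linear_map_add[OF bilinear_mapD(2)[OF bil]] linear_map_scale[OF bilinear_mapD(1)[OF bil]]
        linear_map_scale[OF bilinear_mapD(2)[OF bil]])
  have linc: "linear_map (comult A)" and line: "linear_form (counit A)" and lins: "linear_map (antipode A)"
    using A coalg by (auto simp: graded_hopf_algebra_def graded_coalgebra_def)
  have lincB: "linear_map (comult B)"
    by (rule linear_mapI) (simp_all add: B linear_map_simps[OF linear_tensor_map]
        linear_map_simps[OF \<phi>'] linear_map_simps[OF linc])
  have linsB: "linear_map (antipode B)"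
    by (rule linear_mapI) (simp_all add: B linear_map_simps[OF \<phi>]
        linear_map_simps[OF \<phi>'] linear_map_simps[OF lins])
  have lineB: "linear_form (counit B)"
  proof -
    interpret e: module_hom pscale "(*)" "counit A"
      using line by (simp add: linear_iff_module_hom)
    show ?thesis
      by (unfold linear_iff_module_hom, unfold_locales)
        (simp_all add: algebra_simps B linear_map_simps[OF \<phi>'] e.add e.scale)
  qed
  have algB: "graded_algebra B"
    using alg bilB by (auto simp: graded_algebra_def B intro!: \<phi>_hom) (simp add: \<phi>'_hom)
  have coassoc: "tensor_assoc (tensor_map (comult B) id (comult B f)) = tensor_map id (comult B) (comult B f)" for f
  proof -
    let ?t = "comult A (\<phi>' f)"
    have "tensor_map (comult B) id (comult B f) = tensor_map (tensor_map \<phi> \<phi>) \<phi> (tensor_map (comult A) id ?t)"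
      by (simp add: B(4) tensor_map_comp[OF lincB id] tensor_map_comp[OF linear_tensor_map \<phi>])
    moreover have "tensor_map id (comult B) (comult B f) = tensor_map \<phi> (tensor_map \<phi> \<phi>) (tensor_map id (comult A) ?t)"
      by (simp add: B(4) tensor_map_comp[OF id lincB] tensor_map_comp[OF \<phi> linear_tensor_map])
    moreover have "tensor_assoc (tensor_map (comult A) id ?t) = tensor_map id (comult A) ?t"
      using coalg by (simp add: graded_coalgebra_def)
    ultimately show ?thesis
      by (simp add: tensor_assoc_tensor_map[OF \<phi>])
  qed
  have fl: "form_left (counit B) (tensor_map \<phi> \<phi> t) = \<phi> (form_left (counit A) t)"
    and fr: "form_right (counit B) (tensor_map \<phi> \<phi> t) = \<phi> (form_right (counit A) t)" for t
    unfolding form_left_def form_right_def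
    by (rule linear_map_eqI[OF linear_map_comp[OF linear_lin_ext linear_tensor_map] linear_map_comp[OF \<phi> linear_lin_ext]];
      force simp: tensor_map_basis \<phi>_basis \<phi>'_basis B linear_map_scale[OF \<phi>])+
  have coalgB: "graded_coalgebra B"
    using coalg lincB lineB coassoc
    by (auto simp: graded_coalgebra_def B(4) fl fr intro!: \<phi>2_hom \<phi>'_hom) (simp add: B(5) \<phi>'_hom)
  have tm: "tensor_mult B (tensor_map \<phi> \<phi> s) (tensor_map \<phi> \<phi> t) = tensor_map \<phi> \<phi> (tensor_mult A s t)" for s t
  proof (rule bilinear_map_eqI[where f = s and g = t and
        B = "\<lambda>s t. tensor_mult B (tensor_map \<phi> \<phi> s) (tensor_map \<phi> \<phi> t)"
        and B' = "\<lambda>s t. tensor_map \<phi> \<phi> (tensor_mult A s t)"])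
    show "bilinear_map (\<lambda>s t. tensor_mult B (tensor_map \<phi> \<phi> s) (tensor_map \<phi> \<phi> t))"
      and "bilinear_map (\<lambda>s t. tensor_map \<phi> \<phi> (tensor_mult A s t))"
      by (rule bilinear_mapI; simp add: linear_map_simps[OF linear_tensor_map]
        linear_map_simps[OF bilinear_mapD(1)[OF bilinear_tensor_mult]]
        linear_map_simps[OF bilinear_mapD(2)[OF bilinear_tensor_mult]])+
    show "tensor_mult B (tensor_map \<phi> \<phi> (basis_vec p)) (tensor_map \<phi> \<phi> (basis_vec q)) =
        tensor_map \<phi> \<phi> (tensor_mult A (basis_vec p) (basis_vec q))" for p q
      by (cases p; cases q) (simp add: tensor_map_basis \<phi>_basis \<phi>'_basis tensor_mult_def B tensor_map_tensor[OF \<phi> \<phi>])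
  qed
  have bialgB: "graded_bialgebra B"
    using algB coalgB bialg
    by (simp add: graded_bialgebra_def tm B tensor_map_tensor[OF \<phi> \<phi>])
  have mt: "mult_tensor B (tensor_map \<phi> \<phi> t) = \<phi> (mult_tensor A t)" for t
    unfolding mult_tensor_def
  proof (rule linear_map_eqI[OF linear_map_comp[OF linear_lin_ext linear_tensor_map] linear_map_comp[OF \<phi> linear_lin_ext]])
    show "lin_ext (\<lambda>(x, y). mult B (basis_vec x) (basis_vec y)) (tensor_map \<phi> \<phi> (basis_vec p)) =
        \<phi> (lin_ext (\<lambda>(x, y). mult A (basis_vec x) (basis_vec y)) (basis_vec p))" for p
      by (cases p) (simp add: tensor_map_basis \<phi>_basis \<phi>'_basis B)
  qed
  have S: "mult_tensor B (tensor_map (antipode B) id (comult B f)) = pscale (counit B f) (unit B)"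
    "mult_tensor B (tensor_map id (antipode B) (comult B f)) = pscale (counit B f) (unit B)" for f
  proof -
    let ?t = "comult A (\<phi>' f)"
    have "tensor_map (antipode B) id (comult B f) = tensor_map \<phi> \<phi> (tensor_map (antipode A) id ?t)"
      by (simp add: B(4,6) tensor_map_comp[OF linsB id] tensor_map_comp[OF \<phi> \<phi>])
    with A show "mult_tensor B (tensor_map (antipode B) id (comult B f)) = pscale (counit B f) (unit B)"
      by (simp add: mt graded_hopf_algebra_def B(3,5) linear_map_scale[OF \<phi>])
    have "tensor_map id (antipode B) (comult B f) = tensor_map \<phi> \<phi> (tensor_map id (antipode A) ?t)"
      by (simp add: B(4,6) tensor_map_comp[OF id linsB] tensor_map_comp[OF \<phi> \<phi>])
    with A show "mult_tensor B (tensor_map id (antipode B) (comult B f)) = pscale (counit B f) (unit B)"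
      by (simp add: mt graded_hopf_algebra_def B(3,5) linear_map_scale[OF \<phi>])
  qed
  show "graded_hopf_algebra B"
    using A bialgB linsB S by (auto simp: graded_hopf_algebra_def B(6) intro!: \<phi>_hom \<phi>'_hom)
  have "bij \<phi>"
    by (rule o_bij[of \<phi>']) (auto simp: fun_eq_iff)
  moreover have "\<phi> ` homogeneous (degree A) n = homogeneous (degree B) n" for n
    using \<phi>_hom \<phi>'_hom by (auto intro!: image_eqI[of _ \<phi> "\<phi>' _"])
  ultimately show "graded_hopf_iso A B \<phi>"
    by (simp add: graded_hopf_iso_def \<phi> B)
qed

subsection \<open>Run lengths of weakly decreasing lists\<close>

text \<open>In a weakly decreasing list equal entries are adjacent, so the runs are the
  multiplicities of the distinct values, largest value first.\<close>

fun runs :: "'a list \<Rightarrow> nat list" where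
  "runs [] = []"
| "runs [x] = [1]"
| "runs (x # y # zs) = (if x = y then Suc (hd (runs (y # zs))) # tl (runs (y # zs)) else 1 # runs (y # zs))"

abbreviation decreasing :: "'a::linorder list \<Rightarrow> bool" where
  "decreasing \<equiv> sorted_wrt (\<ge>)"

lemma runs_Cons_neq_Nil [simp]: "runs (x # xs) \<noteq> []"
  by (cases xs) auto

lemma runs_eq_Nil [simp]: "runs xs = [] \<longleftrightarrow> xs = []"
  by (cases xs) auto

lemma sum_runs: "sum_list (runs xs) = length xs"
proof (induction xs rule: runs.induct)
  case (3 x y zs)
  obtain r rs where "runs (y # zs) = r # rs"
    by (cases "runs (y # zs)") auto
  with 3 show ?case
    by (cases "x = y") auto
qed auto

lemma composition_runs: "composition (runs xs)"
proof (induction xs rule: runs.induct)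
  case (3 x y zs)
  obtain r rs where "runs (y # zs) = r # rs"
    by (cases "runs (y # zs)") auto
  with 3 show ?case
    by (cases "x = y") auto
qed auto

lemma runs_const: "xs \<noteq> [] \<Longrightarrow> set xs \<subseteq> {c} \<Longrightarrow> runs xs = [length xs]"
  by (induction xs rule: runs.induct) auto

lemma length_runs: "length (runs xs) \<le> 1 \<Longrightarrow> x \<in> set xs \<Longrightarrow> y \<in> set xs \<Longrightarrow> x = y"
proof (induction xs rule: runs.induct)
  case (3 a b zs)
  obtain r rs where "runs (b # zs) = r # rs"
    by (cases "runs (b # zs)") auto
  with 3 show ?case
    by (cases "a = b") auto
qed auto

text \<open>With \<open>runs_drop\<close> this is the bridge to the algebra: cutting the sorted
  coordinates of a point cuts its composition in the sense of the coproduct.\<close>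

lemma runs_take: "runs (take k xs) = comp_take k (runs xs)"
proof (induction xs arbitrary: k rule: runs.induct)
  case (2 x)
  then show ?case
    by (cases k) auto
next
  case (3 x y zs)
  obtain r rs where r: "runs (y # zs) = r # rs"
    by (cases "runs (y # zs)") auto
  have pos: "0 < r"
    using composition_runs[of "y # zs"] r by simp
  consider "k = 0" | "k = 1" | k' where "k = Suc (Suc k')"
    by (metis One_nat_def not0_implies_Suc)
  then show ?case
  proof cases
    case 3
    have "runs (take (Suc k') (y # zs)) = comp_take (Suc k') (r # rs)"
      using "3.IH"(1)[of "Suc k'"] "3.IH"(3)[of "Suc k'"] r by (cases "x = y") auto
    then show ?thesis
      using 3 r pos by (auto simp del: runs.simps(2)) 
  qed (use r pos in auto)
qed simp

lemma runs_drop: "runs (drop k xs) = comp_drop k (runs xs)"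
proof (induction xs arbitrary: k rule: runs.induct)
  case (2 x)
  then show ?case
    by (cases k) auto
next
  case (3 x y zs)
  obtain r rs where r: "runs (y # zs) = r # rs"
    by (cases "runs (y # zs)") auto
  have pos: "0 < r"
    using composition_runs[of "y # zs"] r by simp
  show ?case
  proof (cases k)
    case (Suc k')
    have "runs (drop k' (y # zs)) = comp_drop k' (r # rs)"
      using "3.IH"(1)[of k'] "3.IH"(3)[of k'] r by (cases "x = y") auto
    then show ?thesis
      using Suc r pos by auto
  qed (use r pos in auto)
qed simp

text \<open>The runs only depend on the places where neighbours coincide. This is exactly the
  information that functionals can detect, by \<open>amax_le_orbit_swap\<close>.\<close>

lemma runs_eqI:
  assumes "length xs = length ys"
    and "\<And>k. Suc k < length xs \<Longrightarrow> xs ! k = xs ! Suc k \<longleftrightarrow> ys ! k = ys ! Suc k"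
  shows "runs xs = runs ys"
  using assms
proof (induction xs arbitrary: ys rule: runs.induct)
  case (2 x)
  then show ?case
    by (cases ys rule: runs.cases) auto
next
  case (3 a b zs)
  then obtain c d us where ys: "ys = c # d # us"
    by (cases ys rule: runs.cases) auto
  have ab: "a = b \<longleftrightarrow> c = d"
    using "3.prems"(2)[of 0] ys by auto
  have "(b # zs) ! k = (b # zs) ! Suc k \<longleftrightarrow> (d # us) ! k = (d # us) ! Suc k" if "Suc k < length (b # zs)" for k
    using "3.prems"(2)[of "Suc k"] ys that by auto
  moreover have "length (b # zs) = length (d # us)"
    using "3.prems"(1) ys by simp
  ultimately have "runs (b # zs) = runs (d # us)"
    using "3.IH" by blast
  with ab ys show ?case
    by simp
qed simp

text \<open>Equal runs mean that the lists differ by an order preserving renaming of values. It is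
  built from the small end, one value being added whenever a new run starts at the front.\<close>

lemma runs_eq_imp_strict_mono_map:
  fixes xs :: "'a::linorder list" and ys :: "'b::linorder list"
  assumes "runs xs = runs ys" "decreasing xs" "decreasing ys"
  shows "\<exists>h. strict_mono_on (set ys) h \<and> xs = map h ys"
  using assms
proof (induction xs arbitrary: ys rule: runs.induct)
  case 1
  then have "ys = []"
    by (metis runs.simps(1) runs_eq_Nil)
  then show ?case
    by (auto simp: strict_mono_on_def)
next
  case (2 x)
  then have "length ys = 1"
    using sum_runs[of ys] sum_runs[of "[x]"] by (metis length_Cons list.size(3) One_nat_def)
  then obtain y where "ys = [y]"
    by (auto simp: length_Suc_conv)
  then show ?case
    by (auto simp: strict_mono_on_def)
next
  case (3 a b zs)
  then have "length ys = length (a # b # zs)"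
    using sum_runs[of ys] sum_runs[of "a # b # zs"] by metis
  then obtain c d us where ys: "ys = c # d # us"
    by (auto simp: length_Suc_conv)
  obtain r rs where r: "runs (b # zs) = r # rs"
    by (cases "runs (b # zs)") auto
  obtain q qs where q: "runs (d # us) = q # qs"
    by (cases "runs (d # us)") auto
  have "0 < r" "0 < q"
    using composition_runs[of "b # zs"] composition_runs[of "d # us"] r q by auto
  then have ab: "a = b \<longleftrightarrow> c = d" and rq: "runs (b # zs) = runs (d # us)"
    using "3.prems"(1) ys r q by (auto split: if_splits)
  have dec: "decreasing (b # zs)" "decreasing (d # us)"
    using 3 ys by auto
  have "\<exists>h. strict_mono_on (set (d # us)) h \<and> b # zs = map h (d # us)"
  proof (cases "a = b")
    case True
    show ?thesis
      by (rule "3.IH"(1)[OF True rq dec])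
  next
    case False
    show ?thesis
      by (rule "3.IH"(3)[OF False rq dec])
  qed
  then obtain h where h: "strict_mono_on (set (d # us)) h" "b # zs = map h (d # us)"
    by (elim exE conjE) (rule that)
  show ?case
  proof (cases "a = b")
    case True
    then have c: "ys = d # d # us"
      using ab ys by simp
    have "b = h d"
      using h(2) by simp
    then have "a # b # zs = map h ys"
      unfolding c list.map(2) using h(2) True by simp
    moreover have "set ys = set (d # us)"
      using c by simp
    ultimately show ?thesis
      using h(1) by metis
  next
    case False
    with 3 ys ab have c: "\<forall>y\<in>set (d # us). y < c" and a: "\<forall>x\<in>set (b # zs). x < a"
      by force+
    \<comment> \<open>The new value \<open>c\<close> exceeds all of \<open>d # us\<close> and
      \<open>a\<close> exceeds all of \<open>b # zs\<close>, so sending \<open>c\<close> to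
      \<open>a\<close> keeps the renaming strictly monotone.\<close>
    have "strict_mono_on (set ys) (h(c := a))"
    proof (rule strict_mono_onI)
      fix u v
      assume uv: "u \<in> set ys" "v \<in> set ys" "u < v"
      then have "u \<noteq> c"
        using c ys by (metis less_asym set_ConsD)
      then have u: "u \<in> set (d # us)"
        using uv ys by auto
      then have hu: "h u \<in> set (b # zs)"
        unfolding h(2) set_map by (rule imageI)
      show "(h(c := a)) u < (h(c := a)) v"
      proof (cases "v = c")
        case True
        with bspec[OF a hu] \<open>u \<noteq> c\<close> show ?thesis
          by simp
      next
        case False
        with uv ys have "v \<in> set (d # us)"
          by auto
        with u uv \<open>u \<noteq> c\<close> False show ?thesis
          using strict_mono_onD[OF h(1)] by simp
      qed
    qed
    moreover have "c \<notin> set (d # us)"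
      using c by blast
    then have "map (h(c := a)) (d # us) = map h (d # us)"
      by (intro map_cong refl) auto
    then have "a # b # zs = map (h(c := a)) ys"
      unfolding ys by (subst list.map(2)) (simp only: fun_upd_same h(2))
    ultimately show ?thesis
      by (intro exI conjI)
  qed
qed

section \<open>The composition of a multiset of values\<close>

definition desc :: "'a::linorder multiset \<Rightarrow> 'a list" where
  "desc X = rev (sorted_list_of_multiset X)"

lemma mset_desc [simp]: "mset (desc X) = X"
  by (simp add: desc_def)

lemma decreasing_desc [simp]: "decreasing (desc X)"
  by (simp add: desc_def sorted_wrt_rev)

lemma desc_eqI: "decreasing xs \<Longrightarrow> mset xs = X \<Longrightarrow> desc X = xs"
proof -
  assume "decreasing xs" "mset xs = X"
  then have "sorted (rev xs)" "mset (rev xs) = X"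
    by (simp_all add: sorted_wrt_rev)
  then have "sorted_list_of_multiset X = rev xs"
    by (metis sorted_list_of_multiset_mset sorted_sort_id)
  then show ?thesis
    by (simp add: desc_def)
qed

lemma length_desc [simp]: "length (desc X) = size X"
  by (metis mset_desc size_mset)

lemma set_desc [simp]: "set (desc X) = set_mset X"
  by (metis mset_desc set_mset_mset)

definition mtype :: "'a::linorder multiset \<Rightarrow> nat list" where
  "mtype X = runs (desc X)"

lemma mtype_mset: "decreasing xs \<Longrightarrow> mtype (mset xs) = runs xs"
  by (simp add: mtype_def desc_eqI)

lemma composition_mtype: "composition (mtype X)"
  by (simp add: mtype_def composition_runs)

lemma sum_mtype: "sum_list (mtype X) = size X"
  by (simp add: mtype_def sum_runs)

lemma mtype_eq_imp_strict_mono_image: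
  assumes "mtype X = mtype Y"
  shows "\<exists>h. strict_mono_on (set_mset Y) h \<and> X = image_mset h Y"
proof -
  obtain h where h: "strict_mono_on (set (desc Y)) h" "desc X = map h (desc Y)"
    using runs_eq_imp_strict_mono_map[of "desc X" "desc Y"] assms by (auto simp: mtype_def)
  then have "X = image_mset h Y"
    by (metis mset_desc mset_map)
  with h show ?thesis
    by auto
qed

lemma mtype_surj:
  assumes "composition \<alpha>"
  shows "\<exists>X :: real multiset. mtype X = \<alpha>"
proof -
  have "\<exists>xs :: real list. decreasing xs \<and> runs xs = \<alpha>"
    using assms
  proof (induction \<alpha>)
    case (Cons a \<alpha>)
    then obtain xs :: "real list" where xs: "decreasing xs" "runs xs = \<alpha>"
      by auto
    \<comment> \<open>A value above all present entries, so that its copies form a run of their own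
      at the front.\<close>
    define m where "m = (if xs = [] then 0 else hd xs + 1)"
    have m: "x < m" if "x \<in> set xs" for x
      using that xs(1) by (cases xs) (auto simp: m_def)
    \<comment> \<open>The runs are computed for \<open>Suc n\<close> copies because zero copies
      contribute no part; a part \<open>a\<close> of a composition is positive and has this
      form.\<close>
    have "decreasing (replicate n m @ xs) \<and> runs (replicate (Suc n) m @ xs) = Suc n # \<alpha>" for n
    proof (induction n)
      case 0
      with xs m show ?case
        by (cases xs) fastforce+
    next
      case (Suc n)
      with m show ?case
        by (auto simp: less_imp_le)
    qed
    moreover have "Suc (a - 1) = a"
      using Cons.prems by simp
    moreover have "decreasing (replicate a m)"
      by (auto simp: sorted_wrt_iff_nth_less)
    ultimately have "runs (replicate a m @ xs) = a # \<alpha>" "decreasing (replicate a m @ xs)"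
      using m xs by (metis, auto simp: sorted_wrt_append less_imp_le)
    then show ?case
      by blast
  qed auto
  then show ?thesis
    by (metis mtype_mset)
qed

subsection \<open>Farkas' lemma and exposed faces\<close>

lemmas linear_simps = linear_add linear_scale

text \<open>Bartl's algebraic proof, by induction on the number of functionals.\<close>

lemma farkas:
  fixes a :: "'i \<Rightarrow> 'v::real_vector \<Rightarrow> real"
  assumes "finite A" "\<And>i. linear (a i)" "linear b"
    and "\<And>y. (\<forall>i\<in>A. a i y \<le> 0) \<Longrightarrow> b y \<le> 0"
  shows "\<exists>c. (\<forall>i\<in>A. 0 \<le> c i) \<and> (\<forall>y. b y = (\<Sum>i\<in>A. c i * a i y))"
  using assms
proof (induction A arbitrary: a b rule: finite_induct)
  case empty
  have "b y = 0" for y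
    using empty(3)[of y] empty(3)[of "- y"] linear_neg[OF empty(2)] by simp
  then show ?case
    by simp
next
  case (insert k A)
  note lin = insert.prems(1,2)
  show ?case
  proof (cases "\<forall>y. (\<forall>i\<in>A. a i y \<le> 0) \<longrightarrow> b y \<le> 0")
    case True
    then have "\<exists>c. (\<forall>i\<in>A. 0 \<le> c i) \<and> (\<forall>y. b y = (\<Sum>i\<in>A. c i * a i y))"
      by (intro insert.IH lin) simp
    then obtain c where c: "\<forall>i\<in>A. 0 \<le> c i" "\<forall>y. b y = (\<Sum>i\<in>A. c i * a i y)"
      by (elim exE conjE) (rule that)
    have "(\<Sum>i\<in>insert k A. (c(k := 0)) i * a i y) = (\<Sum>i\<in>A. c i * a i y)" for y
      using insert.hyps by (auto intro!: sum.cong)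
    with c show ?thesis
      by (intro exI[of _ "c(k := 0)"]) auto
  next
    case False
    then obtain z where z: "\<forall>i\<in>A. a i z \<le> 0" "b z > 0"
      by force
    then have "a k z > 0"
      using insert.prems(3)[of z] by force
    \<comment> \<open>The point \<open>z\<close> satisfies all constraints except the one at
      \<open>k\<close>. Once it is normalized, subtracting \<open>a k y *\<^sub>R y0\<close>
      projects along \<open>y0\<close> onto the kernel of \<open>a k\<close>, and the induction
      hypothesis is applied to the functionals composed with this projection.\<close>
    define y0 where "y0 = (1 / a k z) *\<^sub>R z"
    have y0: "a k y0 = 1" "\<forall>i\<in>A. a i y0 \<le> 0" "b y0 > 0"
      using z \<open>a k z > 0\<close> by (auto simp: y0_def linear_scale[OF lin(1)] linear_scale[OF lin(2)] divide_nonpos_pos)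
    let ?a = "\<lambda>i y. a i (y - a k y *\<^sub>R y0)" and ?b = "\<lambda>y. b (y - a k y *\<^sub>R y0)"
    have l: "linear (\<lambda>y. y - a k y *\<^sub>R y0)"
      by (rule linearI) (simp_all add: linear_simps[OF lin(1)] algebra_simps)
    have "\<exists>c. (\<forall>i\<in>A. 0 \<le> c i) \<and> (\<forall>y. ?b y = (\<Sum>i\<in>A. c i * ?a i y))"
    proof (rule insert.IH)
      show "linear (?a i)" for i
        using linear_compose[OF l lin(1)[of i]] by (simp add: o_def)
      show "linear ?b"
        using linear_compose[OF l lin(2)] by (simp add: o_def)
      show "?b y \<le> 0" if "\<forall>i\<in>A. ?a i y \<le> 0" for y
        using that insert.prems(3)[of "y - a k y *\<^sub>R y0"] y0(1)
        by (simp add: linear_diff[OF lin(1)] linear_scale[OF lin(1)])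
    qed
    then obtain c where c: "\<forall>i\<in>A. 0 \<le> c i" "\<And>y. ?b y = (\<Sum>i\<in>A. c i * ?a i y)"
      by (elim exE conjE) (rule that, simp_all)
    \<comment> \<open>The coefficient at \<open>k\<close> is forced by evaluation at
      \<open>y0\<close>, where \<open>a k\<close> is 1. It is nonnegative since \<open>b y0\<close>
      is positive and the sum is nonpositive.\<close>
    define d where "d = c(k := b y0 - (\<Sum>i\<in>A. c i * a i y0))"
    have d: "d i = c i" if "i \<in> A" for i
      using insert.hyps that by (auto simp: d_def)
    have "(\<Sum>i\<in>A. c i * a i y0) \<le> 0"
      using c(1) y0(2) by (intro sum_nonpos) (simp add: mult_nonneg_nonpos)
    then have "\<forall>i\<in>insert k A. 0 \<le> d i"
      using c(1) y0(3) d by (auto simp: d_def)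
    moreover have "b y = (\<Sum>i\<in>insert k A. d i * a i y)" for y
    proof -
      have "b y - a k y * b y0 = (\<Sum>i\<in>A. c i * a i y) - a k y * (\<Sum>i\<in>A. c i * a i y0)"
        using c(2)[of y]
        by (simp add: linear_diff[OF lin(1)] linear_scale[OF lin(1)] linear_diff[OF lin(2)] linear_scale[OF lin(2)]
            right_diff_distrib sum_subtractf sum_distrib_left mult.left_commute)
      then have "b y = (\<Sum>i\<in>A. c i * a i y) + d k * a k y"
        by (simp add: d_def algebra_simps)
      then show ?thesis
        using insert.hyps d by simp
    qed
    ultimately show ?thesis
      by (intro exI[of _ d] conjI allI)
  qed
qed

section \<open>Maximal faces and exposedness\<close>

lemma lookup_scaleR [simp]: "coord (c *\<^sub>R p) i = c *\<^sub>R coord p i"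
  by (simp add: scaleR_poly_mapping_def)

lemma linear_pairing: "linear (pairing I y)"
  by (rule linearI) (simp_all add: pairing_def lookup_add algebra_simps sum.distrib sum_distrib_left)

lemma linear_pairing_left: "linear (\<lambda>y. pairing I (coord y) p)"
  by (rule linearI) (simp_all add: pairing_def lookup_add algebra_simps sum.distrib sum_distrib_left)

lemma pairing_cong: "(\<And>i. i \<in> I \<Longrightarrow> y i = y' i) \<Longrightarrow> pairing I y p = pairing I y' p"
  by (simp add: pairing_def)

definition supported :: "nat set \<Rightarrow> polytope \<Rightarrow> bool" where
  "supported I P \<longleftrightarrow> (\<forall>p\<in>P. supp p \<subseteq> I)"

lemma supported_lookup: "supported I P \<Longrightarrow> p \<in> P \<Longrightarrow> i \<notin> I \<Longrightarrow> coord p i = 0"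
  by (metis in_keys_iff subsetD supported_def)

definition amax :: "nat set \<Rightarrow> polytope \<Rightarrow> (nat \<Rightarrow> real) \<Rightarrow> polytope" where
  "amax I P y = {p \<in> P. \<forall>q\<in>P. pairing I y q \<le> pairing I y p}"

text \<open>For a polytope this says that \<open>y'\<close> lies in the normal cone of the maximal
  face of \<open>y\<close>. The cones of the normal fan are the principal up-sets of this
  preorder.\<close>

definition amax_le :: "nat set \<Rightarrow> polytope \<Rightarrow> (nat \<Rightarrow> real) \<Rightarrow> (nat \<Rightarrow> real) \<Rightarrow> bool" where
  "amax_le I P y y' \<longleftrightarrow> amax I P y \<subseteq> amax I P y'"

lemma amax_cong: "(\<And>i. i \<in> I \<Longrightarrow> y i = y' i) \<Longrightarrow> amax I P y = amax I P y'"
  using pairing_cong[of I y y'] by (simp add: amax_def)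

text \<open>A convex combination that attains the maximum puts no weight on points with a smaller
  value: the weighted deficits are nonnegative and sum to zero.\<close>

lemma convex_hull_attains:
  fixes g :: "'v::real_vector \<Rightarrow> real"
  assumes "finite V" "linear g" "x \<in> convex hull V" "\<And>v. v \<in> V \<Longrightarrow> g v \<le> g x"
  shows "x \<in> convex hull {v \<in> V. g v = g x}"
proof -
  obtain u where u: "\<forall>v\<in>V. 0 \<le> u v" "sum u V = 1" "(\<Sum>v\<in>V. u v *\<^sub>R v) = x"
    using assms(1,3) by (auto simp: convex_hull_finite)
  have "(\<Sum>v\<in>V. u v * (g x - g v)) = 0"
  proof -
    have "(\<Sum>v\<in>V. u v * g v) = g x"
      unfolding u(3)[symmetric] by (simp add: linear_sum[OF assms(2)] linear_scale[OF assms(2)])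
    then show ?thesis
      using u(2) by (simp add: right_diff_distrib sum_subtractf flip: sum_distrib_right)
  qed
  then have "\<forall>v\<in>V. u v * (g x - g v) = 0"
    using assms(1,4) u(1) by (subst (asm) sum_nonneg_eq_0_iff) auto
  then have z: "g v = g x" if "v \<in> V" "u v \<noteq> 0" for v
    using that by force
  let ?W = "{v \<in> V. g v = g x}"
  have "sum u ?W = sum u V" "(\<Sum>v\<in>?W. u v *\<^sub>R v) = (\<Sum>v\<in>V. u v *\<^sub>R v)"
    using assms(1) z by (auto intro!: sum.mono_neutral_left)
  then have "sum u ?W = 1" "(\<Sum>v\<in>?W. u v *\<^sub>R v) = x"
    using u by simp_all
  then show ?thesis
    using assms(1) u(1) by (auto simp: convex_hull_finite)
qed

lemma linear_le_convex_hull: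
  fixes g :: "'v::real_vector \<Rightarrow> real"
  assumes "linear g" "x \<in> convex hull V" "\<And>v. v \<in> V \<Longrightarrow> g v \<le> c"
  shows "g x \<le> c"
proof -
  have "convex {x. g x \<le> c}"
    using linear_simps[OF assms(1)]
    by (auto simp: convex_def intro: convex_bound_le)
  then have "convex hull V \<subseteq> {x. g x \<le> c}"
    using assms(3) by (intro hull_minimal) auto
  with assms(2) show ?thesis
    by auto
qed

lemma amax_convex_hull:
  assumes "finite V"
  shows "amax I (convex hull V) y = convex hull (amax I V y)"
proof (intro equalityI subsetI)
  fix x
  assume "x \<in> amax I (convex hull V) y"
  then have x: "x \<in> convex hull V" "\<And>v. v \<in> V \<Longrightarrow> pairing I y v \<le> pairing I y x"
    by (auto simp: amax_def hull_inc)
  have "x \<in> convex hull {v \<in> V. pairing I y v = pairing I y x}"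
    by (rule convex_hull_attains[OF assms linear_pairing x])
  also have "\<dots> \<subseteq> convex hull (amax I V y)"
    using x(2) by (intro hull_mono) (auto simp: amax_def)
  finally show "x \<in> convex hull (amax I V y)" .
next
  fix x
  assume x: "x \<in> convex hull (amax I V y)"
  then have "amax I V y \<noteq> {}"
    by auto
  then obtain v where v: "v \<in> amax I V y"
    by blast
  have "- pairing I y x \<le> - pairing I y v"
  proof (rule linear_le_convex_hull[OF _ x])
    show "linear (\<lambda>p. - pairing I y p)"
      using linear_pairing by (rule linear_compose_neg)
  qed (use v in \<open>auto simp: amax_def\<close>)
  moreover have "pairing I y q \<le> pairing I y v" if "q \<in> convex hull V" for q
    using v by (intro linear_le_convex_hull[OF linear_pairing that]) (auto simp: amax_def)
  moreover have "x \<in> convex hull V"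
    using x hull_mono[of "amax I V y" V] by (auto simp: amax_def)
  ultimately show "x \<in> amax I (convex hull V) y"
    by (fastforce simp: amax_def)
qed

lemma amax_vertices: "amax I V y = V \<inter> amax I (convex hull V) y"
proof (intro equalityI subsetI)
  fix v
  assume v: "v \<in> amax I V y"
  have "pairing I y q \<le> pairing I y v" if "q \<in> convex hull V" for q
    using v by (intro linear_le_convex_hull[OF linear_pairing that]) (auto simp: amax_def)
  with v show "v \<in> V \<inter> amax I (convex hull V) y"
    by (auto simp: amax_def hull_inc)
qed (auto simp: amax_def hull_inc)

lemma amax_convex_hull_nonempty:
  assumes "finite V" "V \<noteq> {}"
  shows "amax I (convex hull V) y \<noteq> {}"
proof -
  have "Max (pairing I y ` V) \<in> pairing I y ` V"
    using assms by (intro Max_in) auto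
  then obtain v where "v \<in> V" "pairing I y v = Max (pairing I y ` V)"
    by auto
  with assms(1) have "v \<in> amax I V y"
    by (simp add: amax_def)
  then show ?thesis
    using amax_vertices by blast
qed

text \<open>Inclusion of maximal faces can be tested on any finite spanning set; for orbits it
  thereby becomes a statement about sorted vectors.\<close>

lemma amax_le_convex_hull:
  assumes "finite V"
  shows "amax_le I (convex hull V) y y' \<longleftrightarrow> amax I V y \<subseteq> amax I V y'"
  using amax_vertices[of I V y] amax_vertices[of I V y'] hull_mono[of "amax I V y" "amax I V y'" convex]
  by (auto simp: amax_le_def amax_convex_hull[OF assms])

lemma amax_face_of:
  assumes "convex P"
  shows "amax I P y face_of P"
proof (cases "amax I P y = {}")
  case False
  then obtain m where m: "m \<in> amax I P y"
    by blast
  have eq: "amax I P y = {p \<in> P. pairing I y p = pairing I y m}"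
    using m by (fastforce simp: amax_def)
  have lin: "pairing I y ((1 - u) *\<^sub>R a + u *\<^sub>R b) = (1 - u) * pairing I y a + u * pairing I y b" for u a b
    by (simp add: linear_simps[OF linear_pairing])
  show ?thesis
    unfolding face_of_def
  proof (intro conjI ballI impI)
    show "amax I P y \<subseteq> P"
      by (auto simp: amax_def)
    show "convex (amax I P y)"
    proof (rule convexI)
      fix a b and u v :: real
      assume ab: "a \<in> amax I P y" "b \<in> amax I P y" "0 \<le> u" "0 \<le> v" "u + v = 1"
      then have "u *\<^sub>R a + v *\<^sub>R b \<in> P"
        using assms by (auto simp: eq convex_def)
      moreover have "u * pairing I y m + v * pairing I y m = pairing I y m"
        using ab(5) by (simp flip: distrib_right)
      ultimately show "u *\<^sub>R a + v *\<^sub>R b \<in> amax I P y"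
        using ab by (simp add: eq linear_simps[OF linear_pairing])
    qed
    fix a b x
    assume ab: "a \<in> P" "b \<in> P" "x \<in> amax I P y" "x \<in> open_segment a b"
    then obtain u where u: "0 < u" "u < 1" "x = (1 - u) *\<^sub>R a + u *\<^sub>R b"
      by (auto simp: in_segment)
    let ?m = "pairing I y m"
    have le: "pairing I y a \<le> ?m" "pairing I y b \<le> ?m"
      using m ab by (auto simp: amax_def)
    have "(1 - u) * pairing I y a + u * pairing I y b = ?m"
      using ab(3) u(3) lin by (simp add: eq)
    then have "(1 - u) * (?m - pairing I y a) + u * (?m - pairing I y b) = 0"
      by (simp add: algebra_simps)
    moreover have "0 \<le> (1 - u) * (?m - pairing I y a)" "0 \<le> u * (?m - pairing I y b)"
      using le u by simp_all
    ultimately have "(1 - u) * (?m - pairing I y a) = 0" "u * (?m - pairing I y b) = 0"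
      by linarith+
    with u ab show "a \<in> amax I P y" "b \<in> amax I P y"
      by (auto simp: eq)
  qed
qed simp

text \<open>If \<open>w\<close> has weight less than 1, the point lies between \<open>w\<close> and
  the normalized average \<open>q\<close> of the remaining points. Either \<open>q = w\<close>, or
  the point is inside an open segment ending at \<open>w\<close>, and a face containing it contains
  \<open>w\<close>.\<close>

lemma face_of_convex_hull_weight:
  fixes V :: "'v::real_vector set"
  assumes "F face_of convex hull V" "finite V" "(\<Sum>v\<in>V. u v *\<^sub>R v) \<in> F"
    and "\<And>v. v \<in> V \<Longrightarrow> 0 \<le> u v" "sum u V = 1" "w \<in> V" "0 < u w"
  shows "w \<in> F"
proof (cases "u w = 1")
  case True
  then have "sum u (V - {w}) = 0"
    using assms by (simp add: sum_diff1)
  then have "\<forall>v\<in>V - {w}. u v = 0"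
    using assms by (subst (asm) sum_nonneg_eq_0_iff) auto
  then have "(\<Sum>v\<in>V. u v *\<^sub>R v) = w"
    using assms True by (simp add: sum.remove[of V w])
  with assms show ?thesis
    by simp
next
  case False
  let ?s = "1 - u w" and ?x = "\<Sum>v\<in>V. u v *\<^sub>R v"
  have sum: "sum u (V - {w}) = ?s"
    using assms by (simp add: sum_diff1)
  moreover have "0 \<le> sum u (V - {w})"
    using assms by (intro sum_nonneg) auto
  ultimately have s: "0 < ?s"
    using False by auto
  define q where "q = (\<Sum>v\<in>V - {w}. (u v / ?s) *\<^sub>R v)"
  have "q \<in> convex hull (V - {w})"
    using assms s sum unfolding q_def convex_hull_finite[OF finite_Diff[OF assms(2)]]
    by (auto intro!: exI[of _ "\<lambda>v. u v / ?s"] simp flip: sum_divide_distrib)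
  then have q: "q \<in> convex hull V"
    using hull_mono[of "V - {w}" V convex] by blast
  have "?s *\<^sub>R q = (\<Sum>v\<in>V - {w}. u v *\<^sub>R v)"
    using s by (simp add: q_def scaleR_sum_right)
  then have x: "?x = (1 - ?s) *\<^sub>R w + ?s *\<^sub>R q"
    using assms by (simp add: sum.remove[of V w])
  show ?thesis
  proof (cases "q = w")
    case True
    then have "?x = w"
      using x by (simp flip: scaleR_left_distrib)
    with assms show ?thesis
      by simp
  next
    case False
    then have "?x \<in> open_segment w q"
      unfolding in_segment using s assms(7) x by (intro conjI exI[of _ ?s]) auto
    then show ?thesis
      using face_ofD[OF assms(1) _ _ q assms(3)] hull_inc[OF assms(6)] by blast
  qed
qed

text \<open>Let \<open>p\<close> be the barycentre of the points of \<open>V\<close> in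
  \<open>F\<close>. If no functional maximal at \<open>p\<close> were strictly smaller at some
  \<open>v\<close> outside \<open>F\<close>, Farkas' lemma would express \<open>p\<close> as a
  convex combination with positive weight at \<open>v\<close>, forcing \<open>v\<close> into
  \<open>F\<close>. The sum of such functionals over all \<open>v\<close> exposes
  \<open>F\<close>.\<close>

lemma face_of_convex_hull_exposed:
  assumes I: "finite I" and V: "finite V" "supported I V"
    and F: "F face_of convex hull V" "F \<noteq> {}"
  shows "\<exists>y. F = amax I (convex hull V) y"
proof -
  let ?P = "\<lambda>y. pairing I (coord y)"
  let ?W = "V \<inter> F"
  have F_hull: "F \<subseteq> convex hull V"
    using F(1) by (rule face_of_imp_subset)
  have comb: "\<exists>u. (\<forall>v\<in>V. 0 \<le> u v) \<and> sum u V = 1 \<and> (\<Sum>v\<in>V. u v *\<^sub>R v) = x \<and> (\<forall>v\<in>V. v \<notin> F \<longrightarrow> u v = 0)"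
    if "x \<in> F" for x
  proof -
    obtain u where u: "\<forall>v\<in>V. 0 \<le> u v" "sum u V = 1" "(\<Sum>v\<in>V. u v *\<^sub>R v) = x"
      using \<open>x \<in> F\<close> F_hull V(1) by (auto simp: convex_hull_finite)
    moreover have "u v = 0" if "v \<in> V" "v \<notin> F" for v
      using face_of_convex_hull_weight[OF F(1) V(1), of u v] u \<open>x \<in> F\<close> that by fastforce
    ultimately show ?thesis
      by blast
  qed
  obtain x0 where "x0 \<in> F"
    using F(2) by blast
  \<comment> \<open>Otherwise all weights of \<open>x0\<close> would be zero, although they sum to
    1.\<close>
  from comb[OF this] have "?W \<noteq> {}"
    by (metis disjoint_iff sum.neutral zero_neq_one)
  then have n: "0 < card ?W"
    using V(1) by (simp add: card_gt_0_iff)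
  define p where "p = (\<Sum>v\<in>?W. (1 / card ?W) *\<^sub>R v)"
  have "p \<in> convex hull ?W"
    using V(1) n unfolding p_def
    by (auto simp: convex_hull_finite intro!: exI[of _ "\<lambda>_. 1 / real (card ?W)"])
  then have pF: "p \<in> F"
    using face_of_imp_convex[OF F(1)] hull_minimal[of ?W F convex] by blast
  have ex: "\<exists>y. (\<forall>w\<in>V. ?P y w \<le> ?P y p) \<and> ?P y v < ?P y p" if v: "v \<in> V" "v \<notin> F" for v
  proof (rule ccontr)
    assume no: "\<nexists>y. (\<forall>w\<in>V. ?P y w \<le> ?P y p) \<and> ?P y v < ?P y p"
    have "\<exists>c. (\<forall>w\<in>V. 0 \<le> c w) \<and> (\<forall>y. ?P y (p - v) = (\<Sum>w\<in>V. c w * ?P y (w - p)))"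
    proof (rule farkas[OF V(1) linear_pairing_left linear_pairing_left])
      fix y :: "nat \<Rightarrow>\<^sub>0 real"
      assume "\<forall>w\<in>V. ?P y (w - p) \<le> 0"
      then have "\<forall>w\<in>V. ?P y w \<le> ?P y p"
        by (simp add: linear_diff[OF linear_pairing])
      with no show "?P y (p - v) \<le> 0"
        by (auto simp: linear_diff[OF linear_pairing] not_less)
    qed
    then obtain c where c: "\<forall>w\<in>V. 0 \<le> c w" "\<And>y. ?P y (p - v) = (\<Sum>w\<in>V. c w * ?P y (w - p))"
      by blast
    have keys: "coord x i = 0" if "x \<in> convex hull V" "i \<notin> I" for x i
    proof -
      obtain u where "x = (\<Sum>v\<in>V. u v *\<^sub>R v)"
        using V(1) \<open>x \<in> convex hull V\<close> by (auto simp: convex_hull_finite)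
      moreover have "coord v i = 0" if "v \<in> V" for v
        using supported_lookup[OF V(2) that \<open>i \<notin> I\<close>] .
      ultimately show ?thesis
        by (simp add: lookup_sum)
    qed
    \<comment> \<open>Coordinates are pairings with unit functionals, so the Farkas identity between
      functionals becomes an equality of vectors. Outside \<open>I\<close> both vectors
      vanish.\<close>
    have lookup: "coord x i = ?P (Poly_Mapping.single i 1) x" if "i \<in> I" for x i
      using I that by (simp add: pairing_def lookup_single when_def if_distrib[of "\<lambda>c. c * _"] cong: if_cong)
    have "p - v = (\<Sum>w\<in>V. c w *\<^sub>R (w - p))"
    proof (rule poly_mapping_eqI)
      fix i
      show "coord (p - v) i = coord (\<Sum>w\<in>V. c w *\<^sub>R (w - p)) i"
      proof (cases "i \<in> I")
        case True
        then show ?thesis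
          unfolding lookup[OF True] c(2) by (simp add: linear_sum[OF linear_pairing] linear_scale[OF linear_pairing])
      next
        case False
        have "coord p i = 0"
          using keys[OF _ False] pF F_hull by blast
        moreover have "coord w i = 0" if "w \<in> V" for w
          using keys[OF hull_inc[OF that] False] .
        ultimately show ?thesis
          using v by (simp add: lookup_minus lookup_sum)
      qed
    qed
    then have eq: "(1 + sum c V) *\<^sub>R p = v + (\<Sum>w\<in>V. c w *\<^sub>R w)"
      by (simp add: scaleR_diff_right sum_subtractf scaleR_left_distrib algebra_simps flip: scaleR_sum_left)
    define C where "C = 1 + sum c V"
    have C: "0 < C"
      using sum_nonneg[of V c] c(1) by (simp add: C_def)
    \<comment> \<open>Dividing the preceding identity by \<open>C\<close> gives a convex combination
      for \<open>p\<close>, with an extra weight \<open>1 / C\<close> at \<open>v\<close>.\<close>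
    define u where "u w = (c w + (if w = v then 1 else 0)) / C" for w
    have "sum u V = 1"
      using C V(1) v by (simp add: u_def sum.distrib C_def flip: sum_divide_distrib)
    moreover have "(\<Sum>w\<in>V. u w *\<^sub>R w) = p"
    proof -
      have "C *\<^sub>R (\<Sum>w\<in>V. u w *\<^sub>R w) = (\<Sum>w\<in>V. (c w + (if w = v then 1 else 0)) *\<^sub>R w)"
        using C by (simp add: scaleR_sum_right u_def)
      also have "\<dots> = C *\<^sub>R p"
        using V(1) v unfolding C_def eq
        by (simp add: scaleR_left_distrib sum.distrib if_distrib[of "\<lambda>c. c *\<^sub>R _"] cong: if_cong)
      finally show ?thesis
        using C by simp
    qed
    moreover have "\<And>w. w \<in> V \<Longrightarrow> 0 \<le> u w" "0 < u v"
      using C c(1) v by (auto simp: u_def add_nonneg_pos)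
    ultimately have "v \<in> F"
      using face_of_convex_hull_weight[OF F(1) V(1), of u v] pF v by simp
    with v show False
      by simp
  qed
  then obtain Y where Y: "\<And>v. v \<in> V \<Longrightarrow> v \<notin> F \<Longrightarrow> (\<forall>w\<in>V. ?P (Y v) w \<le> ?P (Y v) p) \<and> ?P (Y v) v < ?P (Y v) p"
    by metis
  \<comment> \<open>All summands are maximal over \<open>V\<close> at \<open>p\<close>, and each
    \<open>v\<close> outside \<open>F\<close> has its own summand that is strict at
    \<open>v\<close>.\<close>
  define y where "y = (\<Sum>v\<in>V - F. Y v)"
  have y: "?P y x = (\<Sum>v\<in>V - F. ?P (Y v) x)" for x
    unfolding y_def by (rule linear_sum[OF linear_pairing_left])
  have le: "?P y w \<le> ?P y p" if "w \<in> V" for w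
    unfolding y using Y that by (intro sum_mono) auto
  have less: "?P y w < ?P y p" if "w \<in> V" "w \<notin> F" for w
    unfolding y using Y that V(1) by (intro sum_strict_mono_ex1) auto
  \<comment> \<open>The value at \<open>p\<close> is the mean of the values on \<open>?W\<close>,
    none of which exceeds it, so all are equal to it.\<close>
  have eq: "?P y w = ?P y p" if "w \<in> ?W" for w
  proof -
    have "?P y p = (\<Sum>v\<in>?W. ?P y v / card ?W)"
      by (simp add: p_def linear_sum[OF linear_pairing] linear_scale[OF linear_pairing])
    then have "(\<Sum>v\<in>?W. ?P y p - ?P y v) = 0"
      using n by (simp add: sum_subtractf field_simps flip: sum_divide_distrib)
    then show ?thesis
      using V(1) le that by (subst (asm) sum_nonneg_eq_0_iff) auto
  qed
  have "amax I V (coord y) = ?W"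
    using le less eq \<open>?W \<noteq> {}\<close> by (fastforce simp: amax_def)
  then have "amax I (convex hull V) (coord y) = convex hull ?W"
    by (simp add: amax_convex_hull[OF V(1)])
  also have "\<dots> = F"
  proof
    show "convex hull ?W \<subseteq> F"
      using face_of_imp_convex[OF F(1)] by (intro hull_minimal) auto
    show "F \<subseteq> convex hull ?W"
    proof
      fix x
      assume "x \<in> F"
      then obtain u where u: "\<forall>v\<in>V. 0 \<le> u v" "sum u V = 1" "(\<Sum>v\<in>V. u v *\<^sub>R v) = x" "\<forall>v\<in>V. v \<notin> F \<longrightarrow> u v = 0"
        using comb by blast
      have "sum u ?W = sum u V" "(\<Sum>v\<in>?W. u v *\<^sub>R v) = (\<Sum>v\<in>V. u v *\<^sub>R v)"
        using V(1) u(4) by (auto intro!: sum.mono_neutral_left)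
      with u V(1) show "x \<in> convex hull ?W"
        by (auto simp: convex_hull_finite)
    qed
  qed
  finally show ?thesis
    by blast
qed

section \<open>The normal fan as a preorder on functionals\<close>

lemma normal_fan_convex_hull:
  assumes I: "finite I" and V: "finite V" "V \<noteq> {}" "supported I V"
  shows "normal_fan I (convex hull V) = range (\<lambda>y. {y' \<in> I \<rightarrow>\<^sub>E UNIV. amax_le I (convex hull V) y y'})"
proof -
  have cone: "normal_cone I (convex hull V) (amax I (convex hull V) y) =
      {y' \<in> I \<rightarrow>\<^sub>E UNIV. amax_le I (convex hull V) y y'}" for y
    by (auto simp: normal_cone_def amax_le_def amax_def)
  have "amax I (convex hull V) y \<noteq> {}" for y
    using V(1,2) by (rule amax_convex_hull_nonempty)
  then have "{F. F face_of convex hull V \<and> F \<noteq> {}} = range (amax I (convex hull V))"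
    using face_of_convex_hull_exposed[OF I V(1,3)] amax_face_of[OF convex_convex_hull] by blast
  then have "normal_fan I (convex hull V) = normal_cone I (convex hull V) ` range (amax I (convex hull V))"
    unfolding normal_fan_def by blast
  then show ?thesis
    by (simp add: image_image cone)
qed

text \<open>A preorder is recovered from its principal up-sets. The restrictions are needed since
  cones consist of extensional functions on \<open>I\<close>.\<close>

lemma amax_le_iff_normal_fan:
  assumes I: "finite I" and V: "finite V" "V \<noteq> {}" "supported I V"
  shows "amax_le I (convex hull V) y y' \<longleftrightarrow>
    (\<forall>C\<in>normal_fan I (convex hull V). restrict y I \<in> C \<longrightarrow> restrict y' I \<in> C)"
proof -
  have "amax I P (restrict z I) = amax I P z" for P z
    by (rule amax_cong) simp
  then have restr: "amax_le I P z (restrict z' I) \<longleftrightarrow> amax_le I P z z'" for P z z'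
    by (simp add: amax_le_def)
  show ?thesis
    unfolding normal_fan_convex_hull[OF assms]
    by (simp add: restr) (auto simp: amax_le_def)
qed

lemma normal_fan_eq_iff:
  assumes I: "finite I" and V: "finite V" "V \<noteq> {}" "supported I V"
    and W: "finite W" "W \<noteq> {}" "supported I W"
  shows "normal_fan I (convex hull V) = normal_fan I (convex hull W) \<longleftrightarrow>
    amax_le I (convex hull V) = amax_le I (convex hull W)"
proof
  assume "amax_le I (convex hull V) = amax_le I (convex hull W)"
  then show "normal_fan I (convex hull V) = normal_fan I (convex hull W)"
    by (simp add: normal_fan_convex_hull[OF I V] normal_fan_convex_hull[OF I W])
next
  assume "normal_fan I (convex hull V) = normal_fan I (convex hull W)"
  then show "amax_le I (convex hull V) = amax_le I (convex hull W)"
    by (intro ext) (simp only: amax_le_iff_normal_fan[OF I V] amax_le_iff_normal_fan[OF I W])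
qed

subsection \<open>Polytopes in coordinate subspaces and their products\<close>

definition polytope_in :: "nat set \<Rightarrow> polytope \<Rightarrow> bool" where
  "polytope_in I P \<longleftrightarrow> finite I \<and> (\<exists>V. finite V \<and> V \<noteq> {} \<and> supported I V \<and> P = convex hull V)"

lemma supported_convex_hull: "supported I V \<Longrightarrow> supported I (convex hull V)"
proof -
  assume V: "supported I V"
  have "supp (u *\<^sub>R p + v *\<^sub>R q) \<subseteq> supp p \<union> supp q" for u v and p q :: "nat \<Rightarrow>\<^sub>0 real"
    by (auto simp: in_keys_iff lookup_add)
  then have "convex {p :: nat \<Rightarrow>\<^sub>0 real. supp p \<subseteq> I}"
    unfolding convex_def by fast
  then have "convex hull V \<subseteq> {p. supp p \<subseteq> I}"
    using V by (intro hull_minimal) (auto simp: supported_def)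
  then show ?thesis
    by (auto simp: supported_def)
qed

lemma polytope_in_supported: "polytope_in I P \<Longrightarrow> supported I P"
  by (auto simp: polytope_in_def supported_convex_hull)

lemma polytope_in_finite: "polytope_in I P \<Longrightarrow> finite I"
  by (simp add: polytope_in_def)

lemma polytope_in_nonempty: "polytope_in I P \<Longrightarrow> P \<noteq> {}"
  by (auto simp: polytope_in_def)

lemma amax_nonempty: "polytope_in I P \<Longrightarrow> amax I P y \<noteq> {}"
  using amax_convex_hull_nonempty by (auto simp: polytope_in_def)

lemma normal_fan_eq_iff':
  assumes "polytope_in I P" "polytope_in I Q"
  shows "normal_fan I P = normal_fan I Q \<longleftrightarrow> amax_le I P = amax_le I Q"
  using assms normal_fan_eq_iff by (auto simp: polytope_in_def)

lemma poly_prod_eq_plus: "poly_prod P Q = P + Q"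
  by (auto simp: poly_prod_def set_plus_def)

lemma poly_prod_assoc: "poly_prod (poly_prod P Q) R = poly_prod P (poly_prod Q R)"
  by (simp add: poly_prod_eq_plus ac_simps)

lemma poly_prod_commute: "poly_prod P Q = poly_prod Q P"
  by (simp add: poly_prod_eq_plus add.commute)

lemma poly_prod_zero [simp]: "poly_prod {0} P = P" "poly_prod P {0} = P"
  by (auto simp: poly_prod_def)

lemma supported_poly_prod: "supported I P \<Longrightarrow> supported J Q \<Longrightarrow> supported (I \<union> J) (poly_prod P Q)"
  using keys_add unfolding supported_def poly_prod_def by fastforce

lemma supported_mono: "supported I P \<Longrightarrow> Q \<subseteq> P \<Longrightarrow> supported I Q"
  by (auto simp: supported_def)

lemma polytope_in_poly_prod:
  assumes "polytope_in I P" "polytope_in J Q"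
  shows "polytope_in (I \<union> J) (poly_prod P Q)"
proof -
  obtain V W where V: "finite V" "V \<noteq> {}" "supported I V" "P = convex hull V"
    and W: "finite W" "W \<noteq> {}" "supported J W" "Q = convex hull W"
    using assms by (auto simp: polytope_in_def)
  have "finite (V + W)" "V + W \<noteq> {}"
    using V W by (auto simp: finite_set_plus set_plus_def)
  moreover have "supported (I \<union> J) (V + W)"
    using supported_poly_prod V W by (simp add: poly_prod_eq_plus)
  moreover have "poly_prod P Q = convex hull (V + W)"
    by (simp add: V W poly_prod_eq_plus convex_hull_set_plus)
  ultimately show ?thesis
    using assms by (auto simp: polytope_in_def)
qed

lemma add_disjoint_support_eq:
  fixes p p' q q' :: "nat \<Rightarrow>\<^sub>0 real"
  assumes "I \<inter> J = {}" "supp p \<subseteq> I" "supp p' \<subseteq> I"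
    "supp q \<subseteq> J" "supp q' \<subseteq> J" "p + q = p' + q'"
  shows "p = p'" "q = q'"
proof -
  have "coord p i = coord p' i \<and> coord q i = coord q' i" for i
  proof -
    have "coord p i + coord q i = coord p' i + coord q' i"
      using assms(6) by (metis lookup_add)
    moreover have "i \<notin> I \<or> i \<notin> J"
      using assms(1) by blast
    moreover have "i \<notin> I \<Longrightarrow> coord p i = 0 \<and> coord p' i = 0"
      "i \<notin> J \<Longrightarrow> coord q i = 0 \<and> coord q' i = 0"
      using assms(2-5) by (metis in_keys_iff subsetD)+
    ultimately show ?thesis
      by auto
  qed
  then show "p = p'" "q = q'"
    by (auto intro: poly_mapping_eqI)
qed

lemma add_mem_poly_prod_iff:
  assumes "I \<inter> J = {}" "supported I A" "supported J B" "supp p \<subseteq> I" "supp q \<subseteq> J"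
  shows "p + q \<in> poly_prod A B \<longleftrightarrow> p \<in> A \<and> q \<in> B"
proof
  assume "p + q \<in> poly_prod A B"
  then obtain a b where ab: "a \<in> A" "b \<in> B" "p + q = a + b"
    by (auto simp: poly_prod_def)
  then have "p = a" "q = b"
    using add_disjoint_support_eq[OF assms(1,4) _ assms(5) _ ab(3)] assms(2,3)
    by (auto simp: supported_def)
  with ab show "p \<in> A \<and> q \<in> B"
    by simp
qed (auto simp: poly_prod_def)

text \<open>Disjoint supports allow the factors to be read off from the sum. An empty factor on the
  left would make the inclusion hold without any information on the other one.\<close>

lemma poly_prod_subset_iff:
  assumes "I \<inter> J = {}" "supported I A" "supported I A'" "supported J B" "supported J B'" "A \<noteq> {}" "B \<noteq> {}"
  shows "poly_prod A B \<subseteq> poly_prod A' B' \<longleftrightarrow> A \<subseteq> A' \<and> B \<subseteq> B'"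
proof
  assume le: "poly_prod A B \<subseteq> poly_prod A' B'"
  have "p \<in> A' \<and> q \<in> B'" if "p \<in> A" "q \<in> B" for p q
  proof -
    have "p + q \<in> poly_prod A' B'"
      by (rule subsetD[OF le]) (use that in \<open>auto simp: poly_prod_def\<close>)
    then show ?thesis
      using assms that by (subst (asm) add_mem_poly_prod_iff) (auto simp: supported_def)
  qed
  with assms(6,7) show "A \<subseteq> A' \<and> B \<subseteq> B'"
    by blast
qed (auto simp: poly_prod_def)

lemma pairing_union:
  assumes "finite I" "finite J" "I \<inter> J = {}" "supp p \<subseteq> I" "supp q \<subseteq> J"
  shows "pairing (I \<union> J) y (p + q) = pairing I y p + pairing J y q"
proof -
  have z: "coord q i = 0" if "i \<in> I" for i
    using assms(3,5) that by (metis disjoint_iff in_keys_iff subsetD)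
  have "coord p i = 0" if "i \<in> J" for i
    using assms(3,4) that by (metis disjoint_iff in_keys_iff subsetD)
  with z show ?thesis
    using assms(1-3) by (simp add: pairing_def sum.union_disjoint lookup_add)
qed

lemma amax_poly_prod:
  assumes "finite I" "finite J" "I \<inter> J = {}" "supported I P" "supported J Q"
  shows "amax (I \<union> J) (poly_prod P Q) y = poly_prod (amax I P y) (amax J Q y)"
proof -
  have e: "pairing (I \<union> J) y (p + q) = pairing I y p + pairing J y q" if "p \<in> P" "q \<in> Q" for p q
    using pairing_union assms that by (auto simp: supported_def)
  have "p + q \<in> amax (I \<union> J) (poly_prod P Q) y \<longleftrightarrow> p \<in> amax I P y \<and> q \<in> amax J Q y"
    if pq: "p \<in> P" "q \<in> Q" for p q
  proof
    assume "p + q \<in> amax (I \<union> J) (poly_prod P Q) y"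
    then have le: "pairing I y p' + pairing J y q' \<le> pairing I y p + pairing J y q" if "p' \<in> P" "q' \<in> Q" for p' q'
      using that pq e by (fastforce simp: amax_def poly_prod_def)
    show "p \<in> amax I P y \<and> q \<in> amax J Q y"
      using le[OF pq(1)] le[OF _ pq(2)] pq by (auto simp: amax_def)
  next
    assume "p \<in> amax I P y \<and> q \<in> amax J Q y"
    with pq show "p + q \<in> amax (I \<union> J) (poly_prod P Q) y"
      by (fastforce simp: amax_def poly_prod_def e intro: add_mono)
  qed
  moreover have "amax (I \<union> J) (poly_prod P Q) y \<subseteq> poly_prod P Q" "amax I P y \<subseteq> P" "amax J Q y \<subseteq> Q"
    by (auto simp: amax_def)
  ultimately show ?thesis
    unfolding poly_prod_def by blast
qed

text \<open>Functionals on a product are maximized in each factor separately, so the preorder is the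
  intersection of those of the factors, each seeing only its own labels.\<close>

lemma amax_le_poly_prod:
  assumes "polytope_in I P" "polytope_in J Q" "I \<inter> J = {}"
  shows "amax_le (I \<union> J) (poly_prod P Q) y y' \<longleftrightarrow> amax_le I P y y' \<and> amax_le J Q y y'"
proof -
  have "supported I (amax I P z)" "supported J (amax J Q z)" for z
    using assms polytope_in_supported by (auto intro: supported_mono simp: amax_def)
  then show ?thesis
    using assms unfolding amax_le_def
    by (simp add: amax_poly_prod polytope_in_finite polytope_in_supported poly_prod_subset_iff amax_nonempty)
qed

subsection \<open>Orbits\<close>

definition vals :: "nat set \<Rightarrow> (nat \<Rightarrow>\<^sub>0 real) \<Rightarrow> real multiset" where
  "vals I p = image_mset (coord p) (mset_set I)"

text \<open>By \<open>orbit_eq_permuted\<close> this is the permutation orbit of \<open>p\<close>.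
  In terms of the multiset of coordinates, vertices can be built by prescribing values instead of
  permutations.\<close>

definition orbit :: "nat set \<Rightarrow> (nat \<Rightarrow>\<^sub>0 real) \<Rightarrow> polytope" where
  "orbit I p = {v. supp v \<subseteq> I \<and> vals I v = vals I p}"

definition vec_on :: "nat set \<Rightarrow> (nat \<Rightarrow> real) \<Rightarrow> (nat \<Rightarrow>\<^sub>0 real)" where
  "vec_on I f = Abs_poly_mapping (\<lambda>i. if i \<in> I then f i else 0)"

lemma lookup_vec_on: "finite I \<Longrightarrow> coord (vec_on I f) i = (if i \<in> I then f i else 0)"
  unfolding vec_on_def by (subst lookup_Abs_poly_mapping) auto

lemma keys_vec_on: "finite I \<Longrightarrow> supp (vec_on I f) \<subseteq> I"
  by (auto simp: in_keys_iff lookup_vec_on split: if_splits)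

lemma vals_vec_on: "finite I \<Longrightarrow> vals I (vec_on I f) = image_mset f (mset_set I)"
  unfolding vals_def by (rule image_mset_cong) (simp add: lookup_vec_on)

lemma size_vals [simp]: "size (vals I p) = card I"
  by (simp add: vals_def)

lemma ex_image_mset_set: "finite A \<Longrightarrow> size X = card A \<Longrightarrow> \<exists>f. image_mset f (mset_set A) = X"
proof (induction A arbitrary: X rule: finite_induct)
  case (insert a A)
  then have "size X = Suc (card A)"
    by simp
  then obtain x Y where X: "X = add_mset x Y" "size Y = card A"
    by (metis size_eq_Suc_imp_eq_union size_add_mset nat.inject)
  then obtain f where f: "image_mset f (mset_set A) = Y"
    using insert.IH by blast
  have "image_mset (f(a := x)) (mset_set A) = image_mset f (mset_set A)"
    using insert.hyps by (intro image_mset_cong) auto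
  with f X insert.hyps have "image_mset (f(a := x)) (mset_set (insert a A)) = X"
    by simp
  then show ?case
    by blast
qed simp

lemma ex_vals: "finite I \<Longrightarrow> size X = card I \<Longrightarrow> \<exists>p. supp p \<subseteq> I \<and> vals I p = X"
  using ex_image_mset_set[of I X] keys_vec_on vals_vec_on by metis

lemma vals_eq_imp_permutes:
  assumes "finite I" "vals I v = vals I p"
  obtains \<sigma> where "\<sigma> permutes I" "\<forall>i\<in>I. coord v i = coord p (\<sigma> i)"
  using image_mset_eq_implies_permutes[OF assms(1), of "coord v" "coord p"] assms(2)
  by (auto simp: vals_def)

lemma image_mset_permutes:
  assumes "\<sigma> permutes I" "finite I"
  shows "image_mset (\<lambda>i. f (\<sigma> i)) (mset_set I) = image_mset f (mset_set I)"
proof -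
  have "image_mset (\<lambda>i. f (\<sigma> i)) (mset_set I) = image_mset f (image_mset \<sigma> (mset_set I))"
    by (simp add: multiset.map_comp o_def)
  also have "image_mset \<sigma> (mset_set I) = mset_set I"
    using assms by (simp add: image_mset_mset_set permutes_inj_on permutes_image)
  finally show ?thesis .
qed

lemma orbit_eq_permuted:
  assumes "finite I" "supp p \<subseteq> I"
  shows "orbit I p = {Poly_Mapping.map_key (inv \<sigma>) p | \<sigma>. \<sigma> permutes I}"
proof (intro equalityI subsetI)
  fix v
  assume "v \<in> orbit I p"
  then have v: "supp v \<subseteq> I" "vals I v = vals I p"
    by (auto simp: orbit_def)
  obtain \<sigma> where \<sigma>: "\<sigma> permutes I" "\<forall>i\<in>I. coord v i = coord p (\<sigma> i)"
    using vals_eq_imp_permutes[OF assms(1) v(2)] .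
  have "coord v i = coord p (\<sigma> i)" for i
    using \<sigma> v(1) assms(2) by (cases "i \<in> I") (metis in_keys_iff permutes_not_in subsetD)+
  then have "v = Poly_Mapping.map_key (inv (inv \<sigma>)) p"
    using \<sigma>(1) by (intro poly_mapping_eqI) (simp add: Poly_Mapping.map_key.rep_eq permutes_inj permutes_inv_inv)
  then show "v \<in> {Poly_Mapping.map_key (inv \<sigma>) p | \<sigma>. \<sigma> permutes I}"
    using permutes_inv[OF \<sigma>(1)] by blast
next
  fix v
  assume "v \<in> {Poly_Mapping.map_key (inv \<sigma>) p | \<sigma>. \<sigma> permutes I}"
  then obtain \<sigma> where \<sigma>: "\<sigma> permutes I" "v = Poly_Mapping.map_key (inv \<sigma>) p"
    by blast
  have inv: "inv \<sigma> permutes I"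
    using \<sigma>(1) by (rule permutes_inv)
  have v: "coord v i = coord p (inv \<sigma> i)" for i
    using inv by (simp add: \<sigma>(2) Poly_Mapping.map_key.rep_eq permutes_inj)
  have "vals I v = vals I p"
    using image_mset_permutes[OF inv assms(1), of "coord p"]
    by (simp only: vals_def v[THEN ext])
  moreover have "supp v \<subseteq> I"
    using assms(2) permutes_in_image[OF inv] by (auto simp: in_keys_iff v)
  ultimately show "v \<in> orbit I p"
    by (simp add: orbit_def)
qed

lemma orbit_polytope_eq:
  "finite I \<Longrightarrow> supp p \<subseteq> I \<Longrightarrow> orbit_polytope I p = convex hull (orbit I p)"
  by (simp add: orbit_polytope_def orbit_eq_permuted)

lemma finite_orbit: "finite I \<Longrightarrow> supp p \<subseteq> I \<Longrightarrow> finite (orbit I p)"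
  using finite_permutations[of I] by (simp add: orbit_eq_permuted setcompr_eq_image)

lemma supported_orbit: "supported I (orbit I p)"
  by (auto simp: supported_def orbit_def)

lemma orbit_polytope_in:
  assumes "finite I" "supp p \<subseteq> I"
  shows "polytope_in I (orbit_polytope I p)"
proof -
  have "p \<in> orbit I p"
    using assms(2) by (simp add: orbit_def)
  then show ?thesis
    using assms finite_orbit[OF assms] supported_orbit[of I p] orbit_polytope_eq[OF assms]
    unfolding polytope_in_def by blast
qed

lemma orbit_product_polytope_in: "orbit_product I P \<Longrightarrow> polytope_in I P"
  by (induction rule: orbit_product.induct) (auto intro: orbit_polytope_in polytope_in_poly_prod)

text \<open>Ties of \<open>y\<close> impose no condition: a constant \<open>y\<close> allows every
  arrangement, an injective one forces a single arrangement of given values.\<close>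

definition sorted_along :: "nat set \<Rightarrow> (nat \<Rightarrow> real) \<Rightarrow> (nat \<Rightarrow> real) \<Rightarrow> bool" where
  "sorted_along I y f \<longleftrightarrow> (\<forall>i\<in>I. \<forall>j\<in>I. y i < y j \<longrightarrow> f i \<le> f j)"

text \<open>Induction on the number of labels: a label \<open>i\<close> is chosen at which both
  \<open>y\<close> and \<open>f\<close> are maximal, \<sigma> is corrected so as to fix
  \<open>i\<close> without lowering the sum, and \<open>i\<close> is removed.\<close>

lemma rearrangement:
  fixes y f :: "nat \<Rightarrow> real"
  assumes "finite I" "\<sigma> permutes I" "sorted_along I y f"
  shows "(\<Sum>i\<in>I. y i * f (\<sigma> i)) \<le> (\<Sum>i\<in>I. y i * f i)"
  using assms
proof (induction "card I" arbitrary: I \<sigma>)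
  case (Suc n)
  \<comment> \<open>Sortedness says nothing within ties of \<open>y\<close>, so among the labels
    with maximal \<open>y\<close> one with maximal \<open>f\<close> is taken; then
    \<open>f i\<close> is maximal on all of \<open>I\<close>.\<close>
  define J where "J = {j \<in> I. y j = Max (y ` I)}"
  have "Max (y ` I) \<in> y ` I"
    using Suc by (intro Max_in) auto
  then have "J \<noteq> {}" "finite J"
    using Suc by (auto simp: J_def)
  then have "Max (f ` J) \<in> f ` J"
    by (intro Max_in) auto
  then obtain i where i: "i \<in> J" "f i = Max (f ` J)"
    by auto
  have iI: "i \<in> I"
    using i by (simp add: J_def)
  have y: "y j \<le> y i" if "j \<in> I" for j
    using i that Suc.prems(1) by (simp add: J_def)
  have f: "f j \<le> f i" if "j \<in> I" for j
  proof (cases "j \<in> J")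
    case True
    then show ?thesis
      using i \<open>finite J\<close> by simp
  next
    case False
    with that i y[OF that] have "y j < y i"
      by (simp add: J_def)
    with Suc.prems(3) that iI show ?thesis
      by (simp add: sorted_along_def)
  qed
  define j where "j = inv \<sigma> i"
  have j: "\<sigma> j = i" "j \<in> I"
    using Suc.prems(2) iI by (auto simp: j_def permutes_inverses permutes_in_image[OF permutes_inv])
  \<comment> \<open>This fixes \<open>i\<close> and hands the former value \<sigma> \<open>i\<close>
    over to \<open>j\<close>. The sum gains
    \<open>(y i - y j) * (f i - f (\<sigma> i))\<close>.\<close>
  define \<tau> where "\<tau> = \<sigma> \<circ> Transposition.transpose i j"
  have \<tau>: "\<tau> i = i" "\<tau> j = \<sigma> i" "\<And>k. k \<noteq> i \<Longrightarrow> k \<noteq> j \<Longrightarrow> \<tau> k = \<sigma> k"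
    using j by (auto simp: \<tau>_def)
  have "\<tau> permutes I"
    unfolding \<tau>_def using Suc.prems(2) iI j by (intro permutes_compose permutes_swap_id)
  then have \<tau>_perm: "\<tau> permutes (I - {i})"
    by (rule permutes_superset) (use \<tau>(1) in auto)
  have "(\<Sum>k\<in>I. y k * f (\<sigma> k)) \<le> (\<Sum>k\<in>I. y k * f (\<tau> k))"
  proof (cases "i = j")
    case True
    then have "\<tau> = \<sigma>"
      by (auto simp: \<tau>_def)
    then show ?thesis
      by simp
  next
    case False
    have "(\<Sum>k\<in>I - {i} - {j}. y k * f (\<sigma> k)) = (\<Sum>k\<in>I - {i} - {j}. y k * f (\<tau> k))"
      by (rule sum.cong) (auto simp: \<tau>)
    moreover have "(\<Sum>k\<in>I. g k) = g i + (g j + (\<Sum>k\<in>I - {i} - {j}. g k))" for g :: "nat \<Rightarrow> real"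
      using Suc.prems(1) iI j False by (simp add: sum.remove[of I i] sum.remove[of "I - {i}" j])
    moreover have "\<sigma> i \<in> I"
      using Suc.prems(2) iI by (simp add: permutes_in_image)
    then have "0 \<le> (y i - y j) * (f i - f (\<sigma> i))"
      using y j f by simp
    then have "y i * f (\<sigma> i) + y j * f (\<sigma> j) \<le> y i * f (\<tau> i) + y j * f (\<tau> j)"
      by (simp add: \<tau> j algebra_simps)
    ultimately show ?thesis
      by simp
  qed
  also have "\<dots> = y i * f i + (\<Sum>k\<in>I - {i}. y k * f (\<tau> k))"
    using Suc.prems(1) iI \<tau> by (simp add: sum.remove[of I i])
  also have "(\<Sum>k\<in>I - {i}. y k * f (\<tau> k)) \<le> (\<Sum>k\<in>I - {i}. y k * f k)"
    using Suc iI \<tau>_perm by (intro Suc.hyps(1)) (auto simp: sorted_along_def)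
  also have "y i * f i + (\<Sum>k\<in>I - {i}. y k * f k) = (\<Sum>k\<in>I. y k * f k)"
    using Suc.prems(1) iI by (simp add: sum.remove[of I i])
  finally show ?case
    by simp
qed simp

text \<open>Sorted vertices are maximal by the rearrangement inequality. Conversely, exchanging the
  entries of a badly ordered pair would strictly increase the pairing.\<close>

lemma amax_orbit:
  assumes "finite I"
  shows "amax I (orbit I p) y = {v \<in> orbit I p. sorted_along I y (coord v)}"
proof (intro equalityI subsetI)
  fix v
  assume v: "v \<in> {v \<in> orbit I p. sorted_along I y (coord v)}"
  have "pairing I y w \<le> pairing I y v" if "w \<in> orbit I p" for w
  proof -
    have "vals I w = vals I v"
      using v that by (simp add: orbit_def)
    then obtain \<sigma> where "\<sigma> permutes I" "\<forall>i\<in>I. coord w i = coord v (\<sigma> i)"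
      using vals_eq_imp_permutes[OF assms] by blast
    then show ?thesis
      using rearrangement[OF assms, of \<sigma> y "coord v"] v by (simp add: pairing_def)
  qed
  with v show "v \<in> amax I (orbit I p) y"
    by (simp add: amax_def)
next
  fix v
  assume v: "v \<in> amax I (orbit I p) y"
  have "coord v i \<le> coord v j" if ij: "i \<in> I" "j \<in> I" "y i < y j" for i j
  proof (rule ccontr)
    assume less: "\<not> coord v i \<le> coord v j"
    have "i \<noteq> j"
      using ij by auto
    let ?f = "\<lambda>k. coord v (Transposition.transpose i j k)"
    let ?w = "vec_on I ?f"
    have "vals I ?w = vals I v"
      using image_mset_permutes[OF permutes_swap_id[OF ij(1,2)] assms, of "coord v"]
      by (simp add: vals_vec_on[OF assms]) (simp add: vals_def)
    with v have "?w \<in> orbit I p"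
      by (simp add: orbit_def amax_def keys_vec_on[OF assms])
    with v have le: "pairing I y ?w \<le> pairing I y v"
      by (simp add: amax_def)
    have s: "(\<Sum>k\<in>I. g k) = g i + (g j + (\<Sum>k\<in>I - {i} - {j}. g k))" for g :: "nat \<Rightarrow> real"
      using assms ij \<open>i \<noteq> j\<close> by (simp add: sum.remove[of I i] sum.remove[of "I - {i}" j])
    have "pairing I y ?w = (\<Sum>k\<in>I. y k * ?f k)"
      by (simp add: pairing_def lookup_vec_on[OF assms])
    also have "\<dots> = y i * coord v j + (y j * coord v i +
        (\<Sum>k\<in>I - {i} - {j}. y k * coord v k))"
      by (subst s) (auto intro!: sum.cong)
    finally have "y i * coord v j + y j * coord v i \<le>
        y i * coord v i + y j * coord v j"
      using le by (simp add: pairing_def s)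
    then have "(y j - y i) * (coord v i - coord v j) \<le> 0"
      by (simp add: algebra_simps)
    moreover have "0 < (y j - y i) * (coord v i - coord v j)"
      using ij less by simp
    ultimately show False
      by simp
  qed
  with v show "v \<in> {v \<in> orbit I p. sorted_along I y (coord v)}"
    by (auto simp: sorted_along_def amax_def)
qed

lemma amax_le_orbit_polytope:
  assumes "finite I" "supp p \<subseteq> I"
  shows "amax_le I (orbit_polytope I p) y y' \<longleftrightarrow>
    (\<forall>v\<in>orbit I p. sorted_along I y (coord v) \<longrightarrow> sorted_along I y' (coord v))"
  by (auto simp: orbit_polytope_eq[OF assms] amax_le_convex_hull[OF finite_orbit[OF assms]] amax_orbit[OF assms(1)])

lemma vals_mem: "finite I \<Longrightarrow> i \<in> I \<Longrightarrow> coord p i \<in># vals I p"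
  by (simp add: vals_def)

text \<open>Equal types give a strictly monotone renaming of values, which matches the vertices of
  the two orbits and preserves sortedness in both directions.\<close>

lemma amax_le_orbit_mono:
  assumes I: "finite I" and p: "supp p \<subseteq> I" and q: "supp q \<subseteq> I"
    and type: "mtype (vals I p) = mtype (vals I q)" and le: "amax_le I (orbit_polytope I p) y y'"
  shows "amax_le I (orbit_polytope I q) y y'"
  unfolding amax_le_orbit_polytope[OF I q]
proof (intro ballI impI)
  fix v
  assume v: "v \<in> orbit I q" "sorted_along I y (coord v)"
  obtain h where h: "strict_mono_on (set_mset (vals I q)) h" "vals I p = image_mset h (vals I q)"
    using mtype_eq_imp_strict_mono_image[OF type] by blast
  have vq: "vals I v = vals I q"
    using v by (simp add: orbit_def)
  have mem: "coord v i \<in># vals I q" if "i \<in> I" for i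
    using vals_mem[OF I that, of v] vq by simp
  have h_le: "h (coord v i) \<le> h (coord v j) \<longleftrightarrow>
      coord v i \<le> coord v j" if "i \<in> I" "j \<in> I" for i j
    using strict_mono_onD[OF h(1) mem[OF that(1)] mem[OF that(2)]]
      strict_mono_onD[OF h(1) mem[OF that(2)] mem[OF that(1)]]
    by (metis linorder_not_less order.order_iff_strict)
  define w where "w = vec_on I (\<lambda>i. h (coord v i))"
  have w: "coord w i = h (coord v i)" if "i \<in> I" for i
    using I that by (simp add: w_def lookup_vec_on)
  have "vals I w = image_mset h (vals I v)"
    by (simp add: w_def vals_vec_on[OF I]) (simp add: vals_def multiset.map_comp o_def)
  then have "w \<in> orbit I p"
    using h(2) vq keys_vec_on[OF I] by (simp add: orbit_def w_def)
  moreover have "sorted_along I y (coord w)"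
    using v(2) by (simp add: sorted_along_def w h_le)
  ultimately have "sorted_along I y' (coord w)"
    using le unfolding amax_le_orbit_polytope[OF I p] by blast
  then show "sorted_along I y' (coord v)"
    by (simp add: sorted_along_def w h_le)
qed

lemma amax_le_orbit_cong:
  assumes "finite I" "supp p \<subseteq> I" "supp q \<subseteq> I" "mtype (vals I p) = mtype (vals I q)"
  shows "amax_le I (orbit_polytope I p) = amax_le I (orbit_polytope I q)"
  using amax_le_orbit_mono[OF assms] amax_le_orbit_mono[OF assms(1,3,2) assms(4)[symmetric]]
  by (intro ext) blast

text \<open>
  The generic direction given by an enumeration of \<open>I\<close> has a unique maximal vertex, whose coordinates
  along the enumeration are \<open>desc (vals I p)\<close>.
\<close>

lemma amax_le_orbit_swap:
  assumes I: "finite I" and p: "supp p \<subseteq> I" and g: "bij_betw g I {..<card I}"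
    and k: "Suc k < card I"
  shows "amax_le I (orbit_polytope I p) (\<lambda>i. - real (g i)) (\<lambda>i. - real (Transposition.transpose k (Suc k) (g i)))
    \<longleftrightarrow> desc (vals I p) ! k = desc (vals I p) ! Suc k"
proof -
  let ?xs = "desc (vals I p)" and ?t = "Transposition.transpose k (Suc k)"
  have len: "length ?xs = card I"
    by simp
  have dec: "?xs ! b \<le> ?xs ! a" if "a \<le> b" "b < card I" for a b
    using decreasing_desc[of "vals I p"] that by (cases "a = b") (auto simp: sorted_wrt_iff_nth_less)
  have gI: "g i < card I" if "i \<in> I" for i
    using g that by (auto simp: bij_betw_def)
  have mset_g: "image_mset g (mset_set I) = mset_set {..<card I}"
    using g by (simp add: bij_betw_def image_mset_mset_set)
  have nth: "image_mset ((!) xs) (mset_set {..<length xs}) = mset xs" for xs :: "real list"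
    by (metis map_nth mset_map mset_upt atLeast0LessThan)
  \<comment> \<open>The minus sign in the direction gives the largest coordinate to the label with
    \<open>g i = 0\<close>, so this vertex lists \<open>?xs\<close> along the enumeration.\<close>
  define v where "v = vec_on I (\<lambda>i. ?xs ! g i)"
  have v: "coord v i = ?xs ! g i" if "i \<in> I" for i
    using I that by (simp add: v_def lookup_vec_on)
  have "vals I v = image_mset ((!) ?xs) (image_mset g (mset_set I))"
    by (simp add: v_def vals_vec_on[OF I] multiset.map_comp o_def)
  also have "\<dots> = vals I p"
    using nth[of ?xs] by (simp add: mset_g)
  finally have v_orbit: "v \<in> orbit I p"
    using keys_vec_on[OF I] by (simp add: orbit_def v_def)
  have v_sorted: "sorted_along I (\<lambda>i. - real (g i)) (coord v)"
    by (simp add: sorted_along_def v dec gI)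
  have uniq: "coord u i = ?xs ! g i"
    if u: "u \<in> orbit I p" "sorted_along I (\<lambda>i. - real (g i)) (coord u)" and i: "i \<in> I" for u i
  proof -
    let ?e = "inv_into I g"
    have e: "?e a \<in> I" "g (?e a) = a" if "a < card I" for a
      using g that by (auto simp: bij_betw_def f_inv_into_f intro!: inv_into_into)
    define us where "us = map (\<lambda>a. coord u (?e a)) [0..<card I]"
    have dec_us: "decreasing us"
      unfolding sorted_wrt_iff_nth_less
    proof (intro allI impI)
      fix a b
      assume "a < b" "b < length us"
      then show "us ! b \<le> us ! a"
        using u(2) e[of a] e[of b] by (auto simp: us_def sorted_along_def)
    qed
    have "mset us = image_mset (\<lambda>a. coord u (?e a)) (image_mset g (mset_set I))"
      by (simp add: us_def mset_g atLeast0LessThan)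
    moreover have "image_mset (\<lambda>i. coord u (?e (g i))) (mset_set I) = vals I u"
      unfolding vals_def using g I by (intro image_mset_cong) (simp add: bij_betw_def)
    ultimately have "mset us = vals I u"
      by (simp add: multiset.map_comp o_def)
    then have "mset us = vals I p"
      using u by (simp add: orbit_def)
    with dec_us have "?xs = us"
      by (rule desc_eqI)
    then have "?xs ! g i = coord u (?e (g i))"
      using gI[OF i] by (simp add: us_def)
    then show ?thesis
      using g i by (simp add: bij_betw_def)
  qed
  have "sorted_along I z (coord u) \<longleftrightarrow> sorted_along I z (\<lambda>i. ?xs ! g i)"
    if "u \<in> orbit I p" "sorted_along I (\<lambda>i. - real (g i)) (coord u)" for u z
    unfolding sorted_along_def by (simp add: uniq[OF that])
  then have "amax_le I (orbit_polytope I p) (\<lambda>i. - real (g i)) (\<lambda>i. - real (?t (g i))) \<longleftrightarrow>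
      sorted_along I (\<lambda>i. - real (?t (g i))) (\<lambda>i. ?xs ! g i)"
    unfolding amax_le_orbit_polytope[OF I p] using v_orbit v_sorted by blast
  also have "\<dots> \<longleftrightarrow> ?xs ! k = ?xs ! Suc k"
  proof
    assume s: "sorted_along I (\<lambda>i. - real (?t (g i))) (\<lambda>i. ?xs ! g i)"
    obtain i j where "i \<in> I" "g i = k" "j \<in> I" "g j = Suc k"
      using g k by (metis Suc_lessD bij_betw_imp_surj_on imageE lessThan_iff)
    with s have "?xs ! k \<le> ?xs ! Suc k"
      unfolding sorted_along_def by force
    with dec[of k "Suc k"] k show "?xs ! k = ?xs ! Suc k"
      by simp
  next
    assume eq: "?xs ! k = ?xs ! Suc k"
    show "sorted_along I (\<lambda>i. - real (?t (g i))) (\<lambda>i. ?xs ! g i)"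
      unfolding sorted_along_def
    proof (intro ballI impI)
      fix i j
      assume ij: "i \<in> I" "j \<in> I" "- real (?t (g i)) < - real (?t (g j))"
      \<comment> \<open>The exchange reverses only the comparison of the positions \<open>k\<close>
        and \<open>Suc k\<close>; all other comparisons are settled by \<open>?xs\<close> being
        decreasing.\<close>
      then have "g j \<le> g i \<or> g i = k \<and> g j = Suc k"
        by (auto simp: Transposition.transpose_def split: if_splits)
      then show "?xs ! g i \<le> ?xs ! g j"
        using dec[of "g j" "g i"] gI[OF ij(1)] eq by auto
    qed
  qed
  finally show ?thesis .
qed

lemma amax_le_orbit_imp_mtype_eq:
  assumes I: "finite I" and p: "supp p \<subseteq> I" and q: "supp q \<subseteq> I"
    and le: "amax_le I (orbit_polytope I p) = amax_le I (orbit_polytope I q)"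
  shows "mtype (vals I p) = mtype (vals I q)"
proof -
  obtain g where g: "bij_betw g I {..<card I}"
    using ex_bij_betw_finite_nat[OF I] by (auto simp: atLeast0LessThan)
  show ?thesis
    unfolding mtype_def
    using amax_le_orbit_swap[OF I p g] amax_le_orbit_swap[OF I q g] le
    by (intro runs_eqI) auto
qed

text \<open>The zero functional is maximal everywhere, so \<open>y\<close> has to be constant on the
  orbit polytope. This is where generators differ from points: a generator of degree at least two
  has two distinct coordinates, which rule out any inequality between values of
  \<open>y\<close>.\<close>

lemma amax_le_zero_orbit_polytope:
  assumes I: "finite I" and p: "supp p \<subseteq> I" and type: "mtype (vals I p) = gen_composition a"
  shows "amax_le I (orbit_polytope I p) (\<lambda>_. 0) y \<longleftrightarrow> (\<forall>i\<in>I. \<forall>j\<in>I. y i = y j)"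
proof
  assume le: "amax_le I (orbit_polytope I p) (\<lambda>_. 0) y"
  have "\<not> y i < y j" if ij: "i \<in> I" "j \<in> I" for i j
  proof
    assume less: "y i < y j"
    then have "i \<noteq> j"
      by auto
    have "card {i, j} \<le> card I"
      using I ij by (intro card_mono) auto
    then have "2 \<le> card I"
      using \<open>i \<noteq> j\<close> by simp
    then have "gen_composition a \<noteq> [1]"
      using sum_mtype[of "vals I p"] type by auto
    then have "1 < length (mtype (vals I p))"
      using gen_composition[of a] type by auto
    then have ne: "desc (vals I p) \<noteq> []"
      by (auto simp: mtype_def)
    have not_const: "\<not> set (desc (vals I p)) \<subseteq> {x}" for x
      using runs_const[OF ne, of x] \<open>1 < length (mtype (vals I p))\<close> by (auto simp: mtype_def simp del: set_desc)
    obtain x where x: "x \<in># vals I p"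
      using ne by (metis list.set_intros(1) neq_Nil_conv set_desc)
    obtain x' where "x' \<in># vals I p" "x' \<noteq> x"
      using not_const[of x] by auto
    with x obtain s t where st: "s \<in># vals I p" "t \<in># vals I p" "t < s"
      by (metis linorder_neqE)
    then obtain R where R: "vals I p = add_mset s (add_mset t R)"
      by (metis insert_noteq_member multi_member_split order_less_irrefl)
    have "card I = Suc (Suc (size R))"
      using size_vals[of I p] R by simp
    then have "size R = card (I - {i, j})"
      using I ij \<open>i \<noteq> j\<close> by (simp add: card_Diff_subset)
    then obtain f where f: "image_mset f (mset_set (I - {i, j})) = R"
      using ex_image_mset_set[of "I - {i, j}" R] I by blast
    \<comment> \<open>A vertex with the larger value at \<open>i\<close> and the smaller one at
      \<open>j\<close>; it is not sorted along \<open>y\<close>.\<close>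
    let ?f = "f(i := s, j := t)"
    have "I = insert i (insert j (I - {i, j}))"
      using ij by auto
    then have "mset_set I = add_mset i (add_mset j (mset_set (I - {i, j})))"
      using I \<open>i \<noteq> j\<close> by (metis finite_Diff finite_insert insert_iff mset_set.insert Diff_iff)
    moreover have "image_mset ?f (mset_set (I - {i, j})) = R"
      unfolding f[symmetric] using I by (intro image_mset_cong) auto
    ultimately have "image_mset ?f (mset_set I) = vals I p"
      using R \<open>i \<noteq> j\<close> by simp
    then have "vec_on I ?f \<in> orbit I p"
      using I by (simp add: orbit_def keys_vec_on vals_vec_on)
    moreover have "sorted_along I (\<lambda>_. 0) (coord (vec_on I ?f))"
      by (simp add: sorted_along_def)
    ultimately have "sorted_along I y (coord (vec_on I ?f))"
      using le unfolding amax_le_orbit_polytope[OF I p] by blast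
    with less ij have "coord (vec_on I ?f) i \<le> coord (vec_on I ?f) j"
      unfolding sorted_along_def by blast
    with I ij \<open>i \<noteq> j\<close> st show False
      by (simp add: lookup_vec_on)
  qed
  then show "\<forall>i\<in>I. \<forall>j\<in>I. y i = y j"
    by (meson linorder_neqE)
next
  assume "\<forall>i\<in>I. \<forall>j\<in>I. y i = y j"
  then show "amax_le I (orbit_polytope I p) (\<lambda>_. 0) y"
    unfolding amax_le_orbit_polytope[OF I p] sorted_along_def by (metis less_irrefl)
qed

subsection \<open>The monomial of a product of orbit polytopes\<close>

text \<open>
  The blocks are split until none is a point of dimension at least two, so that every block
  carries a generator.
\<close>

inductive orbit_monomial :: "nat set \<Rightarrow> polytope \<Rightarrow> monomial \<Rightarrow> bool" where
  empty: "orbit_monomial {} {0} {#}"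
| add: "finite B \<Longrightarrow> supp p \<subseteq> B \<Longrightarrow> mtype (vals B p) = gen_composition a \<Longrightarrow> B \<inter> I = {} \<Longrightarrow>
    orbit_monomial I P M \<Longrightarrow> orbit_monomial (B \<union> I) (poly_prod (orbit_polytope B p) P) (add_mset a M)"

lemma orbit_monomial_union:
  assumes "orbit_monomial I P M" "orbit_monomial J Q N" "I \<inter> J = {}"
  shows "orbit_monomial (I \<union> J) (poly_prod P Q) (M + N)"
  using assms
proof (induction rule: orbit_monomial.induct)
  case (add B p a I P M)
  then have "orbit_monomial (B \<union> (I \<union> J)) (poly_prod (orbit_polytope B p) (poly_prod P Q)) (add_mset a (M + N))"
    by (intro orbit_monomial.add) auto
  then show ?case
    by (simp add: Un_assoc poly_prod_assoc)
qed simp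

lemma orbit_polytope_const:
  assumes I: "finite I" and p: "supp p \<subseteq> I" and c: "\<And>i. i \<in> I \<Longrightarrow> coord p i = c"
  shows "orbit_polytope I p = {p}"
proof -
  have "v = p" if "v \<in> orbit I p" for v
  proof (rule poly_mapping_eqI)
    fix i
    from that have v: "vals I v = vals I p" "supp v \<subseteq> I"
      by (auto simp: orbit_def)
    show "coord v i = coord p i"
    proof (cases "i \<in> I")
      case True
      then have "coord v i \<in># vals I p"
        using v vals_mem[OF I True, of v] by simp
      with I c True show ?thesis
        by (auto simp: vals_def)
    next
      case False
      with v p show ?thesis
        by (metis in_keys_iff subsetD)
    qed
  qed
  moreover have "p \<in> orbit I p"
    using p by (simp add: orbit_def)
  ultimately have "orbit I p = {p}"
    by blast
  then show ?thesis
    by (simp add: orbit_polytope_eq[OF I p])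
qed

lemma mtype_singleton: "mtype {#x#} = [1]"
  using mtype_mset[of "[x]"] by simp

text \<open>The geometric counterpart of \<open>(n)\<close> being the power \<open>(1)^n\<close>: a
  point with constant coordinates is a product of points on single labels.\<close>

lemma orbit_monomial_point:
  assumes "finite I" "supp p \<subseteq> I" "\<And>i. i \<in> I \<Longrightarrow> coord p i = c"
  shows "orbit_monomial I {p} (replicate_mset (card I) (Gen [1]))"
  using assms
proof (induction I arbitrary: p rule: finite_induct)
  case empty
  then have "p = 0"
    by simp
  then show ?case
    using orbit_monomial.empty by simp
next
  case (insert b I)
  let ?q = "Poly_Mapping.single b c" and ?r = "vec_on I (\<lambda>_. c)"
  have "p = ?q + ?r"
  proof (rule poly_mapping_eqI)
    fix i
    show "coord p i = coord (?q + ?r) i"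
      using insert.prems insert.hyps
      by (cases "i \<in> insert b I") (auto simp: lookup_add lookup_vec_on lookup_single when_def in_keys_iff)
  qed
  then have "{p} = poly_prod {?q} {?r}"
    by (auto simp: poly_prod_def)
  moreover have "orbit_polytope {b} ?q = {?q}"
    by (rule orbit_polytope_const[of _ _ c]) auto
  moreover have "orbit_monomial I {?r} (replicate_mset (card I) (Gen [1]))"
    using insert.hyps by (intro insert.IH) (auto simp: lookup_vec_on dest: subsetD[OF keys_vec_on])
  moreover have "mtype (vals {b} ?q) = gen_composition (Gen [1])"
    by (simp add: vals_def mtype_singleton gen_composition_one)
  ultimately show ?case
    using orbit_monomial.add[of "{b}" ?q "Gen [1]" I "{?r}" "replicate_mset (card I) (Gen [1])"] insert.hyps
    by simp
qed

lemma orbit_monomial_orbit: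
  assumes I: "finite I" and p: "supp p \<subseteq> I"
  shows "orbit_monomial I (orbit_polytope I p) (comp_mon (mtype (vals I p)))"
proof -
  let ?\<alpha> = "mtype (vals I p)"
  have sum: "sum_list ?\<alpha> = card I"
    by (simp add: sum_mtype)
  consider "?\<alpha> = []" | n where "?\<alpha> = [n]" | "1 < length ?\<alpha>"
    by (cases ?\<alpha>; cases "tl ?\<alpha>") auto
  then show ?thesis
  proof cases
    case 1
    then have "I = {}"
      using sum I by simp
    with p have "p = 0"
      by simp
    have "orbit_polytope I p = {p}"
      by (rule orbit_polytope_const[OF I p, of 0]) (use \<open>I = {}\<close> in auto)
    with 1 \<open>p = 0\<close> \<open>I = {}\<close> show ?thesis
      using orbit_monomial.empty by (simp add: comp_mon_def)
  next
    case 2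
    then have n: "card I = n"
      using sum by simp
    have eq: "x = y" if "x \<in># vals I p" "y \<in># vals I p" for x y
      using length_runs[of "desc (vals I p)" x y] 2 that by (simp add: mtype_def)
    then obtain c where c: "\<And>i. i \<in> I \<Longrightarrow> coord p i = c"
      using vals_mem[OF I, of _ p] by metis
    have "orbit_polytope I p = {p}"
      by (rule orbit_polytope_const[OF I p c])
    then show ?thesis
      using orbit_monomial_point[OF I p c] 2 n by (simp add: comp_mon_def)
  next
    case 3
    then have "comp_mon ?\<alpha> = {#Gen ?\<alpha>#}"
      by (auto simp: comp_mon_def)
    moreover have "gen_composition (Gen ?\<alpha>) = ?\<alpha>"
      using 3 by (intro Gen_inverse_composition composition_mtype) simp
    ultimately show ?thesis
      using orbit_monomial.add[OF I p, of "Gen ?\<alpha>" "{}"] orbit_monomial.empty by fastforce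
  qed
qed

lemma orbit_product_zero: "orbit_product {} {0}"
  using orbit_product.orbit[of "{}" 0] orbit_polytope_const[of "{}" 0 0] by simp

lemma orbit_monomial_imp_orbit_product: "orbit_monomial I P M \<Longrightarrow> orbit_product I P"
  by (induction rule: orbit_monomial.induct) (auto intro: orbit_product.intros orbit_product_zero)

lemma orbit_product_imp_orbit_monomial: "orbit_product I P \<Longrightarrow> \<exists>M. orbit_monomial I P M"
proof (induction rule: orbit_product.induct)
  case (orbit I p)
  then show ?case
    using orbit_monomial_orbit by blast
next
  case (product S P T Q)
  then show ?case
    using orbit_monomial_union by blast
qed

lemma orbit_monomial_polytope_in: "orbit_monomial I P M \<Longrightarrow> polytope_in I P"
  by (rule orbit_product_polytope_in[OF orbit_monomial_imp_orbit_product])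

lemma sum_gen_composition: "mtype (vals B p) = gen_composition a \<Longrightarrow> sum_list (gen_composition a) = card B"
  by (metis sum_mtype size_vals)

lemma block_nonempty: "mtype (vals B p) = gen_composition a \<Longrightarrow> B \<noteq> {}"
  using gen_composition[of a] by (auto simp: vals_def mtype_def desc_def)

lemma orbit_monomial_degree: "orbit_monomial I P M \<Longrightarrow> finite I \<and> card I = comp_degree M"
  by (induction rule: orbit_monomial.induct)
    (auto simp: comp_degree_def card_Un_disjoint sum_gen_composition)

text \<open>The inductive definition lists the blocks in some order. This brings the block through a
  given label to the front, and \<open>orbit_monomial_split_gen\<close> a block with a given
  generator.\<close>

lemma orbit_monomial_split_mem:
  assumes "orbit_monomial I P M" "b \<in> I"
  shows "\<exists>B p a I' P' M'. b \<in> B \<and> finite B \<and> supp p \<subseteq> B \<and> mtype (vals B p) = gen_composition a \<and>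
    B \<inter> I' = {} \<and> orbit_monomial I' P' M' \<and> I = B \<union> I' \<and> P = poly_prod (orbit_polytope B p) P' \<and>
    M = add_mset a M'"
  using assms
proof (induction rule: orbit_monomial.induct)
  case (add C q c I P M)
  show ?case
  proof (cases "b \<in> C")
    case True
    with add.hyps show ?thesis
      by blast
  next
    case False
    with add obtain B p a I' P' M' where B: "b \<in> B" "finite B" "supp p \<subseteq> B"
      "mtype (vals B p) = gen_composition a" "B \<inter> I' = {}" "orbit_monomial I' P' M'"
      "I = B \<union> I'" "P = poly_prod (orbit_polytope B p) P'" "M = add_mset a M'"
      by blast
    have "orbit_monomial (C \<union> I') (poly_prod (orbit_polytope C q) P') (add_mset c M')"
      using add.hyps B by (intro orbit_monomial.add) auto
    moreover have "poly_prod (orbit_polytope C q) P = poly_prod (orbit_polytope B p) (poly_prod (orbit_polytope C q) P')"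
      unfolding B(8) by (simp add: poly_prod_eq_plus ac_simps)
    moreover have "B \<inter> (C \<union> I') = {}" "C \<union> I = B \<union> (C \<union> I')" "add_mset c M = add_mset a (add_mset c M')"
      using add.hyps B by auto
    ultimately show ?thesis
      using B(1-4) by blast
  qed
qed simp

lemma orbit_monomial_split_gen:
  assumes "orbit_monomial I P M" "a \<in># M"
  shows "\<exists>B p I' P'. finite B \<and> supp p \<subseteq> B \<and> mtype (vals B p) = gen_composition a \<and>
    B \<inter> I' = {} \<and> orbit_monomial I' P' (M - {#a#}) \<and> I = B \<union> I' \<and> P = poly_prod (orbit_polytope B p) P'"
  using assms
proof (induction rule: orbit_monomial.induct)
  case (add C q c I P M)
  show ?case
  proof (cases "a = c")
    case True
    with add.hyps show ?thesis
      by auto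
  next
    case False
    with add obtain B p I' P' where B: "finite B" "supp p \<subseteq> B"
      "mtype (vals B p) = gen_composition a" "B \<inter> I' = {}" "orbit_monomial I' P' (M - {#a#})"
      "I = B \<union> I'" "P = poly_prod (orbit_polytope B p) P'"
      by auto
    have "orbit_monomial (C \<union> I') (poly_prod (orbit_polytope C q) P') (add_mset c (M - {#a#}))"
      using add.hyps B by (intro orbit_monomial.add) auto
    moreover have "poly_prod (orbit_polytope C q) P = poly_prod (orbit_polytope B p) (poly_prod (orbit_polytope C q) P')"
      unfolding B(7) by (simp add: poly_prod_eq_plus ac_simps)
    moreover have "B \<inter> (C \<union> I') = {}" "C \<union> I = B \<union> (C \<union> I')" "add_mset c M - {#a#} = add_mset c (M - {#a#})"
      using add.hyps B False by auto
    ultimately show ?thesis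
      using B(1-3) by metis
  qed
qed simp

subsection \<open>Normal equivalence\<close>

text \<open>Normal equivalence witnessed factor by factor. That it implies equal fans is a direct
  induction; that every pair of normally equivalent products admits such a witness comes from
  \<open>orbit_monomial_unique\<close>.\<close>

inductive orbit_equiv :: "nat set \<Rightarrow> polytope \<Rightarrow> polytope \<Rightarrow> bool" where
  orbit: "finite I \<Longrightarrow> supp p \<subseteq> I \<Longrightarrow> supp q \<subseteq> I \<Longrightarrow> mtype (vals I p) = mtype (vals I q) \<Longrightarrow>
    orbit_equiv I (orbit_polytope I p) (orbit_polytope I q)"
| product: "orbit_equiv I P P' \<Longrightarrow> orbit_equiv J Q Q' \<Longrightarrow> I \<inter> J = {} \<Longrightarrow>
    orbit_equiv (I \<union> J) (poly_prod P Q) (poly_prod P' Q')"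

lemma orbit_equiv_orbit_product: "orbit_equiv I P Q \<Longrightarrow> orbit_product I P \<and> orbit_product I Q"
  by (induction rule: orbit_equiv.induct) (auto intro: orbit_product.intros)

lemma orbit_equiv_amax_le: "orbit_equiv I P Q \<Longrightarrow> amax_le I P = amax_le I Q"
proof (induction rule: orbit_equiv.induct)
  case (orbit I p q)
  then show ?case
    by (rule amax_le_orbit_cong)
next
  case (product I P P' J Q Q')
  then have "polytope_in I P" "polytope_in I P'" "polytope_in J Q" "polytope_in J Q'"
    using orbit_equiv_orbit_product orbit_product_polytope_in by blast+
  with product show ?case
    by (intro ext) (simp add: amax_le_poly_prod)
qed

lemma orbit_equiv_normal_fan: "orbit_equiv I P Q \<Longrightarrow> normal_fan I P = normal_fan I Q"
  using orbit_equiv_amax_le orbit_equiv_orbit_product orbit_product_polytope_in normal_fan_eq_iff' by metis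

lemma orbit_equiv_zero: "orbit_equiv {} {0} {0}"
  using orbit_equiv.orbit[of "{}" 0 0] orbit_polytope_const[of "{}" 0 0] by simp

lemma amax_le_cong:
  assumes "\<And>i. i \<in> I \<Longrightarrow> y i = z i" "\<And>i. i \<in> I \<Longrightarrow> y' i = z' i"
  shows "amax_le I P y y' \<longleftrightarrow> amax_le I P z z'"
  using amax_cong[of I y z P] amax_cong[of I y' z' P] assms by (simp add: amax_le_def)

lemma amax_le_eq_on: "(\<And>i. i \<in> I \<Longrightarrow> y i = y' i) \<Longrightarrow> amax_le I P y y'"
  using amax_cong[of I y y' P] by (simp add: amax_le_def)

text \<open>Directions that are constant on a block and zero elsewhere detect the blocks.\<close>

lemma block_subset:
  assumes B: "finite B" "supp p \<subseteq> B" "B \<inter> I = {}" "polytope_in I P"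
    and C: "finite C" "supp q \<subseteq> C" "mtype (vals C q) = gen_composition c" "C \<inter> J = {}" "polytope_in J Q"
    and eq: "B \<union> I = C \<union> J"
      "amax_le (B \<union> I) (poly_prod (orbit_polytope B p) P) = amax_le (C \<union> J) (poly_prod (orbit_polytope C q) Q)"
    and b: "b \<in> B" "b \<in> C"
  shows "C \<subseteq> B"
proof -
  \<comment> \<open>Constant on \<open>B\<close> and zero on \<open>I\<close>, this lies above the
    zero functional for the first product. For the second product it then has to be constant on
    \<open>C\<close>, with value 1 because of \<open>b\<close>.\<close>
  let ?y = "\<lambda>i. if i \<in> B then 1 else 0 :: real"
  have "amax_le B (orbit_polytope B p) (\<lambda>_. 0) ?y"
    unfolding amax_le_orbit_polytope[OF B(1,2)] by (simp add: sorted_along_def)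
  moreover have "amax_le I P (\<lambda>_. 0) ?y"
    by (rule amax_le_eq_on) (use B(3) in auto)
  ultimately have "amax_le (B \<union> I) (poly_prod (orbit_polytope B p) P) (\<lambda>_. 0) ?y"
    using amax_le_poly_prod[OF orbit_polytope_in[OF B(1,2)] B(4,3)] by simp
  then have "amax_le C (orbit_polytope C q) (\<lambda>_. 0) ?y"
    using amax_le_poly_prod[OF orbit_polytope_in[OF C(1,2)] C(5,4)] eq by simp
  then have "\<forall>i\<in>C. ?y i = ?y b"
    using b(2) unfolding amax_le_zero_orbit_polytope[OF C(1-3)] by blast
  with b(1) show ?thesis
    by (auto split: if_splits)
qed

text \<open>Directions extended by zero from \<open>I\<close> are trivially comparable on
  \<open>J\<close>, so the factor on \<open>J\<close> drops out of the comparison.\<close>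

lemma amax_le_factor:
  assumes P: "polytope_in I P" "polytope_in I P'" and Q: "polytope_in J Q" "polytope_in J Q'" and "I \<inter> J = {}"
    and eq: "amax_le (I \<union> J) (poly_prod P Q) = amax_le (I \<union> J) (poly_prod P' Q')"
  shows "amax_le I P = amax_le I P'"
proof (intro ext)
  fix y y' :: "nat \<Rightarrow> real"
  let ?r = "\<lambda>y i. if i \<in> I then y i else 0"
  have "amax_le I P (?r y) (?r y') \<and> amax_le J Q (?r y) (?r y') \<longleftrightarrow>
      amax_le I P' (?r y) (?r y') \<and> amax_le J Q' (?r y) (?r y')"
    unfolding amax_le_poly_prod[OF P(1) Q(1) assms(5), symmetric] amax_le_poly_prod[OF P(2) Q(2) assms(5), symmetric]
    by (simp only: eq)
  moreover have "amax_le J R (?r y) (?r y')" for R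
    by (rule amax_le_eq_on) (use assms(5) in auto)
  moreover have "amax_le I R y y' = amax_le I R (?r y) (?r y')" for R
    by (rule amax_le_cong) auto
  ultimately show "amax_le I P y y' = amax_le I P' y y'"
    by simp
qed

text \<open>A label \<open>b\<close> of the first block of \<open>P\<close> lies in some block of
  \<open>Q\<close>, and \<open>block_subset\<close> applied both ways shows that the two blocks
  agree. Cancelling factors compares their types and leaves the remaining products to the
  induction.\<close>

theorem orbit_monomial_unique:
  assumes "orbit_monomial I P M" "orbit_monomial I Q N" "amax_le I P = amax_le I Q"
  shows "M = N \<and> orbit_equiv I P Q"
  using assms
proof (induction arbitrary: Q N rule: orbit_monomial.induct)
  case empty
  from empty(1) have "Q = {0} \<and> N = {#}"
    by (cases rule: orbit_monomial.cases) (auto dest: block_nonempty)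
  then show ?case
    using orbit_equiv_zero by simp
next
  case (add B p a I P M)
  obtain b where b: "b \<in> B"
    using block_nonempty[OF add.hyps(3)] by blast
  obtain C q c J R N' where C: "b \<in> C" "finite C" "supp q \<subseteq> C" "mtype (vals C q) = gen_composition c"
    "C \<inter> J = {}" "orbit_monomial J R N'" "B \<union> I = C \<union> J" "Q = poly_prod (orbit_polytope C q) R" "N = add_mset c N'"
    using orbit_monomial_split_mem[OF add.prems(1) UnI1[OF b]] by (elim exE conjE) (rule that)
  have P: "polytope_in I P" "polytope_in J R"
    using add.hyps C orbit_monomial_polytope_in by blast+
  have eq: "amax_le (B \<union> I) (poly_prod (orbit_polytope B p) P) = amax_le (C \<union> J) (poly_prod (orbit_polytope C q) R)"
    using add.prems(2) C by simp
  have "C \<subseteq> B"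
    using block_subset[OF add.hyps(1,2,4) P(1) C(2-5) P(2) C(7) eq b C(1)] .
  moreover have "B \<subseteq> C"
    using block_subset[OF C(2,3,5) P(2) add.hyps(1-4) P(1) C(7)[symmetric] eq[symmetric] C(1) b] .
  ultimately have BC: "C = B"
    by simp
  then have IJ: "J = I"
    using C(5,7) add.hyps(4) by blast
  note B = orbit_polytope_in[OF add.hyps(1,2)] orbit_polytope_in[OF C(2,3), unfolded BC]
  have eq': "amax_le (B \<union> I) (poly_prod (orbit_polytope B p) P) = amax_le (B \<union> I) (poly_prod (orbit_polytope B q) R)"
    using eq BC IJ by simp
  \<comment> \<open>The factors are exchanged since \<open>amax_le_factor\<close> recovers the first
    one only.\<close>
  have "amax_le (I \<union> B) (poly_prod P (orbit_polytope B p)) = amax_le (I \<union> B) (poly_prod R (orbit_polytope B q))"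
    using eq' by (simp only: Un_commute[of I B] poly_prod_commute[of P] poly_prod_commute[of R])
  moreover have "I \<inter> B = {}"
    using add.hyps(4) by blast
  ultimately have le: "amax_le B (orbit_polytope B p) = amax_le B (orbit_polytope B q)" "amax_le I P = amax_le I R"
    using amax_le_factor[OF B P(1) P(2)[unfolded IJ] add.hyps(4) eq']
      amax_le_factor[OF P(1) P(2)[unfolded IJ] B] by simp_all
  have type: "mtype (vals B p) = mtype (vals B q)"
    using amax_le_orbit_imp_mtype_eq[OF add.hyps(1,2) _ le(1)] C(3) BC by simp
  then have "a = c"
    using add.hyps(3) C(4) BC by (simp add: gen_composition_inject)
  moreover have "M = N' \<and> orbit_equiv I P R"
    using add.IH[of R N'] C(6) IJ le(2) by simp
  moreover have "orbit_equiv B (orbit_polytope B p) (orbit_polytope B q)"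
    using orbit_equiv.orbit[OF add.hyps(1,2) _ type] C(3) BC by simp
  ultimately show ?case
    using orbit_equiv.product add.hyps(4) C(8,9) BC by auto
qed

subsection \<open>Relabelling\<close>

lemma relabel_superset:
  assumes "finite X" "supp p \<subseteq> X"
  shows "relabel \<sigma> p = (\<Sum>i\<in>X. Poly_Mapping.single (\<sigma> i) (coord p i))"
  unfolding relabel_def using assms
  by (intro sum.mono_neutral_left) (auto simp: in_keys_iff)

lemma relabel_add: "relabel \<sigma> (p + q) = relabel \<sigma> p + relabel \<sigma> q"
proof -
  let ?X = "supp p \<union> supp q"
  have "supp (p + q) \<subseteq> ?X"
    by (rule keys_add)
  then show ?thesis
    by (simp add: relabel_superset[of ?X] lookup_add single_add sum.distrib)
qed

lemma relabel_scaleR: "relabel \<sigma> (c *\<^sub>R p) = c *\<^sub>R relabel \<sigma> p"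
proof -
  have single: "c *\<^sub>R Poly_Mapping.single i x = Poly_Mapping.single i (c * x)" for i :: nat and x :: real
    by (rule poly_mapping_eqI) (simp add: lookup_single when_def)
  have "supp (c *\<^sub>R p) \<subseteq> supp p"
    by (auto simp: in_keys_iff)
  then show ?thesis
    by (simp add: relabel_superset[of "supp p"] scaleR_sum_right single)
qed

lemma linear_relabel: "linear (relabel \<sigma>)"
  by (rule linearI) (simp_all add: relabel_add relabel_scaleR)

lemma lookup_relabel:
  assumes "inj_on \<sigma> I" "finite I" "supp p \<subseteq> I" "i \<in> I"
  shows "coord (relabel \<sigma> p) (\<sigma> i) = coord p i"
proof -
  have "coord (relabel \<sigma> p) (\<sigma> i) = (\<Sum>k\<in>I. coord p k when \<sigma> k = \<sigma> i)"
    by (simp add: relabel_superset[OF assms(2,3)] lookup_sum lookup_single)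
  also have "\<dots> = (\<Sum>k\<in>I. if k = i then coord p k else 0)"
    using assms(1,4) by (intro sum.cong refl) (auto simp: when_def inj_on_def)
  finally show ?thesis
    using assms(2,4) by simp
qed

lemma keys_relabel: "supp p \<subseteq> I \<Longrightarrow> supp (relabel \<sigma> p) \<subseteq> \<sigma> ` I"
proof -
  assume "supp p \<subseteq> I"
  then have "coord (relabel \<sigma> p) j = 0" if "j \<notin> \<sigma> ` I" for j
    using that unfolding relabel_def lookup_sum by (intro sum.neutral) (auto simp: lookup_single when_def)
  then show ?thesis
    by (auto simp: in_keys_iff)
qed

lemma relabel_cong: "supp p \<subseteq> I \<Longrightarrow> (\<And>i. i \<in> I \<Longrightarrow> \<sigma> i = \<tau> i) \<Longrightarrow> relabel \<sigma> p = relabel \<tau> p"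
  unfolding relabel_def by (intro sum.cong) auto

lemma relabel_image_cong:
  assumes "supported I P" "\<And>i. i \<in> I \<Longrightarrow> \<sigma> i = \<tau> i"
  shows "relabel \<sigma> ` P = relabel \<tau> ` P"
proof (rule image_cong[OF refl])
  fix p
  assume "p \<in> P"
  then show "relabel \<sigma> p = relabel \<tau> p"
    using assms by (intro relabel_cong[of p I]) (auto simp: supported_def)
qed

lemma relabel_poly_prod: "relabel \<sigma> ` poly_prod P Q = poly_prod (relabel \<sigma> ` P) (relabel \<sigma> ` Q)"
proof (intro equalityI subsetI)
  fix v
  assume "v \<in> poly_prod (relabel \<sigma> ` P) (relabel \<sigma> ` Q)"
  then obtain p q where "p \<in> P" "q \<in> Q" "v = relabel \<sigma> (p + q)"
    by (auto simp: poly_prod_def relabel_add)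
  then show "v \<in> relabel \<sigma> ` poly_prod P Q"
    by (auto simp: poly_prod_def)
qed (auto simp: poly_prod_def relabel_add, blast)

lemma relabel_zero: "relabel \<sigma> 0 = 0"
  by (simp add: relabel_def)

lemma vals_image:
  assumes "inj_on \<sigma> I"
  shows "vals (\<sigma> ` I) v = image_mset (\<lambda>i. coord v (\<sigma> i)) (mset_set I)"
  by (simp add: vals_def multiset.map_comp o_def flip: image_mset_mset_set[OF assms])

lemma vals_relabel:
  assumes "inj_on \<sigma> I" "finite I" "supp p \<subseteq> I"
  shows "vals (\<sigma> ` I) (relabel \<sigma> p) = vals I p"
  unfolding vals_image[OF assms(1)]
  using assms unfolding vals_def by (intro image_mset_cong) (simp add: lookup_relabel)

lemma relabel_orbit:
  assumes \<sigma>: "inj_on \<sigma> I" and I: "finite I" and p: "supp p \<subseteq> I"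
  shows "relabel \<sigma> ` orbit I p = orbit (\<sigma> ` I) (relabel \<sigma> p)"
proof (intro equalityI subsetI)
  fix v
  assume v: "v \<in> orbit (\<sigma> ` I) (relabel \<sigma> p)"
  let ?u = "vec_on I (\<lambda>i. coord v (\<sigma> i))"
  have "vals I ?u = vals (\<sigma> ` I) v"
    by (simp add: vals_vec_on[OF I] vals_image[OF \<sigma>])
  then have "?u \<in> orbit I p"
    using v keys_vec_on[OF I] by (simp add: orbit_def vals_relabel[OF \<sigma> I p])
  moreover have "v = relabel \<sigma> ?u"
  proof (rule poly_mapping_eqI)
    fix j
    show "coord v j = coord (relabel \<sigma> ?u) j"
    proof (cases "j \<in> \<sigma> ` I")
      case True
      then show ?thesis
        using I by (auto simp: lookup_relabel[OF \<sigma> I keys_vec_on[OF I]] lookup_vec_on)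
    next
      case False
      then have "j \<notin> supp v" "j \<notin> supp (relabel \<sigma> ?u)"
        using v keys_relabel[OF keys_vec_on[OF I]] by (auto simp: orbit_def)
      then show ?thesis
        by (simp add: in_keys_iff)
    qed
  qed
  ultimately show "v \<in> relabel \<sigma> ` orbit I p"
    by blast
qed (auto simp: orbit_def vals_relabel[OF \<sigma> I] p dest: subsetD[OF keys_relabel])

lemma relabel_orbit_polytope:
  assumes "inj_on \<sigma> I" "finite I" "supp p \<subseteq> I"
  shows "relabel \<sigma> ` orbit_polytope I p = orbit_polytope (\<sigma> ` I) (relabel \<sigma> p)"
  using assms
  by (simp add: orbit_polytope_eq keys_relabel convex_hull_linear_image[OF linear_relabel] relabel_orbit)

lemma inj_on_Un_disjoint: "inj_on \<sigma> (I \<union> J) \<Longrightarrow> I \<inter> J = {} \<Longrightarrow> \<sigma> ` I \<inter> \<sigma> ` J = {}"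
  by (auto simp: inj_on_def)

lemma orbit_equiv_relabel:
  "orbit_equiv I P Q \<Longrightarrow> inj_on \<sigma> I \<Longrightarrow> orbit_equiv (\<sigma> ` I) (relabel \<sigma> ` P) (relabel \<sigma> ` Q)"
proof (induction rule: orbit_equiv.induct)
  case (orbit I p q)
  then show ?case
    by (simp add: relabel_orbit_polytope orbit_equiv.orbit keys_relabel vals_relabel)
next
  case (product I P P' J Q Q')
  then show ?case
    unfolding relabel_poly_prod image_Un
    by (intro orbit_equiv.product inj_on_Un_disjoint) (auto intro: inj_on_subset)
qed

lemma orbit_monomial_relabel:
  "orbit_monomial I P M \<Longrightarrow> inj_on \<sigma> I \<Longrightarrow> orbit_monomial (\<sigma> ` I) (relabel \<sigma> ` P) M"
proof (induction rule: orbit_monomial.induct)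
  case empty
  then show ?case
    using orbit_monomial.empty by (simp add: relabel_zero)
next
  case (add B p a I P M)
  have "inj_on \<sigma> B" "inj_on \<sigma> I"
    using add.prems by (auto intro: inj_on_subset)
  with add show ?case
    unfolding relabel_poly_prod image_Un
    by (simp add: relabel_orbit_polytope)
      (intro orbit_monomial.add, auto simp: keys_relabel vals_relabel inj_on_Un_disjoint)
qed

text \<open>Blocks with the same generator have the same size, and any bijection between them will
  do because the type forgets the labels. The coordinates may still differ, so the result is an
  equivalence and not an equality.\<close>

theorem orbit_monomial_eq_imp_relabel:
  assumes "orbit_monomial I P M" "orbit_monomial J Q M"
  shows "\<exists>\<sigma>. bij_betw \<sigma> I J \<and> orbit_equiv J (relabel \<sigma> ` P) Q"
  using assms
proof (induction arbitrary: J Q rule: orbit_monomial.induct)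
  case empty
  then have "J = {}" "Q = {0}"
    by (auto elim: orbit_monomial.cases)
  then show ?case
    using orbit_equiv_zero by (intro exI[of _ id]) (simp add: relabel_zero bij_betw_def)
next
  case (add B p a I P M)
  obtain C q J' R where C: "finite C" "supp q \<subseteq> C" "mtype (vals C q) = gen_composition a"
    "C \<inter> J' = {}" "orbit_monomial J' R (add_mset a M - {#a#})" "J = C \<union> J'" "Q = poly_prod (orbit_polytope C q) R"
    using orbit_monomial_split_gen[OF add.prems, of a] by auto
  obtain \<tau> where \<tau>: "bij_betw \<tau> I J'" "orbit_equiv J' (relabel \<tau> ` P) R"
    using add.IH[of J' R] C(5) by auto
  have "card B = card C"
    using sum_gen_composition[OF add.hyps(3)] sum_gen_composition[OF C(3)] by simp
  then obtain \<rho> where \<rho>: "bij_betw \<rho> B C"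
    using add.hyps(1) C(1) finite_same_card_bij by blast
  define \<sigma> where "\<sigma> i = (if i \<in> B then \<rho> i else \<tau> i)" for i
  have \<sigma>B: "bij_betw \<sigma> B C"
    using \<rho> by (subst bij_betw_cong[of B \<sigma> \<rho>]) (auto simp: \<sigma>_def)
  have \<sigma>I: "\<sigma> i = \<tau> i" if "i \<in> I" for i
    using that add.hyps(4) by (auto simp: \<sigma>_def)
  have "bij_betw \<sigma> I J'"
    using \<tau>(1) by (subst bij_betw_cong[of I \<sigma> \<tau>]) (auto simp: \<sigma>I)
  with \<sigma>B have "bij_betw \<sigma> (B \<union> I) J"
    unfolding C(6) using C(4) by (rule bij_betw_combine)
  moreover have "orbit_equiv J (relabel \<sigma> ` poly_prod (orbit_polytope B p) P) Q"
    unfolding relabel_poly_prod C(6,7)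
  proof (rule orbit_equiv.product)
    have inj: "inj_on \<sigma> B" and im: "\<sigma> ` B = C"
      using \<sigma>B by (auto simp: bij_betw_def)
    show "orbit_equiv C (relabel \<sigma> ` orbit_polytope B p) (orbit_polytope C q)"
      using relabel_orbit_polytope[OF inj add.hyps(1,2)] vals_relabel[OF inj add.hyps(1,2)]
        keys_relabel[OF add.hyps(2), of \<sigma>] C(1-3) add.hyps(3) im
      by (simp add: orbit_equiv.orbit)
    have "supported I P"
      using add.hyps orbit_monomial_polytope_in polytope_in_supported by blast
    then have "relabel \<sigma> ` P = relabel \<tau> ` P"
      using \<sigma>I by (rule relabel_image_cong)
    with \<tau>(2) show "orbit_equiv J' (relabel \<sigma> ` P) R"
      by simp
  qed (fact C(4))
  ultimately show ?case
    by blast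
qed

subsection \<open>Maximal faces\<close>

lemma max_face_eq_amax:
  assumes "finite I" "S \<subseteq> I"
  shows "max_face S P = amax I P (\<lambda>i. if i \<in> S then 1 else 0)"
proof -
  have "pairing I (\<lambda>i. if i \<in> S then 1 else 0) p = (\<Sum>s\<in>S. coord p s)" for p
    unfolding pairing_def using assms by (intro sum.mono_neutral_cong_right) auto
  then show ?thesis
    by (simp add: max_face_def amax_def)
qed

lemma max_face_poly_prod:
  assumes "polytope_in I P" "polytope_in J Q" "I \<inter> J = {}" "S \<subseteq> I \<union> J"
  shows "max_face S (poly_prod P Q) = poly_prod (max_face (S \<inter> I) P) (max_face (S \<inter> J) Q)"
proof -
  have "finite I" "finite J"
    using assms polytope_in_finite by auto
  then show ?thesis
    using assms amax_cong[of I "\<lambda>i. if i \<in> S then 1 else 0" "\<lambda>i. if i \<in> S \<inter> I then 1 else 0" P]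
      amax_cong[of J "\<lambda>i. if i \<in> S then 1 else 0" "\<lambda>i. if i \<in> S \<inter> J then 1 else 0" Q]
    by (simp add: max_face_eq_amax[of "I \<union> J"] max_face_eq_amax[of I] max_face_eq_amax[of J]
        amax_poly_prod polytope_in_supported)
qed

lemma vals_union: "finite I \<Longrightarrow> finite J \<Longrightarrow> I \<inter> J = {} \<Longrightarrow> vals (I \<union> J) p = vals I p + vals J p"
  by (simp add: vals_def mset_set_Union)

lemma vals_cong: "(\<And>i. i \<in> I \<Longrightarrow> coord p i = coord q i) \<Longrightarrow> vals I p = vals I q"
  unfolding vals_def by (cases "finite I") (auto intro!: image_mset_cong)

lemma vals_vec_on_lookup: "finite I \<Longrightarrow> vals I (vec_on I (coord v)) = vals I v"
  by (rule vals_cong) (simp add: lookup_vec_on)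

text \<open>Sortedness along the indicator of \<open>S\<close> means that no entry on
  \<open>I - S\<close> exceeds an entry on \<open>S\<close>. The sorted entries on \<open>S\<close>
  followed by those on the complement are then the sorted list of all entries, so each side runs
  through a full orbit of its own.\<close>

lemma max_face_orbit:
  assumes I: "finite I" and p: "supp p \<subseteq> I" and S: "S \<subseteq> I"
  shows "\<exists>q r. supp q \<subseteq> S \<and> supp r \<subseteq> I - S \<and>
    max_face S (orbit_polytope I p) = poly_prod (orbit_polytope S q) (orbit_polytope (I - S) r) \<and>
    mtype (vals S q) = comp_take (card S) (mtype (vals I p)) \<and>
    mtype (vals (I - S) r) = comp_drop (card S) (mtype (vals I p))"
proof -
  let ?T = "I - S" and ?xs = "desc (vals I p)" and ?y = "\<lambda>i. if i \<in> S then 1 else 0 :: real"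
  have fin: "finite S" "finite ?T"
    using I S finite_subset by auto
  have card: "card S \<le> card I"
    using I S by (rule card_mono)
  have IST: "S \<union> ?T = I" "S \<inter> ?T = {}"
    using S by auto
  obtain q where q: "supp q \<subseteq> S" "vals S q = mset (take (card S) ?xs)"
    using ex_vals[OF fin(1), of "mset (take (card S) ?xs)"] card by auto
  obtain r where r: "supp r \<subseteq> ?T" "vals ?T r = mset (drop (card S) ?xs)"
    using ex_vals[OF fin(2), of "mset (drop (card S) ?xs)"] by (auto simp: card_Diff_subset[OF fin(1) S])
  have dec: "decreasing (take (card S) ?xs)" "decreasing (drop (card S) ?xs)"
    by (simp_all add: sorted_wrt_take sorted_wrt_drop)
  have cross: "x \<le> x'" if "x \<in># vals ?T r" "x' \<in># vals S q" for x x'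
  proof -
    have "decreasing (take (card S) ?xs @ drop (card S) ?xs)"
      by simp
    with that show ?thesis
      unfolding sorted_wrt_append q(2) r(2) by auto
  qed
  have "amax I (orbit I p) ?y = orbit S q + orbit ?T r"
  proof (intro equalityI subsetI)
    fix v
    assume "v \<in> amax I (orbit I p) ?y"
    then have v: "supp v \<subseteq> I" "vals I v = vals I p" "sorted_along I ?y (coord v)"
      unfolding amax_orbit[OF I] by (auto simp: orbit_def)
    let ?a = "vec_on S (coord v)" and ?b = "vec_on ?T (coord v)"
    have le: "x \<le> x'" if x: "x \<in># vals ?T v" "x' \<in># vals S v" for x x'
    proof -
      obtain i j where ij: "i \<in> ?T" "x = coord v i" "j \<in> S" "x' = coord v j"
        using x fin by (auto simp: vals_def)
      then have "i \<in> I" "j \<in> I" "?y i < ?y j"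
        using S by auto
      with v(3) ij show ?thesis
        unfolding sorted_along_def by simp
    qed
    let ?l = "desc (vals S v) @ desc (vals ?T v)"
    have "decreasing ?l"
      using le by (simp add: sorted_wrt_append)
    moreover have "mset ?l = vals I p"
      using vals_union[OF fin IST(2), of v] IST(1) v(2) by simp
    ultimately have "?xs = ?l"
      by (rule desc_eqI)
    then have "take (card S) ?xs = desc (vals S v)" "drop (card S) ?xs = desc (vals ?T v)"
      by simp_all
    then have "vals S v = vals S q" "vals ?T v = vals ?T r"
      using q r by (metis mset_desc)+
    then have "?a \<in> orbit S q" "?b \<in> orbit ?T r"
      by (simp_all add: orbit_def vals_vec_on_lookup[OF fin(1)] vals_vec_on_lookup[OF fin(2)]
          keys_vec_on[OF fin(1)] keys_vec_on[OF fin(2)])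
    moreover have "v = ?a + ?b"
    proof (rule poly_mapping_eqI)
      fix i
      show "coord v i = coord (?a + ?b) i"
        using v(1) S fin by (cases "i \<in> I") (auto simp: lookup_add lookup_vec_on in_keys_iff)
    qed
    ultimately show "v \<in> orbit S q + orbit ?T r"
      by (auto simp: set_plus_def)
  next
    fix v
    assume "v \<in> orbit S q + orbit ?T r"
    then obtain a b where ab: "v = a + b" "supp a \<subseteq> S" "vals S a = vals S q"
      "supp b \<subseteq> ?T" "vals ?T b = vals ?T r"
      by (auto simp: set_plus_def orbit_def)
    have va: "coord v i = coord a i" if "i \<in> S" for i
      using ab that by (auto simp: lookup_add in_keys_iff)
    have vb: "coord v i = coord b i" if "i \<in> ?T" for i
      using ab that by (auto simp: lookup_add in_keys_iff)
    have vals: "vals S v = vals S q" "vals ?T v = vals ?T r"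
      using vals_cong[of S v a] vals_cong[of ?T v b] va vb ab by auto
    then have "vals I v = mset (take (card S) ?xs) + mset (drop (card S) ?xs)"
      using vals_union[OF fin IST(2), of v] IST(1) q r by simp
    also have "\<dots> = vals I p"
      by (simp flip: mset_append)
    finally have "vals I v = vals I p" .
    moreover have "supp v \<subseteq> I"
      using keys_add[of a b] ab S by auto
    moreover have "sorted_along I ?y (coord v)"
      unfolding sorted_along_def
    proof (intro ballI impI)
      fix i j
      assume "i \<in> I" "j \<in> I" "?y i < ?y j"
      then have "i \<in> ?T" "j \<in> S"
        by (auto split: if_splits)
      then show "coord v i \<le> coord v j"
        using cross vals vals_mem fin by metis
    qed
    ultimately show "v \<in> amax I (orbit I p) ?y"
      unfolding amax_orbit[OF I] by (simp add: orbit_def)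
  qed
  then have "max_face S (orbit_polytope I p) = poly_prod (orbit_polytope S q) (orbit_polytope ?T r)"
    using fin q(1) r(1)
    by (simp add: max_face_eq_amax[OF I S] orbit_polytope_eq[OF I p] orbit_polytope_eq poly_prod_eq_plus
        amax_convex_hull[OF finite_orbit[OF I p]] convex_hull_set_plus)
  moreover have "mtype (vals S q) = comp_take (card S) (mtype (vals I p))"
    "mtype (vals ?T r) = comp_drop (card S) (mtype (vals I p))"
    using dec by (simp_all add: q(2) r(2) mtype_mset runs_take runs_drop mtype_def[of "vals I p"])
  ultimately show ?thesis
    using q(1) r(1) by blast
qed

lemma Diff_Un_disjoint: "I \<inter> J = {} \<Longrightarrow> S \<subseteq> I \<union> J \<Longrightarrow> I \<union> J - S = (I - S \<inter> I) \<union> (J - S \<inter> J)"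
  and Un_Int_parts: "S \<subseteq> I \<union> J \<Longrightarrow> S = (S \<inter> I) \<union> (S \<inter> J)"
  by auto

text \<open>This is why restriction and contraction are well defined on classes: equal types have
  equal cuts, and maximal faces of products are products of maximal faces.\<close>

lemma orbit_equiv_max_face:
  assumes "orbit_equiv I P Q" "S \<subseteq> I"
  shows "\<exists>A B A' B'. orbit_equiv S A A' \<and> orbit_equiv (I - S) B B' \<and>
    max_face S P = poly_prod A B \<and> max_face S Q = poly_prod A' B'"
  using assms
proof (induction arbitrary: S rule: orbit_equiv.induct)
  case (orbit I p q)
  have fin: "finite S" "finite (I - S)"
    using orbit finite_subset by auto
  obtain a b where a: "supp a \<subseteq> S" "supp b \<subseteq> I - S"
    "max_face S (orbit_polytope I p) = poly_prod (orbit_polytope S a) (orbit_polytope (I - S) b)"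
    "mtype (vals S a) = comp_take (card S) (mtype (vals I p))"
    "mtype (vals (I - S) b) = comp_drop (card S) (mtype (vals I p))"
    using max_face_orbit[OF orbit(1,2,5)] by (elim exE conjE) (rule that)
  obtain c d where c: "supp c \<subseteq> S" "supp d \<subseteq> I - S"
    "max_face S (orbit_polytope I q) = poly_prod (orbit_polytope S c) (orbit_polytope (I - S) d)"
    "mtype (vals S c) = comp_take (card S) (mtype (vals I q))"
    "mtype (vals (I - S) d) = comp_drop (card S) (mtype (vals I q))"
    using max_face_orbit[OF orbit(1,3,5)] by (elim exE conjE) (rule that)
  have "orbit_equiv S (orbit_polytope S a) (orbit_polytope S c)"
    "orbit_equiv (I - S) (orbit_polytope (I - S) b) (orbit_polytope (I - S) d)"
    using a c orbit(4) fin by (auto intro!: orbit_equiv.orbit)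
  with a(3) c(3) show ?case
    by (intro exI conjI)
next
  case (product I P P' J Q Q')
  obtain A B A' B' where A: "orbit_equiv (S \<inter> I) A A'" "orbit_equiv (I - S \<inter> I) B B'"
    "max_face (S \<inter> I) P = poly_prod A B" "max_face (S \<inter> I) P' = poly_prod A' B'"
    using product.IH(1)[of "S \<inter> I"] by (elim exE conjE meta_impE) (simp, rule that)
  obtain C D C' D' where C: "orbit_equiv (S \<inter> J) C C'" "orbit_equiv (J - S \<inter> J) D D'"
    "max_face (S \<inter> J) Q = poly_prod C D" "max_face (S \<inter> J) Q' = poly_prod C' D'"
    using product.IH(2)[of "S \<inter> J"] by (elim exE conjE meta_impE) (simp, rule that)
  have "polytope_in I P" "polytope_in I P'" "polytope_in J Q" "polytope_in J Q'"
    using product.hyps orbit_equiv_orbit_product orbit_product_polytope_in by blast+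
  then have face: "max_face S (poly_prod P Q) = poly_prod (poly_prod A C) (poly_prod B D)"
    "max_face S (poly_prod P' Q') = poly_prod (poly_prod A' C') (poly_prod B' D')"
    using product.hyps(3) product.prems A(3,4) C(3,4)
    by (simp_all add: max_face_poly_prod) (simp_all add: poly_prod_eq_plus ac_simps)
  have "orbit_equiv S (poly_prod A C) (poly_prod A' C')"
    using orbit_equiv.product[OF A(1) C(1)] product.hyps(3) Un_Int_parts[OF product.prems] by auto
  moreover have "orbit_equiv (I \<union> J - S) (poly_prod B D) (poly_prod B' D')"
    using orbit_equiv.product[OF A(2) C(2)] product.hyps(3) Diff_Un_disjoint[OF product.hyps(3) product.prems] by auto
  ultimately show ?case
    using face by (intro exI conjI)
qed

section \<open>Summing over all maximal faces\<close>

lemma sum_Pow_card: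
  fixes h :: "nat \<Rightarrow> 'r::semiring_1"
  assumes "finite I"
  shows "(\<Sum>S\<in>Pow I. h (card S)) = (\<Sum>k\<le>card I. of_nat (card I choose k) * h k)"
proof -
  have "(\<Sum>S\<in>Pow I. h (card S)) = (\<Sum>k\<in>{..card I}. \<Sum>S\<in>{S \<in> Pow I. card S = k}. h (card S))"
    using assms by (intro sum.group[symmetric]) (auto intro: card_mono)
  also have "\<dots> = (\<Sum>k\<le>card I. of_nat (card I choose k) * h k)"
    using n_subsets[OF assms] by (intro sum.cong) auto
  finally show ?thesis .
qed

lemma sum_Pow_union:
  assumes "I \<inter> J = {}"
  shows "(\<Sum>S\<in>Pow (I \<union> J). h (S \<inter> I) (S \<inter> J)) = (\<Sum>S\<in>Pow I. \<Sum>T\<in>Pow J. h S T)"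
  unfolding sum.cartesian_product
  by (rule sum.reindex_bij_witness[of _ "\<lambda>(S, T). S \<union> T" "\<lambda>S. (S \<inter> I, S \<inter> J)"])
    (use assms in \<open>auto simp: Int_Un_distrib2 Int_absorb2 disjoint_iff\<close>)

text \<open>The monomials of both factors depend on \<open>S\<close> only through its size, so
  grouping the subsets by size produces the binomial coefficients of the coproduct.\<close>

lemma max_face_block_comult:
  assumes I: "finite I" and p: "supp p \<subseteq> I"
  shows "\<exists>A B f g. (\<forall>S. S \<subseteq> I \<longrightarrow> orbit_monomial S (A S) (f S) \<and> orbit_monomial (I - S) (B S) (g S) \<and>
      max_face S (orbit_polytope I p) = poly_prod (A S) (B S)) \<and>
    (\<Sum>S\<in>Pow I. basis_vec (f S, g S)) = (comp_comult (comp_elem (mtype (vals I p))) :: _ \<Rightarrow>\<^sub>0 'k::field)"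
proof -
  let ?\<alpha> = "mtype (vals I p)"
  let ?f = "\<lambda>k. comp_mon (comp_take k ?\<alpha>)" and ?g = "\<lambda>k. comp_mon (comp_drop k ?\<alpha>)"
  have "\<exists>A B. orbit_monomial S A (?f (card S)) \<and> orbit_monomial (I - S) B (?g (card S)) \<and>
      max_face S (orbit_polytope I p) = poly_prod A B" if S: "S \<subseteq> I" for S
  proof -
    have "finite S" "finite (I - S)"
      using I S finite_subset by auto
    then show ?thesis
      using max_face_orbit[OF I p S] orbit_monomial_orbit by metis
  qed
  then have "\<forall>S. \<exists>A B. S \<subseteq> I \<longrightarrow> orbit_monomial S A (?f (card S)) \<and> orbit_monomial (I - S) B (?g (card S)) \<and>
      max_face S (orbit_polytope I p) = poly_prod A B"
    by blast
  then obtain A B where AB: "\<forall>S. S \<subseteq> I \<longrightarrow> orbit_monomial S (A S) (?f (card S)) \<and>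
      orbit_monomial (I - S) (B S) (?g (card S)) \<and> max_face S (orbit_polytope I p) = poly_prod (A S) (B S)"
    unfolding choice_iff by blast
  have "(\<Sum>S\<in>Pow I. basis_vec (?f (card S), ?g (card S))) = (comp_comult (comp_elem ?\<alpha>) :: _ \<Rightarrow>\<^sub>0 'k)"
    using sum_Pow_card[OF I, of "\<lambda>k. basis_vec (?f k, ?g k) :: _ \<Rightarrow>\<^sub>0 'k"]
    unfolding comp_comult_comp_elem[OF composition_mtype] by (simp add: comp_elem_eq sum_mtype)
  with AB show ?thesis
    by (intro exI[of _ A] exI[of _ B] exI[of _ "\<lambda>S. ?f (card S)"] exI[of _ "\<lambda>S. ?g (card S)"]) simp
qed

text \<open>A subset of a disjoint union is a pair of subsets, so the sum over faces of a product
  factors. This matches the multiplicativity of \<open>comp_comult\<close> and allows induction on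
  blocks.\<close>

theorem orbit_monomial_max_face:
  assumes "orbit_monomial I P M"
  shows "\<exists>A B f g. (\<forall>S. S \<subseteq> I \<longrightarrow> orbit_monomial S (A S) (f S) \<and> orbit_monomial (I - S) (B S) (g S) \<and>
      max_face S P = poly_prod (A S) (B S)) \<and>
    (\<Sum>S\<in>Pow I. basis_vec (f S, g S)) = (comp_comult (basis_vec M) :: _ \<Rightarrow>\<^sub>0 'k::field)"
  using assms
proof (induction rule: orbit_monomial.induct)
  case empty
  have "max_face {} {0} = {0}"
    by (auto simp: max_face_def)
  then show ?case
    using orbit_monomial.empty alg_homD(2)[OF alg_hom_comp_comult]
    by (intro exI[of _ "\<lambda>_. {0}"] exI[of _ "\<lambda>_. {#}"]) (simp add: basis_vec_zero flip: zero_prod_def)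
next
  case (add C p a I P M)
  obtain A B f g where A: "\<And>S. S \<subseteq> C \<Longrightarrow> orbit_monomial S (A S) (f S)" "\<And>S. S \<subseteq> C \<Longrightarrow> orbit_monomial (C - S) (B S) (g S)"
      "\<And>S. S \<subseteq> C \<Longrightarrow> max_face S (orbit_polytope C p) = poly_prod (A S) (B S)"
    and sum1: "(\<Sum>S\<in>Pow C. basis_vec (f S, g S)) = (comp_comult (comp_elem (mtype (vals C p))) :: _ \<Rightarrow>\<^sub>0 'k)"
    using max_face_block_comult[OF add.hyps(1,2)] by (elim exE conjE) (rule that, simp_all)
  obtain A' B' f' g' where A': "\<And>S. S \<subseteq> I \<Longrightarrow> orbit_monomial S (A' S) (f' S)" "\<And>S. S \<subseteq> I \<Longrightarrow> orbit_monomial (I - S) (B' S) (g' S)"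
      "\<And>S. S \<subseteq> I \<Longrightarrow> max_face S P = poly_prod (A' S) (B' S)"
    and sum2: "(\<Sum>S\<in>Pow I. basis_vec (f' S, g' S)) = (comp_comult (basis_vec M) :: _ \<Rightarrow>\<^sub>0 'k)"
    using add.IH by (elim exE conjE) (rule that, simp_all)
  have P: "polytope_in C (orbit_polytope C p)" "polytope_in I P"
    using add.hyps orbit_polytope_in orbit_monomial_polytope_in by auto
  have face: "orbit_monomial S (poly_prod (A (S \<inter> C)) (A' (S \<inter> I))) (f (S \<inter> C) + f' (S \<inter> I)) \<and>
      orbit_monomial (C \<union> I - S) (poly_prod (B (S \<inter> C)) (B' (S \<inter> I))) (g (S \<inter> C) + g' (S \<inter> I)) \<and>
      max_face S (poly_prod (orbit_polytope C p) P) =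
        poly_prod (poly_prod (A (S \<inter> C)) (A' (S \<inter> I))) (poly_prod (B (S \<inter> C)) (B' (S \<inter> I)))"
    if S: "S \<subseteq> C \<union> I" for S
  proof (intro conjI)
    show "orbit_monomial S (poly_prod (A (S \<inter> C)) (A' (S \<inter> I))) (f (S \<inter> C) + f' (S \<inter> I))"
      using orbit_monomial_union[OF A(1) A'(1), of "S \<inter> C" "S \<inter> I"] add.hyps(4) Un_Int_parts[OF S] by auto
    show "orbit_monomial (C \<union> I - S) (poly_prod (B (S \<inter> C)) (B' (S \<inter> I))) (g (S \<inter> C) + g' (S \<inter> I))"
      using orbit_monomial_union[OF A(2) A'(2), of "S \<inter> C" "S \<inter> I"] add.hyps(4)
        Diff_Un_disjoint[OF add.hyps(4) S] by auto
    show "max_face S (poly_prod (orbit_polytope C p) P) =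
        poly_prod (poly_prod (A (S \<inter> C)) (A' (S \<inter> I))) (poly_prod (B (S \<inter> C)) (B' (S \<inter> I)))"
      unfolding max_face_poly_prod[OF P add.hyps(4) S] A(3)[OF Int_lower2] A'(3)[OF Int_lower2]
      by (simp add: poly_prod_eq_plus ac_simps)
  qed
  have "(\<Sum>S\<in>Pow (C \<union> I). basis_vec (f (S \<inter> C) + f' (S \<inter> I), g (S \<inter> C) + g' (S \<inter> I)) :: _ \<Rightarrow>\<^sub>0 'k) =
      (\<Sum>S\<in>Pow C. \<Sum>T\<in>Pow I. basis_vec (f S, g S) * basis_vec (f' T, g' T))"
    by (simp add: sum_Pow_union[OF add.hyps(4), of "\<lambda>S T. basis_vec (f S + f' T, g S + g' T)"] basis_vec_mult)
  also have "\<dots> = comp_comult (comp_elem (gen_composition a)) * comp_comult (basis_vec M)"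
    unfolding sum1[unfolded add.hyps(3), symmetric] sum2[symmetric] by (simp only: sum_product)
  also have "\<dots> = comp_comult (basis_vec (add_mset a M))"
    by (simp add: comp_elem_eq comp_mon_gen basis_vec_mult flip: alg_homD(3)[OF alg_hom_comp_comult])
  finally show ?case
    using face
    by (intro exI[of _ "\<lambda>S. poly_prod (A (S \<inter> C)) (A' (S \<inter> I))"] exI[of _ "\<lambda>S. poly_prod (B (S \<inter> C)) (B' (S \<inter> I))"]
        exI[of _ "\<lambda>S. f (S \<inter> C) + f' (S \<inter> I)"] exI[of _ "\<lambda>S. g (S \<inter> C) + g' (S \<inter> I)"]) simp
qed

subsection \<open>Normal equivalence classes and isomorphism classes\<close>

lemma orbit_product_finite: "orbit_product I P \<Longrightarrow> finite I"
  using orbit_product_polytope_in polytope_in_finite by blast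

lemma orbit_equiv_iff_normal_fan:
  assumes "orbit_product I P" "orbit_product I Q"
  shows "orbit_equiv I P Q \<longleftrightarrow> normal_fan I P = normal_fan I Q"
proof
  assume "normal_fan I P = normal_fan I Q"
  then have le: "amax_le I P = amax_le I Q"
    using normal_fan_eq_iff' orbit_product_polytope_in assms by simp
  obtain M N where "orbit_monomial I P M" "orbit_monomial I Q N"
    using assms[THEN orbit_product_imp_orbit_monomial] by auto
  from orbit_monomial_unique[OF this le] show "orbit_equiv I P Q"
    by simp
qed (rule orbit_equiv_normal_fan)

lemma normal_class_mem_iff: "orbit_product I P \<Longrightarrow> Q \<in> normal_class I P \<longleftrightarrow> orbit_equiv I P Q"
  using orbit_equiv_iff_normal_fan[of I P Q] orbit_equiv_orbit_product[of I P Q]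
  by (auto simp: normal_class_def)

lemma normal_class_cong: "orbit_equiv I P Q \<Longrightarrow> normal_class I P = normal_class I Q"
  using orbit_equiv_normal_fan by (simp add: normal_class_def)

lemma orbit_equiv_refl: "orbit_product I P \<Longrightarrow> orbit_equiv I P P"
  by (simp add: orbit_equiv_iff_normal_fan)

lemma normal_class_eq_iff:
  assumes "orbit_product I P" "orbit_product I Q"
  shows "normal_class I P = normal_class I Q \<longleftrightarrow> orbit_equiv I P Q"
  using normal_class_mem_iff[OF assms(1)] normal_class_mem_iff[OF assms(2)] orbit_equiv_refl[OF assms(2)]
    normal_class_cong by blast

text \<open>Evaluates the operations on classes, which are unions over representatives: a constant
  family over a nonempty class.\<close>

lemma UN_normal_class:
  assumes "orbit_product I P" "\<And>Q. orbit_equiv I P Q \<Longrightarrow> F Q = F P"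
  shows "(\<Union>Q\<in>normal_class I P. F Q) = F P"
  using assms orbit_equiv_refl[OF assms(1)] normal_class_mem_iff[OF assms(1)] by blast

lemma class_relabel_normal_class:
  assumes "orbit_product I P" "bij_betw \<sigma> I J"
  shows "class_relabel J \<sigma> (normal_class I P) = normal_class J (relabel \<sigma> ` P)"
  unfolding class_relabel_def
proof (rule UN_normal_class[OF assms(1)])
  fix Q
  assume Q: "orbit_equiv I P Q"
  have "orbit_equiv J (relabel \<sigma> ` P) (relabel \<sigma> ` Q)"
    using orbit_equiv_relabel[OF Q, of \<sigma>] assms(2) by (simp add: bij_betw_def)
  then show "normal_class J (relabel \<sigma> ` Q) = normal_class J (relabel \<sigma> ` P)"
    by (rule normal_class_cong[symmetric])
qed

definition monomial_class :: "monomial \<Rightarrow> (nat set \<times> polytope set) set" where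
  "monomial_class M = {(J, normal_class J Q) | J Q. orbit_monomial J Q M}"

text \<open>Relabelling preserves monomials, and equal monomials provide a relabelling up to normal
  equivalence, so the monomial is a complete invariant of isomorphism classes.\<close>

lemma iso_class_normal_class:
  assumes "orbit_monomial I P M"
  shows "iso_class I (normal_class I P) = monomial_class M"
proof (intro equalityI subsetI)
  have P: "orbit_product I P"
    using assms by (rule orbit_monomial_imp_orbit_product)
  fix c
  {
    assume "c \<in> iso_class I (normal_class I P)"
    then obtain J \<sigma> where "bij_betw \<sigma> I J" "c = (J, class_relabel J \<sigma> (normal_class I P))"
      by (auto simp: iso_class_def)
    moreover from this have "orbit_monomial J (relabel \<sigma> ` P) M"
      using orbit_monomial_relabel[OF assms, of \<sigma>] by (auto simp: bij_betw_def)
    ultimately show "c \<in> monomial_class M"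
      using class_relabel_normal_class[OF P] by (auto simp: monomial_class_def)
  next
    assume "c \<in> monomial_class M"
    then obtain J Q where Q: "c = (J, normal_class J Q)" "orbit_monomial J Q M"
      by (auto simp: monomial_class_def)
    obtain \<sigma> where \<sigma>: "bij_betw \<sigma> I J" "orbit_equiv J (relabel \<sigma> ` P) Q"
      using orbit_monomial_eq_imp_relabel[OF assms Q(2)] by blast
    then have "class_relabel J \<sigma> (normal_class I P) = normal_class J Q"
      using class_relabel_normal_class[OF P \<sigma>(1)] normal_class_cong by simp
    moreover have "orbit_product J Q"
      using Q(2) by (rule orbit_monomial_imp_orbit_product)
    ultimately show "c \<in> iso_class I (normal_class I P)"
      using Q(1) \<sigma>(1) orbit_product_finite by (auto simp: iso_class_def OP_bar_def)
  }
qed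

text \<open>Blocks are placed on fresh labels, with real values of the prescribed type. Avoiding
  \<open>K\<close> provides the disjoint representatives that the product of classes
  requires.\<close>

lemma ex_orbit_monomial:
  assumes "finite K"
  shows "\<exists>I P. orbit_monomial I P M \<and> I \<inter> K = {}"
proof (induction M)
  case empty
  then show ?case
    using orbit_monomial.empty by blast
next
  case (add a M)
  then obtain I P where P: "orbit_monomial I P M" "I \<inter> K = {}"
    by blast
  have "finite I"
    using orbit_monomial_degree[OF P(1)] by simp
  then have "infinite (UNIV - (I \<union> K))"
    using assms by (simp add: Diff_infinite_finite)
  then obtain B where B: "finite B" "card B = sum_list (gen_composition a)" "B \<subseteq> UNIV - (I \<union> K)"
    using infinite_arbitrarily_large by blast
  obtain X :: "real multiset" where X: "mtype X = gen_composition a"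
    using mtype_surj[OF composition_gen] by blast
  then have "size X = card B"
    using sum_mtype[of X] B(2) by simp
  then obtain p where "supp p \<subseteq> B" "vals B p = X"
    using ex_vals[OF B(1)] by blast
  moreover have "B \<inter> I = {}"
    using B(3) by blast
  ultimately have "orbit_monomial (B \<union> I) (poly_prod (orbit_polytope B p) P) (add_mset a M)"
    using B(1) X P(1) by (intro orbit_monomial.add) auto
  moreover have "(B \<union> I) \<inter> K = {}"
    using B(3) P(2) by blast
  ultimately show ?case
    by blast
qed

section \<open>The bijection of bases and the structure maps on it\<close>

definition op_of :: "monomial \<Rightarrow> op_class" where
  "op_of M = Abs_op_class (monomial_class M)"

lemma op_cls_normal_class: "orbit_monomial I P M \<Longrightarrow> op_cls I (normal_class I P) = op_of M"
  by (simp add: op_of_def iso_class_normal_class)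

lemma representatives_op_of: "representatives (op_of M) = monomial_class M"
proof -
  obtain I P where P: "orbit_monomial I P M"
    using ex_orbit_monomial[of "{}"] by blast
  then have "orbit_product I P" "finite I"
    using orbit_monomial_imp_orbit_product orbit_product_finite by blast+
  then have "monomial_class M \<in> {iso_class I x | I x. finite I \<and> x \<in> OP_bar I}"
    using iso_class_normal_class[OF P] by (auto simp: OP_bar_def)
  then show ?thesis
    unfolding op_of_def by (rule Abs_op_class_inverse)
qed

lemma mem_representatives_op_of:
  "(I, x) \<in> representatives (op_of M) \<longleftrightarrow> (\<exists>P. x = normal_class I P \<and> orbit_monomial I P M)"
  by (auto simp: representatives_op_of monomial_class_def)

text \<open>Injective because the preorder determines the monomial, surjective because every product
  can be split into blocks that carry generators.\<close>

lemma bij_op_of: "bij op_of"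
proof (rule bijI)
  show "inj op_of"
  proof (rule injI)
    fix M N
    assume eq: "op_of M = op_of N"
    obtain I P where P: "orbit_monomial I P M"
      using ex_orbit_monomial[of "{}"] by blast
    then have "(I, normal_class I P) \<in> representatives (op_of N)"
      using eq mem_representatives_op_of by metis
    then obtain Q where Q: "normal_class I P = normal_class I Q" "orbit_monomial I Q N"
      using mem_representatives_op_of by blast
    then have "orbit_equiv I P Q"
      using P normal_class_eq_iff orbit_monomial_imp_orbit_product by blast
    then show "M = N"
      using orbit_monomial_unique[OF P Q(2)] orbit_equiv_amax_le by blast
  qed
  show "surj op_of"
  proof (rule surjI)
    fix c
    obtain I x where I: "representatives c = iso_class I x" "x \<in> OP_bar I"
      using representatives[of c] by blast
    then obtain P where P: "orbit_product I P" "x = normal_class I P"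
      by (auto simp: OP_bar_def)
    then obtain M where "orbit_monomial I P M"
      using orbit_product_imp_orbit_monomial by blast
    then have "op_of M = c"
      using I(1) P(2) by (metis op_cls_normal_class representatives_inverse)
    then show "op_of (SOME M. op_of M = c) = c"
      by (rule someI)
  qed
qed

lemma op_degree_op_of: "op_degree (op_of M) = comp_degree M"
  unfolding op_degree_def
proof (rule the_equality)
  obtain I P where P: "orbit_monomial I P M"
    using ex_orbit_monomial[of "{}" M] by auto
  then have "(I, normal_class I P) \<in> representatives (op_of M)"
    by (auto simp: mem_representatives_op_of)
  with orbit_monomial_degree[OF P]
  show "\<exists>I x. (I, x) \<in> representatives (op_of M) \<and> comp_degree M = card I"
    by auto
next
  fix n
  assume "\<exists>I x. (I, x) \<in> representatives (op_of M) \<and> n = card I"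
  then obtain I P where "orbit_monomial I P M" "n = card I"
    by (auto simp: mem_representatives_op_of)
  then show "n = comp_degree M"
    by (simp add: orbit_monomial_degree)
qed

lemma class_prod_normal_class:
  assumes "orbit_product I P" "orbit_product J Q" "I \<inter> J = {}"
  shows "class_prod (I \<union> J) (normal_class I P) (normal_class J Q) = normal_class (I \<union> J) (poly_prod P Q)"
proof -
  have c: "normal_class (I \<union> J) (poly_prod P' Q') = normal_class (I \<union> J) (poly_prod P Q)"
    if "orbit_equiv I P P'" "orbit_equiv J Q Q'" for P' Q'
    using normal_class_cong[OF orbit_equiv.product[OF that assms(3)]] by simp
  have "(\<Union>Q'\<in>normal_class J Q. normal_class (I \<union> J) (poly_prod P' Q')) = normal_class (I \<union> J) (poly_prod P Q)"
    if "orbit_equiv I P P'" for P'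
    using UN_normal_class[OF assms(2), of "\<lambda>Q'. normal_class (I \<union> J) (poly_prod P' Q')"]
      c[OF that] orbit_equiv_refl[OF assms(2)] by simp
  then show ?thesis
    unfolding class_prod_def
    using UN_normal_class[OF assms(1), of "\<lambda>P'. \<Union>Q'\<in>normal_class J Q. normal_class (I \<union> J) (poly_prod P' Q')"]
      orbit_equiv_refl[OF assms(1)] by simp
qed

lemma op_basis_mult_op_of: "op_basis_mult (op_of M) (op_of N) = op_of (M + N)"
  unfolding op_basis_mult_def
proof (rule the_equality)
  have prod: "op_cls (I \<union> J) (class_prod (I \<union> J) (normal_class I P) (normal_class J Q)) = op_of (M + N)"
    if "orbit_monomial I P M" "orbit_monomial J Q N" "I \<inter> J = {}" for I P J Q
    using that by (simp add: class_prod_normal_class orbit_monomial_imp_orbit_product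
        op_cls_normal_class[OF orbit_monomial_union])
  obtain I P where P: "orbit_monomial I P M"
    using ex_orbit_monomial[of "{}"] by blast
  then obtain J Q where Q: "orbit_monomial J Q N" "J \<inter> I = {}"
    using ex_orbit_monomial[of I N] orbit_monomial_degree by blast
  have "I \<inter> J = {}"
    using Q(2) by blast
  then show "\<exists>I x J y. (I, x) \<in> representatives (op_of M) \<and> (J, y) \<in> representatives (op_of N) \<and> I \<inter> J = {} \<and>
      op_of (M + N) = op_cls (I \<union> J) (class_prod (I \<union> J) x y)"
  proof (intro exI conjI)
    show "(I, normal_class I P) \<in> representatives (op_of M)" "(J, normal_class J Q) \<in> representatives (op_of N)"
      using P Q(1) by (auto simp: mem_representatives_op_of)
  qed (use prod[OF P Q(1)] \<open>I \<inter> J = {}\<close> in auto)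
  show "e = op_of (M + N)"
    if "\<exists>I x J y. (I, x) \<in> representatives (op_of M) \<and> (J, y) \<in> representatives (op_of N) \<and> I \<inter> J = {} \<and>
      e = op_cls (I \<union> J) (class_prod (I \<union> J) x y)" for e
    using that prod by (auto simp: mem_representatives_op_of)
qed

lemma op_unit_eq: "op_unit = basis_vec (op_of {#})"
proof -
  have "orbit_polytope {} 0 = {0}"
    by (rule orbit_polytope_const[of _ _ 0]) auto
  then show ?thesis
    using op_cls_normal_class[OF orbit_monomial.empty] by (simp add: op_unit_def)
qed

text \<open>Nonempty factors with disjoint supports are determined by their product, which makes the
  definite description meaningful.\<close>

lemma face_factors_eqI:
  assumes "orbit_product S A" "orbit_product T B" "S \<inter> T = {}" "max_face S P = poly_prod A B"
  shows "face_factors S T P = (A, B)"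
  unfolding face_factors_def
proof (rule the_equality)
  fix c
  assume "case c of (A', B') \<Rightarrow> orbit_product S A' \<and> orbit_product T B' \<and> max_face S P = poly_prod A' B'"
  then obtain A' B' where c: "c = (A', B')" "orbit_product S A'" "orbit_product T B'" "poly_prod A B = poly_prod A' B'"
    using assms(4) by auto
  note supp = assms(1,2)[THEN orbit_product_polytope_in, THEN polytope_in_supported]
    c(2,3)[THEN orbit_product_polytope_in, THEN polytope_in_supported]
  note ne = assms(1,2)[THEN orbit_product_polytope_in, THEN polytope_in_nonempty]
    c(2,3)[THEN orbit_product_polytope_in, THEN polytope_in_nonempty]
  have "A \<subseteq> A' \<and> B \<subseteq> B'" "A' \<subseteq> A \<and> B' \<subseteq> B"
    using poly_prod_subset_iff[OF assms(3) supp(1,3,2,4) ne(1,2)]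
      poly_prod_subset_iff[OF assms(3) supp(3,1,4,2) ne(3,4)] c(4) by auto
  with c(1) show "c = (A, B)"
    by auto
qed (use assms in auto)

lemma class_restrict_contract:
  assumes "orbit_product I P" "S \<subseteq> I" "orbit_product S A" "orbit_product (I - S) B" "max_face S P = poly_prod A B"
  shows "class_restrict S (I - S) (normal_class I P) = normal_class S A"
    and "class_contract S (I - S) (normal_class I P) = normal_class (I - S) B"
proof -
  have disj: "S \<inter> (I - S) = {}"
    by blast
  have ff: "face_factors S (I - S) P = (A, B)"
    using assms disj by (intro face_factors_eqI)
  have *: "normal_class S (fst (face_factors S (I - S) Q)) = normal_class S A \<and>
      normal_class (I - S) (snd (face_factors S (I - S) Q)) = normal_class (I - S) B"
    if Q: "orbit_equiv I P Q" for Q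
  proof -
    obtain C D C' D' where C: "orbit_equiv S C C'" "orbit_equiv (I - S) D D'"
      "max_face S P = poly_prod C D" "max_face S Q = poly_prod C' D'"
      using orbit_equiv_max_face[OF Q assms(2)] by (elim exE conjE) (rule that)
    have "face_factors S (I - S) P = (C, D)" "face_factors S (I - S) Q = (C', D')"
      using C disj orbit_equiv_orbit_product by (blast intro!: face_factors_eqI)+
    with ff C(1,2) show ?thesis
      using normal_class_cong by simp
  qed
  show "class_restrict S (I - S) (normal_class I P) = normal_class S A"
    unfolding class_restrict_def
    using UN_normal_class[OF assms(1), of "\<lambda>Q. normal_class S (fst (face_factors S (I - S) Q))"] * ff by simp
  show "class_contract S (I - S) (normal_class I P) = normal_class (I - S) B"
    unfolding class_contract_def
    using UN_normal_class[OF assms(1), of "\<lambda>Q. normal_class (I - S) (snd (face_factors S (I - S) Q))"] * ff by simp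
qed

abbreviation op_map :: "(monomial \<Rightarrow>\<^sub>0 'k::field) \<Rightarrow> (op_class \<Rightarrow>\<^sub>0 'k)" where
  "op_map \<equiv> lin_ext (\<lambda>M. basis_vec (op_of M))"

lemma op_basis_comult_op_of:
  "op_basis_comult (op_of M) = (tensor_map op_map op_map (comp_comult (basis_vec M)) :: _ \<Rightarrow>\<^sub>0 'k::field)"
  (is "_ = ?rhs")
proof -
  let ?sum = "\<lambda>I x. \<Sum>(S, T) \<in> {(S, T). S \<union> T = I \<and> S \<inter> T = {}}.
    tensor (basis_vec (op_cls S (class_restrict S T x))) (basis_vec (op_cls T (class_contract S T x))) :: _ \<Rightarrow>\<^sub>0 'k"
  have sum: "?sum I (normal_class I P) = ?rhs"
    if P: "orbit_monomial I P M" for I P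
  proof -
    obtain A B f g where A: "\<And>S. S \<subseteq> I \<Longrightarrow> orbit_monomial S (A S) (f S)"
        "\<And>S. S \<subseteq> I \<Longrightarrow> orbit_monomial (I - S) (B S) (g S)"
        "\<And>S. S \<subseteq> I \<Longrightarrow> max_face S P = poly_prod (A S) (B S)"
      and comult: "(\<Sum>S\<in>Pow I. basis_vec (f S, g S)) = (comp_comult (basis_vec M) :: _ \<Rightarrow>\<^sub>0 'k)"
      using orbit_monomial_max_face[OF P] by (elim exE conjE) (rule that, simp_all)
    have cls: "op_cls S (class_restrict S (I - S) (normal_class I P)) = op_of (f S) \<and>
        op_cls (I - S) (class_contract S (I - S) (normal_class I P)) = op_of (g S)" if S: "S \<subseteq> I" for S
      using class_restrict_contract[OF orbit_monomial_imp_orbit_product[OF P] S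
          orbit_monomial_imp_orbit_product[OF A(1)[OF S]] orbit_monomial_imp_orbit_product[OF A(2)[OF S]] A(3)[OF S]]
        op_cls_normal_class A(1,2)[OF S] by simp
    have pairs: "{(S, T). S \<union> T = I \<and> S \<inter> T = {}} = (\<lambda>S. (S, I - S)) ` Pow I"
      by auto
    have "?sum I (normal_class I P) =
        (\<Sum>S\<in>Pow I. basis_vec (op_of (f S), op_of (g S)) :: _ \<Rightarrow>\<^sub>0 'k)"
      unfolding pairs by (subst sum.reindex) (simp_all add: inj_on_def cls)
    also have "\<dots> = tensor_map op_map op_map (\<Sum>S\<in>Pow I. basis_vec (f S, g S))"
      by (simp add: linear_map_sum[OF linear_tensor_map] tensor_map_basis)
    finally show ?thesis
      by (simp only: comult)
  qed
  show ?thesis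
    unfolding op_basis_comult_def
  proof (rule the_equality)
    obtain I P where P: "orbit_monomial I P M"
      using ex_orbit_monomial[of "{}"] by blast
    show "\<exists>I x. (I, x) \<in> representatives (op_of M) \<and> ?rhs = ?sum I x"
    proof (intro exI conjI)
      show "(I, normal_class I P) \<in> representatives (op_of M)"
        using P by (auto simp: mem_representatives_op_of)
    qed (simp only: sum[OF P])
    show "t = ?rhs" if t: "\<exists>I x. (I, x) \<in> representatives (op_of M) \<and> t = ?sum I x" for t
    proof -
      obtain I P where P: "orbit_monomial I P M" and "t = ?sum I (normal_class I P)"
        using t by (auto simp only: mem_representatives_op_of)
      then show ?thesis
        by (simp only: sum[OF P])
    qed
  qed
qed

theorem theorem4p21:
  shows "\<exists>(\<epsilon> :: (monomial \<Rightarrow>\<^sub>0 'k::field) \<Rightarrow> 'k) S.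
           graded_hopf_algebra (comp_hopf \<epsilon> S) \<and>
           (\<exists>(\<epsilon>' :: (op_class \<Rightarrow>\<^sub>0 'k) \<Rightarrow> 'k) S'.
              graded_hopf_algebra (op_hopf \<epsilon>' S') \<and>
              graded_hopf_isomorphic (comp_hopf \<epsilon> S) (op_hopf \<epsilon>' S'))"
proof -
  \<comment> \<open>The inverse of \<open>op_map\<close>. Counit and antipode of the polytope side
    are conjugated along it; only product, coproduct and unit, given geometrically, have to be
    compared.\<close>
  let ?\<psi> = "lin_ext (\<lambda>c. basis_vec (inv op_of c)) :: (op_class \<Rightarrow>\<^sub>0 'k) \<Rightarrow> (monomial \<Rightarrow>\<^sub>0 'k)"
  let ?A = "comp_hopf comp_counit comp_antipode :: (monomial, 'k) hopf"
  let ?\<epsilon> = "\<lambda>f. comp_counit (?\<psi> f)" and ?S = "\<lambda>f. op_map (comp_antipode (?\<psi> f))"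
  let ?B = "op_hopf ?\<epsilon> ?S :: (op_class, 'k) hopf"
  have inv: "op_of (inv op_of c) = c" for c
    using bij_op_of by (simp add: bij_is_surj surj_f_inv_f)
  have mult: "op_mult f g = op_map (?\<psi> f * ?\<psi> g)" for f g :: "op_class \<Rightarrow>\<^sub>0 'k"
  proof (rule bilinear_map_eqI[where B = op_mult and B' = "\<lambda>f g. op_map (?\<psi> f * ?\<psi> g)"])
    show "bilinear_map (op_mult :: (_ \<Rightarrow>\<^sub>0 'k) \<Rightarrow> _)"
      unfolding op_mult_def
      by (rule bilinear_mapI) (simp_all add: lin_ext_bilinear)
    show "bilinear_map (\<lambda>f g. op_map (?\<psi> f * ?\<psi> g))"
      by (rule bilinear_mapI)
        (simp_all add: lin_ext_add lin_ext_scale algebra_simps pscale_mult_left pscale_mult_right)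
    show "op_mult (basis_vec c) (basis_vec d) = op_map (?\<psi> (basis_vec c) * ?\<psi> (basis_vec d))" for c d
      using op_basis_mult_op_of[of "inv op_of c" "inv op_of d"] by (simp add: op_mult_def basis_vec_mult inv)
  qed
  have comult: "op_comult f = tensor_map op_map op_map (comp_comult (?\<psi> f))" for f :: "op_class \<Rightarrow>\<^sub>0 'k"
  proof (rule linear_map_eqI[where L = op_comult
        and L' = "\<lambda>f. tensor_map op_map op_map (comp_comult (?\<psi> f))"])
    show "linear_map (op_comult :: (_ \<Rightarrow>\<^sub>0 'k) \<Rightarrow> _)"
      unfolding op_comult_def by (rule linear_lin_ext)
    show "linear_map (\<lambda>f. tensor_map op_map op_map (comp_comult (?\<psi> f)))"
      by (intro linear_map_comp[OF linear_tensor_map] linear_map_comp[OF alg_homD(1)[OF alg_hom_comp_comult]] linear_lin_ext)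
    show "op_comult (basis_vec c) = tensor_map op_map op_map (comp_comult (?\<psi> (basis_vec c)))" for c
      using op_basis_comult_op_of[of "inv op_of c"] by (simp add: op_comult_def inv)
  qed
  have unit: "op_unit = op_map (1 :: monomial \<Rightarrow>\<^sub>0 'k)"
    by (simp add: op_unit_eq flip: basis_vec_zero)
  have "graded_hopf_algebra ?B \<and> graded_hopf_iso ?A ?B op_map"
    by (intro conjI graded_hopf_transport[OF graded_hopf_algebra_comp bij_op_of])
      (simp_all add: comp_hopf_def op_hopf_def op_degree_op_of mult comult unit)
  then show ?thesis
    using graded_hopf_algebra_comp unfolding graded_hopf_isomorphic_def by blast
qed

end
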